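(* Let $K$ be a field and let $\mathcal G$ be a second-countable ample groupoid (not necessarily Hausdorff), with unit space $\mathcal G^0$. Then the Steinberg algebra $K\mathcal G$ is GCR if and only if the orbit space $\mathcal G^0/\mathcal G$ is $T_0$ and the isotropy group rings $KG_u$, $u\in\mathcal G^0$, are all GCR. In particular, if all isotropy groups of $\mathcal G$ are virtually abelian, then $\mathbb C\mathcal G$ is GCR if and only if $\mathcal G^0/\mathcal G$ is $T_0$.
   Context: Rings are not assumed unital; "ideal" means two-sided ideal. A left module $M$ over a ring $R$ is simple if $RM\neq 0$ and its only submodules are $0$ and $M$. A ring is (left) primitive if it has a faithful simple left module. A minimal left ideal is a simple submodule of the left regular module $R$. A ring $R$ is GCR if every primitive quotient ring of $R$ has a minimal left ideal. A topological groupoid $\mathcal G$ with arrow space $\mathcal G^1$ and object (unit) space $\mathcal G^0\subseteq\mathcal G^1$, source $s$ and range $r$, is étale if $s:\mathcal G^1\to\mathcal G^0$ is a local homeomorphism; it is ample if moreover $\mathcal G^0$ is Hausdorff with a basis of compact open sets. "Compact" includes Hausdorff; $\mathcal G^1$ is not assumed Hausdorff. Second-countable means $\mathcal G^1$ is second countable. The orbit equivalence relation on $\mathcal G^0$ is $u\sim v$ iff there is an arrow $\gamma:u\to v$ (i.e. $s(\gamma)=u$, $r(\gamma)=v$); the orbit space $\mathcal G^0/\mathcal G$ is the quotient space (quotient topology). The isotropy group $G_u$ is the group of all arrows $u\to u$. A group is virtually abelian if it has an abelian subgroup of finite index. A bisection is an open subset $U\subseteq \mathcal G^1$ on which $s$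 and $r$ are injective. The Steinberg algebra $K\mathcal G$ is the $K$-linear span, in the space of functions $\mathcal G^1\to K$, of the characteristic functions $1_U$ of compact open bisections $U$, with convolution product $(f\ast g)(\gamma)=\sum_{s(\alpha)=s(\gamma)}f(\gamma\alpha^{-1})g(\alpha)$. *)

theory Defs
  imports "HOL-Analysis.Analysis" "HOL-Algebra.Module" "HOL-Algebra.QuotRing"
begin

section \<open>Rings without unit, primitivity and the GCR property\<close>

text \<open>
  Rings are carried by the record type of HOL-Algebra, so that additive subgroups, cosets and
  the quotient \<open>R Quot I\<close> can be reused.  The field \<open>one\<close> of that record is never looked at.
\<close>

locale nonunital_ring = abelian_group R for R (structure) +
  assumes m_closed: "\<lbrakk>x \<in> carrier R; y \<in> carrier R\<rbrakk> \<Longrightarrow> x \<otimes> y \<in> carrier R"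
    and m_assoc: "\<lbrakk>x \<in> carrier R; y \<in> carrier R; z \<in> carrier R\<rbrakk>
      \<Longrightarrow> (x \<otimes> y) \<otimes> z = x \<otimes> (y \<otimes> z)"
    and l_distr: "\<lbrakk>x \<in> carrier R; y \<in> carrier R; z \<in> carrier R\<rbrakk>
      \<Longrightarrow> (x \<oplus> y) \<otimes> z = x \<otimes> z \<oplus> y \<otimes> z"
    and r_distr: "\<lbrakk>x \<in> carrier R; y \<in> carrier R; z \<in> carrier R\<rbrakk>
      \<Longrightarrow> z \<otimes> (x \<oplus> y) = z \<otimes> x \<oplus> z \<otimes> y"

locale two_sided_ideal = additive_subgroup I R for I and R (structure) +
  assumes I_l_closed: "\<lbrakk>a \<in> I; x \<in> carrier R\<rbrakk> \<Longrightarrow> x \<otimes> a \<in> I"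
    and I_r_closed: "\<lbrakk>a \<in> I; x \<in> carrier R\<rbrakk> \<Longrightarrow> a \<otimes> x \<in> I"

text \<open>
  The HOL-Algebra locale \<open>module\<close> demands a commutative unital ring of scalars, hence the new
  locale; the record type \<open>module\<close> and the locale \<open>submodule\<close> carry no such restriction.
\<close>

locale left_module = R?: nonunital_ring R + M?: abelian_group M
    for R (structure) and M (structure) +
  assumes smult_closed: "\<lbrakk>a \<in> carrier R; x \<in> carrier M\<rbrakk> \<Longrightarrow> a \<odot>\<^bsub>M\<^esub> x \<in> carrier M"
    and smult_l_distr: "\<lbrakk>a \<in> carrier R; b \<in> carrier R; x \<in> carrier M\<rbrakk>
      \<Longrightarrow> (a \<oplus>\<^bsub>R\<^esub> b) \<odot>\<^bsub>M\<^esub> x = a \<odot>\<^bsub>M\<^esub> x \<oplus>\<^bsub>M\<^esub> b \<odot>\<^bsub>M\<^esub> x"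
    and smult_r_distr: "\<lbrakk>a \<in> carrier R; x \<in> carrier M; y \<in> carrier M\<rbrakk>
      \<Longrightarrow> a \<odot>\<^bsub>M\<^esub> (x \<oplus>\<^bsub>M\<^esub> y) = a \<odot>\<^bsub>M\<^esub> x \<oplus>\<^bsub>M\<^esub> a \<odot>\<^bsub>M\<^esub> y"
    and smult_assoc: "\<lbrakk>a \<in> carrier R; b \<in> carrier R; x \<in> carrier M\<rbrakk>
      \<Longrightarrow> (a \<otimes>\<^bsub>R\<^esub> b) \<odot>\<^bsub>M\<^esub> x = a \<odot>\<^bsub>M\<^esub> (b \<odot>\<^bsub>M\<^esub> x)"

definition simple_left_module :: "('a, 'c) ring_scheme \<Rightarrow> ('a, 'b, 'd) module_scheme \<Rightarrow> bool" where
  "simple_left_module R M \<longleftrightarrow> left_module R M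
     \<and> (\<exists>a\<in>carrier R. \<exists>x\<in>carrier M. a \<odot>\<^bsub>M\<^esub> x \<noteq> \<zero>\<^bsub>M\<^esub>)
     \<and> (\<forall>N. submodule N R M \<longrightarrow> N = {\<zero>\<^bsub>M\<^esub>} \<or> N = carrier M)"

definition faithful_left_module :: "('a, 'c) ring_scheme \<Rightarrow> ('a, 'b, 'd) module_scheme \<Rightarrow> bool" where
  "faithful_left_module R M \<longleftrightarrow> left_module R M
     \<and> (\<forall>a\<in>carrier R. (\<forall>x\<in>carrier M. a \<odot>\<^bsub>M\<^esub> x = \<zero>\<^bsub>M\<^esub>) \<longrightarrow> a = \<zero>\<^bsub>R\<^esub>)"

text \<open>
  HOL cannot quantify over the type of elements of the module.  Taking sets of ring elements
  loses nothing: a simple module is generated by one element \<open>x\<close>, hence isomorphic to the module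
  of fibres of \<open>r \<mapsto> r x\<close>, and \<open>left_primitiveI\<close> below lifts the restriction.
\<close>

definition left_primitive :: "('a, 'c) ring_scheme \<Rightarrow> bool" where
  "left_primitive R \<longleftrightarrow>
     (\<exists>M :: ('a, 'a set) module. simple_left_module R M \<and> faithful_left_module R M)"

definition left_regular_module :: "('a, 'c) ring_scheme \<Rightarrow> ('a, 'a) module" where
  "left_regular_module R = \<lparr>carrier = carrier R, mult = mult R, one = one R,
     zero = zero R, add = add R, smult = mult R\<rparr>"

definition minimal_left_ideal :: "('a, 'c) ring_scheme \<Rightarrow> 'a set \<Rightarrow> bool" where
  "minimal_left_ideal R L \<longleftrightarrow> submodule L R (left_regular_module R)
     \<and> simple_left_module R ((left_regular_module R)\<lparr>carrier := L\<rparr>)"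

definition GCR :: "('a, 'c) ring_scheme \<Rightarrow> bool" where
  "GCR R \<longleftrightarrow> (\<forall>I. two_sided_ideal I R \<and> left_primitive (R Quot I)
     \<longrightarrow> (\<exists>L. minimal_left_ideal (R Quot I) L))"


section \<open>Groups\<close>

definition virtually_abelian :: "('a, 'c) monoid_scheme \<Rightarrow> bool" where
  "virtually_abelian G \<longleftrightarrow>
     (\<exists>H. subgroup H G \<and> comm_group (G\<lparr>carrier := H\<rparr>) \<and> finite (rcosets\<^bsub>G\<^esub> H))"

text \<open>Elements of the group ring are finitely supported functions, extended by \<open>0\<close> off the group.\<close>

definition group_ring :: "('a, 'c) monoid_scheme \<Rightarrow> ('a \<Rightarrow> 'k::field) ring" where
  "group_ring G =
    \<lparr>carrier = {f. finite {x. f x \<noteq> 0} \<and> {x. f x \<noteq> 0} \<subseteq> carrier G},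
     mult = (\<lambda>f g x. if x \<in> carrier G
       then \<Sum>y\<in>{y \<in> carrier G. g y \<noteq> 0}. f (x \<otimes>\<^bsub>G\<^esub> inv\<^bsub>G\<^esub> y) * g y else 0),
     one = (\<lambda>x. if x = \<one>\<^bsub>G\<^esub> then 1 else 0),
     zero = (\<lambda>x. 0),
     add = (\<lambda>f g x. f x + g x)\<rparr>"


section \<open>Ample groupoids\<close>

definition local_homeomorphism :: "'a topology \<Rightarrow> 'b topology \<Rightarrow> ('a \<Rightarrow> 'b) \<Rightarrow> bool" where
  "local_homeomorphism X Y f \<longleftrightarrow> (\<forall>x\<in>topspace X. \<exists>U. openin X U \<and> x \<in> U \<and> openin Y (f ` U)
     \<and> homeomorphic_map (subtopology X U) (subtopology Y (f ` U)) f)"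

text \<open>The arrow space need not be Hausdorff, while "compact" is meant to include Hausdorff.\<close>

definition compact_Hausdorff_in :: "'a topology \<Rightarrow> 'a set \<Rightarrow> bool" where
  "compact_Hausdorff_in X S \<longleftrightarrow> compactin X S \<and> Hausdorff_space (subtopology X S)"

text \<open>
  Units are identified with identity arrows.  \<open>gcomp G x y\<close> is the composite of \<open>y\<close> followed by \<open>x\<close>,
  meaningful when \<open>src G x = tgt G y\<close>; \<open>tgt\<close> is the range map.
\<close>

record 'a groupoid =
  arrows :: "'a topology"
  src :: "'a \<Rightarrow> 'a"
  tgt :: "'a \<Rightarrow> 'a"
  gcomp :: "'a \<Rightarrow> 'a \<Rightarrow> 'a"
  ginv :: "'a \<Rightarrow> 'a"

definition units :: "'a groupoid \<Rightarrow> 'a set" where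
  "units G = src G ` topspace (arrows G)"

definition unit_space :: "'a groupoid \<Rightarrow> 'a topology" where
  "unit_space G = subtopology (arrows G) (units G)"

definition composable :: "'a groupoid \<Rightarrow> ('a \<times> 'a) set" where
  "composable G = {(x, y). x \<in> topspace (arrows G) \<and> y \<in> topspace (arrows G) \<and> src G x = tgt G y}"

locale topological_groupoid =
  fixes G :: "'a groupoid"
  assumes src_arrow: "x \<in> topspace (arrows G) \<Longrightarrow> src G x \<in> topspace (arrows G)"
    and tgt_unit: "x \<in> topspace (arrows G) \<Longrightarrow> tgt G x \<in> units G"
    and src_of_unit: "u \<in> units G \<Longrightarrow> src G u = u"
    and tgt_of_unit: "u \<in> units G \<Longrightarrow> tgt G u = u"
    and comp_arrow: "(x, y) \<in> composable G \<Longrightarrow> gcomp G x y \<in> topspace (arrows G)"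
    and src_comp: "(x, y) \<in> composable G \<Longrightarrow> src G (gcomp G x y) = src G y"
    and tgt_comp: "(x, y) \<in> composable G \<Longrightarrow> tgt G (gcomp G x y) = tgt G x"
    and comp_assoc: "\<lbrakk>(x, y) \<in> composable G; (y, z) \<in> composable G\<rbrakk>
      \<Longrightarrow> gcomp G (gcomp G x y) z = gcomp G x (gcomp G y z)"
    and comp_src: "x \<in> topspace (arrows G) \<Longrightarrow> gcomp G x (src G x) = x"
    and comp_tgt: "x \<in> topspace (arrows G) \<Longrightarrow> gcomp G (tgt G x) x = x"
    and inv_arrow: "x \<in> topspace (arrows G) \<Longrightarrow> ginv G x \<in> topspace (arrows G)"
    and src_inv: "x \<in> topspace (arrows G) \<Longrightarrow> src G (ginv G x) = tgt G x"
    and tgt_inv: "x \<in> topspace (arrows G) \<Longrightarrow> tgt G (ginv G x) = src G x"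
    and inv_comp: "x \<in> topspace (arrows G) \<Longrightarrow> gcomp G (ginv G x) x = src G x"
    and comp_inv: "x \<in> topspace (arrows G) \<Longrightarrow> gcomp G x (ginv G x) = tgt G x"
    and continuous_src: "continuous_map (arrows G) (unit_space G) (src G)"
    and continuous_tgt: "continuous_map (arrows G) (unit_space G) (tgt G)"
    and continuous_inv: "continuous_map (arrows G) (arrows G) (ginv G)"
    and continuous_comp:
      "continuous_map (subtopology (prod_topology (arrows G) (arrows G)) (composable G)) (arrows G)
         (\<lambda>(x, y). gcomp G x y)"

locale etale_groupoid = topological_groupoid +
  assumes etale: "local_homeomorphism (arrows G) (unit_space G) (src G)"

locale ample_groupoid = etale_groupoid +
  assumes Hausdorff_units: "Hausdorff_space (unit_space G)"
    and compact_open_basis: "\<lbrakk>openin (unit_space G) W; u \<in> W\<rbrakk>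
      \<Longrightarrow> \<exists>V. openin (unit_space G) V \<and> compact_Hausdorff_in (unit_space G) V \<and> u \<in> V \<and> V \<subseteq> W"

definition orbit_rel :: "'a groupoid \<Rightarrow> ('a \<times> 'a) set" where
  "orbit_rel G = {(u, v). \<exists>x\<in>topspace (arrows G). src G x = u \<and> tgt G x = v}"

definition orbit_space :: "'a groupoid \<Rightarrow> 'a set topology" where
  "orbit_space G =
     topology (\<lambda>V. V \<subseteq> units G // orbit_rel G \<and> openin (unit_space G) (\<Union>V))"

definition isotropy_group :: "'a groupoid \<Rightarrow> 'a \<Rightarrow> 'a monoid" where
  "isotropy_group G u =
     \<lparr>carrier = {x \<in> topspace (arrows G). src G x = u \<and> tgt G x = u}, mult = gcomp G, one = u\<rparr>"


section \<open>The Steinberg algebra\<close>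

definition bisection :: "'a groupoid \<Rightarrow> 'a set \<Rightarrow> bool" where
  "bisection G U \<longleftrightarrow> openin (arrows G) U \<and> inj_on (src G) U \<and> inj_on (tgt G) U"

text \<open>
  Elements are functions that vanish off the arrow space.  In the convolution product the sum runs
  only over those \<open>y\<close> with \<open>g y \<noteq> 0\<close>: the other terms vanish, and for \<open>g\<close> in the carrier this makes
  the index set finite, as a bisection meets each fibre of the source map at most once.
\<close>

definition steinberg_algebra :: "'a groupoid \<Rightarrow> ('a \<Rightarrow> 'k::field) ring" where
  "steinberg_algebra G =
    \<lparr>carrier = {f. \<exists>F c. finite F
       \<and> (\<forall>U\<in>F. bisection G U \<and> compact_Hausdorff_in (arrows G) U)
       \<and> f = (\<lambda>x. \<Sum>U\<in>F. c U * indicator U x)},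
     mult = (\<lambda>f g x. if x \<in> topspace (arrows G)
       then \<Sum>y\<in>{y \<in> topspace (arrows G). src G y = src G x \<and> g y \<noteq> 0}.
              f (gcomp G x (ginv G y)) * g y
       else 0),
     one = undefined,
     zero = (\<lambda>x. 0),
     add = (\<lambda>f g x. f x + g x)\<rparr>"


section \<open>Consistency of the encodings\<close>

lemma left_primitiveI:
  fixes M :: "('a, 'b, 'd) module_scheme"
  assumes simple: "simple_left_module R M" and faithful: "faithful_left_module R M"
  shows "left_primitive R"
proof -
  interpret left_module R M using simple by (simp add: simple_left_module_def)
  obtain a0 m where m: "m \<in> carrier M" and a0: "a0 \<in> carrier R" "a0 \<odot>\<^bsub>M\<^esub> m \<noteq> \<zero>\<^bsub>M\<^esub>"
    using simple by (auto simp: simple_left_module_def)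
  have z1: "\<zero>\<^bsub>R\<^esub> \<odot>\<^bsub>M\<^esub> x = \<zero>\<^bsub>M\<^esub>" if "x \<in> carrier M" for x
    using smult_l_distr[of "\<zero>\<^bsub>R\<^esub>" "\<zero>\<^bsub>R\<^esub>" x] smult_closed[of "\<zero>\<^bsub>R\<^esub>" x] that
    by (metis M.add.r_cancel_one' R.l_zero R.zero_closed)
  have neg: "\<ominus>\<^bsub>M\<^esub> (a \<odot>\<^bsub>M\<^esub> x) = (\<ominus>\<^bsub>R\<^esub> a) \<odot>\<^bsub>M\<^esub> x" if "a \<in> carrier R" "x \<in> carrier M" for a x
  proof -
    have "(\<ominus>\<^bsub>R\<^esub> a) \<odot>\<^bsub>M\<^esub> x \<oplus>\<^bsub>M\<^esub> a \<odot>\<^bsub>M\<^esub> x = \<zero>\<^bsub>M\<^esub>"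
      using smult_l_distr[of "\<ominus>\<^bsub>R\<^esub> a" a x] that z1 by (simp add: R.l_neg)
    then show ?thesis using M.minus_equality smult_closed that by simp
  qed
  let ?S = "(\<lambda>a. a \<odot>\<^bsub>M\<^esub> m) ` carrier R"
  have "submodule ?S R M"
  proof (intro submodule.intro submodule_axioms.intro M.add.subgroupI)
    show "?S \<subseteq> carrier M" using m smult_closed by auto
    show "?S \<noteq> {}" by auto
    show "\<ominus>\<^bsub>M\<^esub> x \<in> ?S" if "x \<in> ?S" for x
      using that m neg by auto
    show "x \<oplus>\<^bsub>M\<^esub> y \<in> ?S" if "x \<in> ?S" "y \<in> ?S" for x y
      using that m by (auto simp: smult_l_distr[symmetric])
    show "b \<odot>\<^bsub>M\<^esub> x \<in> ?S" if "b \<in> carrier R" "x \<in> ?S" for b x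
      using that m by (auto simp: smult_assoc[symmetric] m_closed)
  qed
  then have S: "?S = carrier M"
    using simple a0 by (auto simp: simple_left_module_def)
  define g where "g = (\<lambda>x. {a \<in> carrier R. a \<odot>\<^bsub>M\<^esub> m = x})"
  have inj: "inj_on g (carrier M)"
  proof (rule inj_onI)
    fix x y assume "x \<in> carrier M" "y \<in> carrier M" "g x = g y"
    moreover obtain a where "a \<in> g x"
    proof -
      have "x \<in> ?S" using \<open>x \<in> carrier M\<close> S by simp
      then show thesis using that by (auto simp: g_def)
    qed
    ultimately show "x = y" by (auto simp: g_def)
  qed
  define h where "h = inv_into (carrier M) g"
  have hg: "h (g x) = x" if "x \<in> carrier M" for x
    using inj that by (simp add: h_def)
  define N :: "('a, 'a set) module" where
    "N = \<lparr>carrier = g ` carrier M, mult = undefined, one = undefined, zero = g \<zero>\<^bsub>M\<^esub>,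
       add = (\<lambda>X Y. g (h X \<oplus>\<^bsub>M\<^esub> h Y)), smult = (\<lambda>a X. g (a \<odot>\<^bsub>M\<^esub> h X))\<rparr>"
  have abN: "abelian_group N"
  proof (rule abelian_groupI)
    show "\<exists>y\<in>carrier N. y \<oplus>\<^bsub>N\<^esub> x = \<zero>\<^bsub>N\<^esub>" if x: "x \<in> carrier N" for x
    proof -
      obtain x' where "x' \<in> carrier M" "x = g x'" using x by (auto simp: N_def)
      then show ?thesis
        by (intro bexI[of _ "g (\<ominus>\<^bsub>M\<^esub> x')"]) (auto simp: N_def hg M.l_neg)
    qed
  qed (auto simp: N_def hg M.a_ac)
  have lmN: "left_module R N"
    by (intro left_module.intro left_module_axioms.intro abN nonunital_ring_axioms)
      (auto simp: N_def hg smult_closed smult_l_distr smult_r_distr smult_assoc)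
  have nz: "\<exists>a\<in>carrier R. \<exists>x\<in>carrier N. a \<odot>\<^bsub>N\<^esub> x \<noteq> \<zero>\<^bsub>N\<^esub>"
  proof (intro bexI)
    show "a0 \<odot>\<^bsub>N\<^esub> g m \<noteq> \<zero>\<^bsub>N\<^esub>"
      using a0 m inj_onD[OF inj, of "a0 \<odot>\<^bsub>M\<^esub> m" "\<zero>\<^bsub>M\<^esub>"] smult_closed by (auto simp: N_def hg)
  qed (use a0 m in \<open>auto simp: N_def\<close>)
  have sub: "P = {\<zero>\<^bsub>N\<^esub>} \<or> P = carrier N" if P: "submodule P R N" for P
  proof -
    interpret P: submodule P R N by (rule P)
    have PN: "P \<subseteq> g ` carrier M" using P.subset by (simp add: N_def)
    then have hPM: "h ` P \<subseteq> carrier M" using hg by auto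
    have gh: "g ` h ` P = P"
    proof -
      have "g (h X) = X" if "X \<in> P" for X
        unfolding h_def using that PN by (intro f_inv_into_f) blast
      then show ?thesis by (simp add: image_image)
    qed
    have hP: "x \<in> h ` P" if "x \<in> carrier M" "g x \<in> P" for x
      using that hg by (metis imageI)
    have gP: "g x \<in> P" if "x \<in> h ` P" for x
      using that gh by blast
    have "submodule (h ` P) R M"
    proof (intro submodule.intro submodule_axioms.intro M.add.subgroupI)
      show "h ` P \<subseteq> carrier M" by (rule hPM)
      show "h ` P \<noteq> {}" using P.one_closed by auto
      show "x \<oplus>\<^bsub>M\<^esub> y \<in> h ` P" if xy: "x \<in> h ` P" "y \<in> h ` P" for x y
      proof (rule hP)
        have c: "x \<in> carrier M" "y \<in> carrier M" using xy hPM by blast+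
        then show "x \<oplus>\<^bsub>M\<^esub> y \<in> carrier M" by simp
        show "g (x \<oplus>\<^bsub>M\<^esub> y) \<in> P"
          using P.m_closed[OF gP[OF xy(1)] gP[OF xy(2)]] by (simp add: N_def hg c)
      qed
      show "b \<odot>\<^bsub>M\<^esub> x \<in> h ` P" if bx: "b \<in> carrier R" "x \<in> h ` P" for b x
      proof (rule hP)
        have c: "x \<in> carrier M" using bx hPM by blast
        then show "b \<odot>\<^bsub>M\<^esub> x \<in> carrier M" using smult_closed bx by simp
        show "g (b \<odot>\<^bsub>M\<^esub> x) \<in> P"
          using P.smult_closed[OF bx(1) gP[OF bx(2)]] by (simp add: N_def hg c)
      qed
      show "\<ominus>\<^bsub>M\<^esub> x \<in> h ` P" if x: "x \<in> h ` P" for x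
      proof -
        have xM: "x \<in> carrier M" using x hPM by auto
        interpret N: abelian_group N by (rule abN)
        have "g (\<ominus>\<^bsub>M\<^esub> x) = \<ominus>\<^bsub>N\<^esub> (g x)"
          by (rule N.minus_equality[symmetric]) (use xM in \<open>auto simp: N_def hg M.l_neg\<close>)
        then have "g (\<ominus>\<^bsub>M\<^esub> x) \<in> P"
          using P.m_inv_closed[OF gP[OF x]] by (simp add: a_inv_def)
        then show ?thesis using xM hP by simp
      qed
    qed
    then have "h ` P = {\<zero>\<^bsub>M\<^esub>} \<or> h ` P = carrier M"
      using simple by (simp add: simple_left_module_def)
    then show ?thesis
    proof
      assume "h ` P = {\<zero>\<^bsub>M\<^esub>}"
      with gh have "P = {g \<zero>\<^bsub>M\<^esub>}" by simp
      then show ?thesis by (simp add: N_def)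
    next
      assume "h ` P = carrier M"
      with gh have "P = g ` carrier M" by simp
      then show ?thesis by (simp add: N_def)
    qed
  qed
  have "simple_left_module R N"
    using lmN nz sub by (simp add: simple_left_module_def)
  moreover have "faithful_left_module R N"
    unfolding faithful_left_module_def
  proof (intro conjI ballI impI lmN)
    fix a assume a: "a \<in> carrier R" and 0: "\<forall>x\<in>carrier N. a \<odot>\<^bsub>N\<^esub> x = \<zero>\<^bsub>N\<^esub>"
    have "a \<odot>\<^bsub>M\<^esub> x = \<zero>\<^bsub>M\<^esub>" if x: "x \<in> carrier M" for x
    proof (rule inj_onD[OF inj])
      show "g (a \<odot>\<^bsub>M\<^esub> x) = g \<zero>\<^bsub>M\<^esub>"
        using 0 x hg[OF x] by (auto simp: N_def)
    qed (use a x smult_closed in auto)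
    then show "a = \<zero>\<^bsub>R\<^esub>" using faithful a by (simp add: faithful_left_module_def)
  qed
  ultimately show ?thesis unfolding left_primitive_def by blast
qed

context topological_groupoid
begin

lemma units_subset: "units G \<subseteq> topspace (arrows G)"
  by (auto simp: units_def src_arrow)

lemma topspace_unit_space: "topspace (unit_space G) = units G"
  using units_subset by (auto simp: unit_space_def)

lemma equiv_orbit_rel: "equiv (units G) (orbit_rel G)"
proof (rule equivI)
  show "orbit_rel G \<subseteq> units G \<times> units G"
    using tgt_unit by (auto simp: orbit_rel_def units_def)
  show "refl_on (units G) (orbit_rel G)"
    by (rule refl_onI)
      (use units_subset src_of_unit tgt_of_unit in \<open>force simp: orbit_rel_def\<close>)
  show "sym (orbit_rel G)"
  proof (rule symI)
    fix u v assume "(u, v) \<in> orbit_rel G"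
    then obtain x where "x \<in> topspace (arrows G)" "src G x = u" "tgt G x = v"
      by (auto simp: orbit_rel_def)
    then show "(v, u) \<in> orbit_rel G"
      using inv_arrow src_inv tgt_inv by (auto simp: orbit_rel_def intro!: bexI[of _ "ginv G x"])
  qed
  show "trans (orbit_rel G)"
  proof (rule transI)
    fix u v w assume "(u, v) \<in> orbit_rel G" "(v, w) \<in> orbit_rel G"
    then obtain x y where xy: "x \<in> topspace (arrows G)" "src G x = u" "tgt G x = v"
      "y \<in> topspace (arrows G)" "src G y = v" "tgt G y = w"
      by (auto simp: orbit_rel_def)
    then have "(y, x) \<in> composable G" by (simp add: composable_def)
    then show "(u, w) \<in> orbit_rel G"
      using comp_arrow src_comp tgt_comp xy
      by (auto simp: orbit_rel_def intro!: bexI[of _ "gcomp G y x"])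
  qed
qed

lemma openin_orbit_space:
  "openin (orbit_space G) V \<longleftrightarrow> V \<subseteq> units G // orbit_rel G \<and> openin (unit_space G) (\<Union>V)"
proof -
  have "istopology (\<lambda>V. V \<subseteq> units G // orbit_rel G \<and> openin (unit_space G) (\<Union>V))"
    unfolding istopology_def
  proof (intro conjI allI impI)
    fix S T
    assume S: "S \<subseteq> units G // orbit_rel G \<and> openin (unit_space G) (\<Union>S)"
      and T: "T \<subseteq> units G // orbit_rel G \<and> openin (unit_space G) (\<Union>T)"
    have "\<Union>(S \<inter> T) = \<Union>S \<inter> \<Union>T"
    proof
      show "\<Union>S \<inter> \<Union>T \<subseteq> \<Union>(S \<inter> T)"
      proof
        fix u assume "u \<in> \<Union>S \<inter> \<Union>T"
        then obtain A B where "A \<in> S" "u \<in> A" "B \<in> T" "u \<in> B" by auto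
        moreover then have "A = B"
          using quotient_disj[OF equiv_orbit_rel, of A B] S T by blast
        ultimately show "u \<in> \<Union>(S \<inter> T)" by blast
      qed
    qed blast
    then show "openin (unit_space G) (\<Union>(S \<inter> T))" using S T by auto
    show "S \<inter> T \<subseteq> units G // orbit_rel G" using S by blast
  next
    fix K assume K: "\<forall>S\<in>K. S \<subseteq> units G // orbit_rel G \<and> openin (unit_space G) (\<Union>S)"
    then show "\<Union>K \<subseteq> units G // orbit_rel G" by blast
    have "\<Union>(\<Union>K) = \<Union>((\<lambda>S. \<Union>S) ` K)" by blast
    then show "openin (unit_space G) (\<Union>(\<Union>K))" using K by auto
  qed
  then show ?thesis by (simp add: orbit_space_def)
qed

lemma topspace_orbit_space: "topspace (orbit_space G) = units G // orbit_rel G"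
proof
  show "topspace (orbit_space G) \<subseteq> units G // orbit_rel G"
    using openin_orbit_space openin_topspace by blast
  have "openin (unit_space G) (\<Union>(units G // orbit_rel G))"
    using Union_quotient[OF equiv_orbit_rel] topspace_unit_space openin_topspace by metis
  then show "units G // orbit_rel G \<subseteq> topspace (orbit_space G)"
    by (intro openin_subset) (simp add: openin_orbit_space)
qed

lemma quotient_map_orbit_space:
  "quotient_map (unit_space G) (orbit_space G) (\<lambda>u. orbit_rel G `` {u})"
  unfolding quotient_map_def
proof (intro conjI allI impI)
  show "(\<lambda>u. orbit_rel G `` {u}) ` topspace (unit_space G) = topspace (orbit_space G)"
    by (auto simp: topspace_unit_space topspace_orbit_space quotient_def)
  fix V assume V: "V \<subseteq> topspace (orbit_space G)"
  have "{u \<in> topspace (unit_space G). orbit_rel G `` {u} \<in> V} = \<Union>V"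
  proof
    show "{u \<in> topspace (unit_space G). orbit_rel G `` {u} \<in> V} \<subseteq> \<Union>V"
      using equiv_class_self[OF equiv_orbit_rel] by (auto simp: topspace_unit_space)
    show "\<Union>V \<subseteq> {u \<in> topspace (unit_space G). orbit_rel G `` {u} \<in> V}"
    proof
      fix u assume "u \<in> \<Union>V"
      then obtain A where A: "A \<in> V" "u \<in> A" by blast
      then have Aq: "A \<in> units G // orbit_rel G" using V topspace_orbit_space by auto
      then have u: "u \<in> units G"
        using A Union_quotient[OF equiv_orbit_rel] by blast
      have "orbit_rel G `` {u} \<in> units G // orbit_rel G" using u by (rule quotientI)
      then have "orbit_rel G `` {u} = A"
        using quotient_disj[OF equiv_orbit_rel Aq] A equiv_class_self[OF equiv_orbit_rel u] by blast
      then show "u \<in> {u \<in> topspace (unit_space G). orbit_rel G `` {u} \<in> V}"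
        using A u by (simp add: topspace_unit_space)
    qed
  qed
  then show "openin (unit_space G) {u \<in> topspace (unit_space G). orbit_rel G `` {u} \<in> V}
      = openin (orbit_space G) V"
    using V by (simp add: openin_orbit_space topspace_orbit_space)
qed

lemma group_isotropy_group:
  assumes u: "u \<in> units G"
  shows "group (isotropy_group G u)"
proof (rule groupI)
  fix x assume "x \<in> carrier (isotropy_group G u)"
  then have x: "x \<in> topspace (arrows G)" "src G x = u" "tgt G x = u"
    by (auto simp: isotropy_group_def)
  show "\<one>\<^bsub>isotropy_group G u\<^esub> \<otimes>\<^bsub>isotropy_group G u\<^esub> x = x"
    using comp_tgt[OF x(1)] x by (simp add: isotropy_group_def)
  show "\<exists>y\<in>carrier (isotropy_group G u). y \<otimes>\<^bsub>isotropy_group G u\<^esub> x = \<one>\<^bsub>isotropy_group G u\<^esub>"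
    using inv_comp[OF x(1)] inv_arrow[OF x(1)] src_inv[OF x(1)] tgt_inv[OF x(1)] x
    by (auto simp: isotropy_group_def intro!: bexI[of _ "ginv G x"])
qed (use u units_subset src_of_unit tgt_of_unit comp_arrow src_comp tgt_comp comp_assoc in
      \<open>auto simp: isotropy_group_def composable_def\<close>)

end

end

theory Submission
  imports Defs
begin

text \<open>
  A primitive ideal is the core \<open>{a. a R \<subseteq> L}\<close> of a maximal modular left ideal \<open>L\<close>, so being GCR can be
  phrased elementwise in \<open>R\<close>; in this form it passes to surjective images and to corners \<open>e R e\<close>,
  and it can be lifted from a corner.

  Let \<open>R\<close> be the Steinberg algebra.  If \<open>R\<close> is GCR, take for a unit \<open>u\<close> the module with basis the orbit
  of \<open>u\<close>.  Its annihilator depends only on the closure of the orbit, while a primitive GCR ring has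
  only one faithful simple module; hence orbits with the same closure coincide, i.e. the orbit space
  is \<open>T\<^sub>0\<close>.  By a Baire category argument every orbit is then discrete in its closure, so that the group
  ring at \<open>u\<close> is an image of the corner of \<open>R\<close> at a small compact open neighbourhood of \<open>u\<close>.

  Conversely, the support in the unit space of a simple module is closed, invariant and irreducible,
  so by the same Baire argument it has an isolated point \<open>u\<close>, and a corner of the primitive quotient
  is a quotient of the group ring at \<open>u\<close>.

  The group ring of a virtually abelian group is a finitely generated module over a commutative
  subring, and linear algebra over the residue field of that subring shows that the annihilator of
  a simple module is the annihilator of finitely many of its elements.
\<close>

section \<open>Maximal modular left ideals\<close>

text \<open>In a ring without unit, a maximal left ideal has to be modular: a right identity modulo
  \<open>L\<close> supplies the vector of \<open>R/L\<close> whose annihilator is \<open>L\<close>.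
  Working with congruences modulo \<open>L\<close> lets the proof pass between several rings without
  carrying module types and quotient rings along.

  The arrow space need not be Hausdorff, so an element of the algebra that is nonzero at an arrow
  may vanish at arrows arbitrarily close to it. Two facts replace continuity. A function that
  vanishes on the whole source fibre of a unit vanishes over a neighbourhood of that unit; and the
  sum of a function over a source fibre is locally constant in the unit. The second fact is why the
  orbit module uses the trivial representation of the isotropy group: its coefficients sum a
  function over the arrows with given source and range, and restricting the range turns them into
  fibre sums.

  An isolated point \<open>u\<close> of a closed invariant set matters because an arrow that starts
  at \<open>u\<close> and ends in a small neighbourhood of \<open>u\<close> must end at
  \<open>u\<close>. This makes restriction to the isotropy group multiplicative.\<close>

context nonunital_ring
begin

lemma l_null [simp]: "x \<in> carrier R \<Longrightarrow> \<zero> \<otimes> x = \<zero>"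
  by (metis add.r_cancel_one' l_distr l_zero m_closed zero_closed)

lemma r_null [simp]: "x \<in> carrier R \<Longrightarrow> x \<otimes> \<zero> = \<zero>"
  by (metis add.r_cancel_one' r_distr l_zero m_closed zero_closed)

lemma l_minus:
  assumes "x \<in> carrier R" "y \<in> carrier R"
  shows "(\<ominus> x) \<otimes> y = \<ominus> (x \<otimes> y)"
proof -
  have "(\<ominus> x) \<otimes> y \<oplus> x \<otimes> y = \<zero>"
    using assms by (simp add: l_distr[symmetric] l_neg)
  then show ?thesis using assms m_closed minus_equality by auto
qed

lemma r_minus:
  assumes "x \<in> carrier R" "y \<in> carrier R"
  shows "x \<otimes> (\<ominus> y) = \<ominus> (x \<otimes> y)"
proof -
  have "x \<otimes> (\<ominus> y) \<oplus> x \<otimes> y = \<zero>"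
    using assms by (simp add: r_distr[symmetric] l_neg)
  then show ?thesis using assms m_closed minus_equality by auto
qed

lemma l_diff_distr:
  "\<lbrakk>x \<in> carrier R; y \<in> carrier R; z \<in> carrier R\<rbrakk> \<Longrightarrow> (x \<ominus> y) \<otimes> z = x \<otimes> z \<ominus> y \<otimes> z"
  by (simp add: a_minus_def l_distr l_minus)

lemma r_diff_distr:
  "\<lbrakk>x \<in> carrier R; y \<in> carrier R; z \<in> carrier R\<rbrakk> \<Longrightarrow> z \<otimes> (x \<ominus> y) = z \<otimes> x \<ominus> z \<otimes> y"
  by (simp add: a_minus_def r_distr r_minus)

end

section \<open>Left ideals and congruence modulo them\<close>

locale left_ideal = R?: nonunital_ring R + additive_subgroup L R for L and R (structure) +
  assumes l_closed: "\<lbrakk>a \<in> L; x \<in> carrier R\<rbrakk> \<Longrightarrow> x \<otimes> a \<in> L"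
begin

lemma diff_closed: "\<lbrakk>a \<in> L; b \<in> L\<rbrakk> \<Longrightarrow> a \<ominus> b \<in> L"
  by (simp add: a_minus_def)

lemma diff_trans:
  assumes "x \<ominus> y \<in> L" "y \<ominus> z \<in> L" "x \<in> carrier R" "y \<in> carrier R" "z \<in> carrier R"
  shows "x \<ominus> z \<in> L"
proof -
  have "x \<ominus> z = (x \<ominus> y) \<oplus> (y \<ominus> z)"
    using assms(3-) by (simp add: a_minus_def add.m_assoc add.inv_solve_left)
  then show ?thesis using assms by simp
qed

lemma diff_sym:
  assumes "x \<ominus> y \<in> L" "x \<in> carrier R" "y \<in> carrier R"
  shows "y \<ominus> x \<in> L"
proof -
  have "y \<ominus> x = \<ominus> (x \<ominus> y)"
    using assms(2-) by (simp add: a_minus_def minus_add add.m_comm)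
  then show ?thesis using assms by simp
qed

lemma mem_cong:
  assumes "x \<ominus> y \<in> L" "x \<in> carrier R" "y \<in> carrier R"
  shows "x \<in> L \<longleftrightarrow> y \<in> L"
proof -
  have "x = (x \<ominus> y) \<oplus> y" "y = (y \<ominus> x) \<oplus> x"
    using assms(2-) by (simp_all add: a_minus_def add.m_assoc l_neg)
  then show ?thesis using assms diff_sym[OF assms] a_closed by metis
qed

end

text \<open>The element \<open>c\<close> is a right identity modulo \<open>L\<close> and replaces
  the unit: its class generates \<open>R/L\<close>. The last clause is maximality, put as: every
  nonzero class can be multiplied onto that generator.\<close>

definition max_modular :: "('a, 'c) ring_scheme \<Rightarrow> 'a set \<Rightarrow> bool" where
  "max_modular R L \<longleftrightarrow> left_ideal L R \<and>
     (\<exists>c\<in>carrier R - L. (\<forall>r\<in>carrier R. r \<ominus>\<^bsub>R\<^esub> r \<otimes>\<^bsub>R\<^esub> c \<in> L)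
        \<and> (\<forall>y\<in>carrier R - L. \<exists>s\<in>carrier R. s \<otimes>\<^bsub>R\<^esub> y \<ominus>\<^bsub>R\<^esub> c \<in> L))"

text \<open>The annihilator of the simple module \<open>R/L\<close>.\<close>

definition ideal_core :: "('a, 'c) ring_scheme \<Rightarrow> 'a set \<Rightarrow> 'a set" where
  "ideal_core R L = {a \<in> carrier R. \<forall>r\<in>carrier R. a \<otimes>\<^bsub>R\<^esub> r \<in> L}"

text \<open>The image of \<open>R a\<close> in \<open>R/I\<close> is a minimal left ideal, provided that \<open>I\<close> is primitive.\<close>

definition has_minimal :: "('a, 'c) ring_scheme \<Rightarrow> 'a set \<Rightarrow> bool" where
  "has_minimal R I \<longleftrightarrow> (\<exists>a\<in>carrier R - I. \<forall>r\<in>carrier R. r \<otimes>\<^bsub>R\<^esub> a \<notin> I \<longrightarrow>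
     (\<exists>s\<in>carrier R. s \<otimes>\<^bsub>R\<^esub> (r \<otimes>\<^bsub>R\<^esub> a) \<ominus>\<^bsub>R\<^esub> a \<in> I))"

locale max_modular_left_ideal = left_ideal +
  assumes max_modular: "max_modular R L"
begin

text \<open>Multiplying the relation \<open>s y = c\<close> modulo \<open>L\<close> by
  \<open>z\<close> on the left, and using that \<open>z - z c\<close> lies in \<open>L\<close>,
  replaces the target \<open>c\<close> by an arbitrary \<open>z\<close>.\<close>

lemma simple:
  assumes "y \<in> carrier R - L" "z \<in> carrier R"
  shows "\<exists>s\<in>carrier R. s \<otimes> y \<ominus> z \<in> L"
proof -
  obtain c where c: "c \<in> carrier R" "\<And>r. r \<in> carrier R \<Longrightarrow> r \<ominus> r \<otimes> c \<in> L"
     "\<And>y. y\<in>carrier R - L \<Longrightarrow> \<exists>s\<in>carrier R. s \<otimes> y \<ominus> c \<in> L"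
    using max_modular by (auto simp: max_modular_def)
  obtain s where s: "s \<in> carrier R" "s \<otimes> y \<ominus> c \<in> L" using c(3) assms by auto
  have "z \<otimes> (s \<otimes> y \<ominus> c) \<in> L" using s assms l_closed by auto
  then have 1: "(z \<otimes> s) \<otimes> y \<ominus> z \<otimes> c \<in> L"
    using s assms c by (simp add: r_diff_distr m_assoc m_closed)
  have "(z \<otimes> s) \<otimes> y \<ominus> z \<in> L"
    by (rule diff_trans[OF 1 diff_sym]) (use s assms c m_closed in auto)
  then show ?thesis using s assms m_closed by blast
qed

lemma proper: "\<exists>c\<in>carrier R. c \<notin> L"
  using max_modular by (auto simp: max_modular_def)

lemma simple_zero:
  assumes "y \<in> carrier R" "\<And>s. s \<in> carrier R \<Longrightarrow> s \<otimes> y \<in> L"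
  shows "y \<in> L"
proof (rule ccontr)
  assume y: "y \<notin> L"
  obtain c where c: "c \<in> carrier R" "c \<notin> L" using proper by auto
  obtain s where "s \<in> carrier R" "s \<otimes> y \<ominus> c \<in> L" using simple[of y c] y assms c by auto
  then show False using mem_cong[of "s \<otimes> y" c] c assms m_closed by auto
qed

text \<open>For \<open>a\<close> in the core, both \<open>a c\<close> and \<open>a - a c\<close> lie
  in \<open>L\<close>. This is where the right identity \<open>c\<close> counts: if all products
  were zero, the core would be the whole ring.\<close>

lemma core_subset: "ideal_core R L \<subseteq> L"
proof
  fix a assume a: "a \<in> ideal_core R L"
  obtain c where c: "c \<in> carrier R" "a \<ominus> a \<otimes> c \<in> L"
    using max_modular a by (auto simp: max_modular_def ideal_core_def)
  then show "a \<in> L" using mem_cong[of a "a \<otimes> c"] a m_closed by (auto simp: ideal_core_def)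
qed

lemma core_ideal: "two_sided_ideal (ideal_core R L) R"
proof (intro two_sided_ideal.intro two_sided_ideal_axioms.intro additive_subgroup.intro add.subgroupI)
  show "ideal_core R L \<noteq> {}" by (auto simp: ideal_core_def intro!: exI[of _ \<zero>])
qed (auto simp: ideal_core_def m_closed m_assoc l_minus l_distr l_closed)

text \<open>Annihilators of simple modules are prime: if \<open>b x\<close> is not in
  \<open>L\<close>, then \<open>R b x\<close> covers \<open>R\<close> modulo \<open>L\<close>, so an
  \<open>a\<close> for which \<open>a R b\<close> lies in the core kills every class.\<close>

lemma core_prime:
  assumes "a \<in> carrier R" "b \<in> carrier R" "\<And>r. r \<in> carrier R \<Longrightarrow> a \<otimes> (r \<otimes> b) \<in> ideal_core R L"
    "b \<notin> ideal_core R L"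
  shows "a \<in> ideal_core R L"
proof -
  obtain x where x: "x \<in> carrier R" "b \<otimes> x \<notin> L" using assms by (auto simp: ideal_core_def)
  have "a \<otimes> r \<in> L" if r: "r \<in> carrier R" for r
  proof -
    obtain s where s: "s \<in> carrier R" "s \<otimes> (b \<otimes> x) \<ominus> r \<in> L"
      using simple[of "b \<otimes> x" r] x r assms m_closed by auto
    have "a \<otimes> (s \<otimes> (b \<otimes> x)) \<ominus> a \<otimes> r \<in> L"
      using l_closed[OF s(2) assms(1)] s r x assms by (simp add: r_diff_distr m_closed)
    moreover have "a \<otimes> (s \<otimes> (b \<otimes> x)) \<in> L"
      using assms(3)[OF s(1)] x s assms by (auto simp: ideal_core_def m_assoc m_closed)
    ultimately show ?thesis
      using mem_cong[of "a \<otimes> (s \<otimes> (b \<otimes> x))" "a \<otimes> r"] s r x assms m_closed by auto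
  qed
  then show ?thesis using assms by (auto simp: ideal_core_def)
qed

end

lemma max_modular_left_idealI: "max_modular R L \<Longrightarrow> max_modular_left_ideal L R"
  by (simp add: max_modular_left_ideal_def max_modular_left_ideal_axioms_def max_modular_def)

section \<open>Transport along surjective ring homomorphisms\<close>

locale surj_ring_hom = R: nonunital_ring R + S: nonunital_ring S
  for R :: "('a, 'c) ring_scheme" and S :: "('b, 'd) ring_scheme" and h :: "'a \<Rightarrow> 'b" +
  assumes image: "h ` carrier R = carrier S"
    and add: "\<lbrakk>x \<in> carrier R; y \<in> carrier R\<rbrakk> \<Longrightarrow> h (x \<oplus>\<^bsub>R\<^esub> y) = h x \<oplus>\<^bsub>S\<^esub> h y"
    and mult: "\<lbrakk>x \<in> carrier R; y \<in> carrier R\<rbrakk> \<Longrightarrow> h (x \<otimes>\<^bsub>R\<^esub> y) = h x \<otimes>\<^bsub>S\<^esub> h y"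
begin

definition preimage :: "'b set \<Rightarrow> 'a set" where
  "preimage A = {x \<in> carrier R. h x \<in> A}"

lemma closed [simp]: "x \<in> carrier R \<Longrightarrow> h x \<in> carrier S"
  using image by auto

lemma lift:
  assumes "y \<in> carrier S"
  obtains x where "x \<in> carrier R" "y = h x"
  using image assms by auto

lemma zero [simp]: "h \<zero>\<^bsub>R\<^esub> = \<zero>\<^bsub>S\<^esub>"
  using add[of "\<zero>\<^bsub>R\<^esub>" "\<zero>\<^bsub>R\<^esub>"] by (simp add: S.add.r_cancel_one')

lemma minus [simp]: "x \<in> carrier R \<Longrightarrow> h (\<ominus>\<^bsub>R\<^esub> x) = \<ominus>\<^bsub>S\<^esub> h x"
  using add[of "\<ominus>\<^bsub>R\<^esub> x" x] by (simp add: R.l_neg S.minus_equality)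

lemma diff: "\<lbrakk>x \<in> carrier R; y \<in> carrier R\<rbrakk> \<Longrightarrow> h (x \<ominus>\<^bsub>R\<^esub> y) = h x \<ominus>\<^bsub>S\<^esub> h y"
  by (simp add: a_minus_def add)

lemma core_preimage: "ideal_core R (preimage L) = preimage (ideal_core S L)"
proof -
  have "(\<forall>r\<in>carrier R. h a \<otimes>\<^bsub>S\<^esub> h r \<in> L) \<longleftrightarrow> (\<forall>r\<in>carrier S. h a \<otimes>\<^bsub>S\<^esub> r \<in> L)" for a
    unfolding image[symmetric] by blast
  then show ?thesis by (auto simp: ideal_core_def preimage_def R.m_closed mult)
qed

lemma max_modular_preimage:
  assumes "max_modular S L"
  shows "max_modular R (preimage L)"
proof -
  interpret L: max_modular_left_ideal L S using assms by (rule max_modular_left_idealI)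
  have "left_ideal (preimage L) R"
  proof (intro left_ideal.intro left_ideal_axioms.intro R.nonunital_ring_axioms
      additive_subgroup.intro R.add.subgroupI)
    show "preimage L \<noteq> {}" by (auto simp: preimage_def intro!: exI[of _ "\<zero>\<^bsub>R\<^esub>"])
  qed (auto simp: preimage_def add mult R.m_closed L.l_closed)
  moreover obtain c' where c': "c' \<in> carrier S" "c' \<notin> L" "\<And>r. r \<in> carrier S \<Longrightarrow> r \<ominus>\<^bsub>S\<^esub> r \<otimes>\<^bsub>S\<^esub> c' \<in> L"
     "\<And>y. y\<in>carrier S - L \<Longrightarrow> \<exists>s\<in>carrier S. s \<otimes>\<^bsub>S\<^esub> y \<ominus>\<^bsub>S\<^esub> c' \<in> L"
    using assms by (auto simp: max_modular_def)
  moreover obtain c where c: "c \<in> carrier R" "c' = h c" using lift[OF c'(1)] by auto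
  moreover have "\<exists>s\<in>carrier R. s \<otimes>\<^bsub>R\<^esub> y \<ominus>\<^bsub>R\<^esub> c \<in> preimage L" if y: "y \<in> carrier R - preimage L" for y
  proof -
    obtain s where s: "s \<in> carrier S" "s \<otimes>\<^bsub>S\<^esub> h y \<ominus>\<^bsub>S\<^esub> c' \<in> L" 
      using c'(4)[of "h y"] y by (auto simp: preimage_def)
    then obtain t where "t \<in> carrier R" "s = h t" using lift[OF s(1)] by auto
    then show ?thesis using s y c
      by (intro bexI[of _ t]) (auto simp: preimage_def diff mult R.m_closed)
  qed
  ultimately show ?thesis
    unfolding max_modular_def
    by (intro conjI bexI[of _ c]) (auto simp: preimage_def diff mult R.m_closed)
qed

text \<open>A left ideal that contains the kernel is a union of fibres of \<open>h\<close>.\<close>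

lemma preimage_image:
  assumes "left_ideal L R" "\<And>x. x \<in> carrier R \<Longrightarrow> h x = \<zero>\<^bsub>S\<^esub> \<Longrightarrow> x \<in> L"
  shows "preimage (h ` L) = L"
proof -
  interpret L: left_ideal L R by fact
  have "x \<in> L" if "x \<in> carrier R" "y \<in> L" "h x = h y" for x y
  proof -
    have "x \<ominus>\<^bsub>R\<^esub> y \<in> L" using that by (intro assms) (auto simp: add S.r_neg a_minus_def)
    then show ?thesis using L.mem_cong that by auto
  qed
  then show ?thesis by (auto simp: preimage_def)
qed

lemma max_modular_image:
  assumes "max_modular R L" "\<And>x. x \<in> carrier R \<Longrightarrow> h x = \<zero>\<^bsub>S\<^esub> \<Longrightarrow> x \<in> L"
  shows "max_modular S (h ` L)"
proof -
  interpret L: max_modular_left_ideal L R using assms(1) by (rule max_modular_left_idealI)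
  note pre = preimage_image[OF L.left_ideal_axioms assms(2), simplified]
  have hL: "h x \<in> h ` L \<longleftrightarrow> x \<in> L" if "x \<in> carrier R" for x
    using pre that by (auto simp: preimage_def)
  have "left_ideal (h ` L) S"
  proof (intro left_ideal.intro left_ideal_axioms.intro S.nonunital_ring_axioms
      additive_subgroup.intro S.add.subgroupI)
    fix x a assume "a \<in> h ` L" "x \<in> carrier S"
    then obtain a' x' where *: "a' \<in> L" "x' \<in> carrier R" "a = h a'" "x = h x'" using lift[of x] by blast
    then show "x \<otimes>\<^bsub>S\<^esub> a \<in> h ` L" by (simp add: mult[symmetric] L.l_closed)
  next
    fix x a assume "a \<in> h ` L" "x \<in> h ` L"
    then obtain a' x' where *: "a' \<in> L" "x' \<in> L" "a = h a'" "x = h x'" by auto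
    then show "x \<oplus>\<^bsub>S\<^esub> a \<in> h ` L" by (simp add: add[symmetric])
  next
    fix a assume "a \<in> h ` L"
    then obtain a' where *: "a' \<in> L" "a = h a'" by auto
    then show "\<ominus>\<^bsub>S\<^esub> a \<in> h ` L" by (simp add: minus[symmetric] del: minus)
  qed (use L.a_subset L.zero_closed in fastforce)+
  moreover obtain c where c: "c \<in> carrier R" "c \<notin> L" "\<And>r. r \<in> carrier R \<Longrightarrow> r \<ominus>\<^bsub>R\<^esub> r \<otimes>\<^bsub>R\<^esub> c \<in> L"
     "\<And>y. y\<in>carrier R - L \<Longrightarrow> \<exists>s\<in>carrier R. s \<otimes>\<^bsub>R\<^esub> y \<ominus>\<^bsub>R\<^esub> c \<in> L"
    using assms by (auto simp: max_modular_def)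
  moreover have "r \<ominus>\<^bsub>S\<^esub> r \<otimes>\<^bsub>S\<^esub> h c \<in> h ` L" if r: "r \<in> carrier S" for r
  proof -
    obtain t where "t \<in> carrier R" "r = h t" using lift[of r] r by auto
    then show ?thesis using c by (simp add: mult[symmetric] diff[symmetric] R.m_closed)
  qed
  moreover have "\<exists>s\<in>carrier S. s \<otimes>\<^bsub>S\<^esub> y \<ominus>\<^bsub>S\<^esub> h c \<in> h ` L" if y: "y \<in> carrier S - h ` L" for y
  proof -
    obtain t where t: "t \<in> carrier R" "y = h t" using lift[of y] y by auto
    then obtain s where "s \<in> carrier R" "s \<otimes>\<^bsub>R\<^esub> t \<ominus>\<^bsub>R\<^esub> c \<in> L" using c(4)[of t] y by auto
    then show ?thesis using t c
      by (intro bexI[of _ "h s"]) (auto simp: mult[symmetric] diff[symmetric] R.m_closed)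
  qed
  ultimately show ?thesis
    unfolding max_modular_def
    by (intro conjI bexI[of _ "h c"]) (auto simp: hL)
qed

lemma has_minimal_preimage: "has_minimal R (preimage I) \<longleftrightarrow> has_minimal S I"
proof
  assume "has_minimal R (preimage I)"
  then obtain a where a: "a \<in> carrier R" "h a \<notin> I"
    and *: "\<And>r. r \<in> carrier R \<Longrightarrow> r \<otimes>\<^bsub>R\<^esub> a \<notin> preimage I \<Longrightarrow>
      \<exists>s\<in>carrier R. s \<otimes>\<^bsub>R\<^esub> (r \<otimes>\<^bsub>R\<^esub> a) \<ominus>\<^bsub>R\<^esub> a \<in> preimage I"
    unfolding has_minimal_def by (auto simp: preimage_def)
  have "\<exists>s\<in>carrier S. s \<otimes>\<^bsub>S\<^esub> (r \<otimes>\<^bsub>S\<^esub> h a) \<ominus>\<^bsub>S\<^esub> h a \<in> I"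
    if r: "r \<in> carrier S" "r \<otimes>\<^bsub>S\<^esub> h a \<notin> I" for r
  proof -
    obtain t where t: "t \<in> carrier R" "r = h t" using lift[of r] r by auto
    then obtain s where "s \<in> carrier R" "s \<otimes>\<^bsub>R\<^esub> (t \<otimes>\<^bsub>R\<^esub> a) \<ominus>\<^bsub>R\<^esub> a \<in> preimage I"
      using *[OF t(1)] r a by (auto simp: preimage_def mult)
    then show ?thesis using t a
      by (intro bexI[of _ "h s"]) (auto simp: preimage_def mult diff R.m_closed)
  qed
  then show "has_minimal S I" unfolding has_minimal_def using a by (intro bexI[of _ "h a"]) auto
next
  assume "has_minimal S I"
  then obtain a' where a': "a' \<in> carrier S" "a' \<notin> I"
    and *: "\<And>r. r \<in> carrier S \<Longrightarrow> r \<otimes>\<^bsub>S\<^esub> a' \<notin> I \<Longrightarrow>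
      \<exists>s\<in>carrier S. s \<otimes>\<^bsub>S\<^esub> (r \<otimes>\<^bsub>S\<^esub> a') \<ominus>\<^bsub>S\<^esub> a' \<in> I"
    unfolding has_minimal_def by auto
  obtain a where a: "a \<in> carrier R" "a' = h a" using lift[OF a'(1)] by auto
  have "\<exists>s\<in>carrier R. s \<otimes>\<^bsub>R\<^esub> (r \<otimes>\<^bsub>R\<^esub> a) \<ominus>\<^bsub>R\<^esub> a \<in> preimage I"
    if r: "r \<in> carrier R" "r \<otimes>\<^bsub>R\<^esub> a \<notin> preimage I" for r
  proof -
    obtain s' where s': "s' \<in> carrier S" "s' \<otimes>\<^bsub>S\<^esub> (h r \<otimes>\<^bsub>S\<^esub> a') \<ominus>\<^bsub>S\<^esub> a' \<in> I"
      using *[of "h r"] r a by (auto simp: preimage_def mult R.m_closed)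
    then obtain s where "s \<in> carrier R" "s' = h s" using lift[OF s'(1)] by auto
    then show ?thesis using s' r a
      by (intro bexI[of _ s]) (auto simp: preimage_def mult diff R.m_closed)
  qed
  then show "has_minimal R (preimage I)"
    unfolding has_minimal_def using a a' by (auto simp: preimage_def)
qed

end

text \<open>The product in \<open>R Quot I\<close> is a union of cosets over all pairs of
  representatives, so the point is that all these cosets coincide.\<close>

lemma surj_ring_hom_Quot:
  fixes R (structure)
  assumes "nonunital_ring R" "two_sided_ideal I R"
  shows "surj_ring_hom R (R Quot I) (\<lambda>x. I +> x)"
proof -
  interpret R: nonunital_ring R by fact
  interpret I: two_sided_ideal I R by fact
  interpret A: abelian_subgroup I R
    by (intro abelian_subgroupI3 I.additive_subgroup_axioms R.abelian_group_axioms)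
  have mult: "rcoset_mult R I (I +> x) (I +> y) = I +> (x \<otimes> y)" if xy: "x \<in> carrier R" "y \<in> carrier R" for x y
  proof -
    have 1: "I +> (a \<otimes> b) = I +> (x \<otimes> y)" if ab: "a \<in> I +> x" "b \<in> I +> y" for a b
    proof -
      obtain i j where ij: "i \<in> I" "j \<in> I" "a = i \<oplus> x" "b = j \<oplus> y"
        using ab by (auto simp: a_r_coset_def')
      have "a \<otimes> b = (i \<otimes> j \<oplus> i \<otimes> y \<oplus> x \<otimes> j) \<oplus> x \<otimes> y"
        using ij xy by (simp add: R.l_distr R.r_distr R.m_closed R.a_ac)
      moreover have "i \<otimes> j \<oplus> i \<otimes> y \<oplus> x \<otimes> j \<in> I"
        using ij xy I.I_l_closed I.I_r_closed by simp
      ultimately have "a \<otimes> b \<in> I +> (x \<otimes> y)" by (auto simp: a_r_coset_def')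
      then show ?thesis using A.a_repr_independence' xy R.m_closed
        by (metis I.additive_subgroup_axioms R.a_repr_independence additive_subgroup.a_subgroup)
    qed
    have "x \<in> I +> x" "y \<in> I +> y" using xy A.a_rcos_self by auto
    then show ?thesis unfolding rcoset_mult_def using 1 by blast
  qed
  have car: "carrier (R Quot I) = (\<lambda>x. I +> x) ` carrier R"
    by (auto simp: FactRing_simps)
  have Q: "(I +> x) \<oplus>\<^bsub>R Quot I\<^esub> (I +> y) = I +> (x \<oplus> y)"
      "(I +> x) \<otimes>\<^bsub>R Quot I\<^esub> (I +> y) = I +> (x \<otimes> y)"
    if "x \<in> carrier R" "y \<in> carrier R" for x y
    using that by (simp_all add: FactRing_def A.a_rcos_sum mult)
  have Q0: "\<zero>\<^bsub>R Quot I\<^esub> = I +> \<zero>"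
    by (simp add: FactRing_def R.a_coset_join2 I.a_subgroup)
  have grp: "abelian_group (R Quot I)"
  proof (rule abelian_groupI)
    fix x assume "x \<in> carrier (R Quot I)"
    then obtain x' where x': "x' \<in> carrier R" "x = I +> x'" by (auto simp: car)
    show "\<exists>y\<in>carrier (R Quot I). y \<oplus>\<^bsub>R Quot I\<^esub> x = \<zero>\<^bsub>R Quot I\<^esub>"
      using x' by (intro bexI[of _ "I +> (\<ominus> x')"]) (auto simp: Q Q0 R.l_neg car)
  qed (auto simp: car Q Q0 R.a_ac)
  have "nonunital_ring (R Quot I)"
    by (intro nonunital_ring.intro grp nonunital_ring_axioms.intro)
      (auto simp: car Q R.m_assoc R.l_distr R.r_distr R.m_closed)
  then show ?thesis
    by (intro surj_ring_hom.intro surj_ring_hom_axioms.intro R.nonunital_ring_axioms)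
      (auto simp: car Q)
qed

section \<open>The elementwise criterion for GCR\<close>

lemma (in left_module) smult_l_null [simp]: "x \<in> carrier M \<Longrightarrow> \<zero> \<odot>\<^bsub>M\<^esub> x = \<zero>\<^bsub>M\<^esub>"
  using smult_l_distr[of "\<zero>" "\<zero>" x] smult_closed[of "\<zero>" x]
  by (metis M.add.r_cancel_one' R.l_zero R.zero_closed)

lemma (in left_module) smult_r_null [simp]: "a \<in> carrier R \<Longrightarrow> a \<odot>\<^bsub>M\<^esub> \<zero>\<^bsub>M\<^esub> = \<zero>\<^bsub>M\<^esub>"
  using smult_r_distr[of a "\<zero>\<^bsub>M\<^esub>" "\<zero>\<^bsub>M\<^esub>"] smult_closed[of a "\<zero>\<^bsub>M\<^esub>"]
  by (metis M.add.r_cancel_one' M.l_zero M.zero_closed)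

lemma (in left_module) smult_l_minus:
  assumes "a \<in> carrier R" "x \<in> carrier M"
  shows "(\<ominus> a) \<odot>\<^bsub>M\<^esub> x = \<ominus>\<^bsub>M\<^esub> (a \<odot>\<^bsub>M\<^esub> x)"
proof -
  have "(\<ominus> a) \<odot>\<^bsub>M\<^esub> x \<oplus>\<^bsub>M\<^esub> a \<odot>\<^bsub>M\<^esub> x = \<zero>\<^bsub>M\<^esub>"
    using smult_l_distr[of "\<ominus> a" a x] assms by (simp add: R.l_neg)
  then show ?thesis using M.minus_equality smult_closed assms by simp
qed

lemma (in left_module) smult_r_minus:
  assumes "a \<in> carrier R" "x \<in> carrier M"
  shows "a \<odot>\<^bsub>M\<^esub> (\<ominus>\<^bsub>M\<^esub> x) = \<ominus>\<^bsub>M\<^esub> (a \<odot>\<^bsub>M\<^esub> x)"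
proof -
  have "a \<odot>\<^bsub>M\<^esub> (\<ominus>\<^bsub>M\<^esub> x) \<oplus>\<^bsub>M\<^esub> a \<odot>\<^bsub>M\<^esub> x = \<zero>\<^bsub>M\<^esub>"
    using smult_r_distr[of a "\<ominus>\<^bsub>M\<^esub> x" x] assms by (simp add: M.l_neg)
  then show ?thesis using M.minus_equality smult_closed assms by simp
qed

lemma (in left_module) submodule_orbit:
  assumes "x \<in> carrier M"
  shows "submodule ((\<lambda>a. a \<odot>\<^bsub>M\<^esub> x) ` carrier R) R M"
proof (intro submodule.intro submodule_axioms.intro M.add.subgroupI)
  let ?S = "(\<lambda>a. a \<odot>\<^bsub>M\<^esub> x) ` carrier R"
  show "?S \<subseteq> carrier M" using assms smult_closed by auto
  show "?S \<noteq> {}" by auto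
  show "\<ominus>\<^bsub>M\<^esub> z \<in> ?S" if "z \<in> ?S" for z
    using that assms by (auto simp: smult_l_minus[symmetric])
  show "z \<oplus>\<^bsub>M\<^esub> y \<in> ?S" if "z \<in> ?S" "y \<in> ?S" for z y
    using that assms by (auto simp: smult_l_distr[symmetric])
  show "b \<odot>\<^bsub>M\<^esub> z \<in> ?S" if "b \<in> carrier R" "z \<in> ?S" for b z
    using that assms by (auto simp: smult_assoc[symmetric] R.m_closed)
qed

lemma (in left_module) left_module_submodule:
  assumes "submodule N R M"
  shows "left_module R (M\<lparr>carrier := N\<rparr>)"
proof -
  interpret N: submodule N R M by fact
  have sub: "x \<in> N \<Longrightarrow> x \<in> carrier M" for x using N.subset by auto
  have grp: "abelian_group (M\<lparr>carrier := N\<rparr>)"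
  proof (rule abelian_groupI)
    fix x assume x: "x \<in> carrier (M\<lparr>carrier := N\<rparr>)"
    then have "\<ominus>\<^bsub>M\<^esub> x \<in> N" using N.m_inv_closed by (simp add: a_inv_def)
    then show "\<exists>y\<in>carrier (M\<lparr>carrier := N\<rparr>). y \<oplus>\<^bsub>M\<lparr>carrier := N\<rparr>\<^esub> x = \<zero>\<^bsub>M\<lparr>carrier := N\<rparr>\<^esub>"
      using x sub by (intro bexI[of _ "\<ominus>\<^bsub>M\<^esub> x"]) (auto simp: M.l_neg)
  qed (use N.m_closed N.one_closed sub in \<open>auto simp: M.a_ac\<close>)
  show ?thesis
    by (intro left_module.intro left_module_axioms.intro grp R.nonunital_ring_axioms)
      (auto simp: sub smult_l_distr smult_r_distr smult_assoc)
qed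

text \<open>The vectors killed by all of \<open>R\<close> form a submodule; it is not everything, as
  \<open>R M \<noteq> 0\<close>, so it is zero. Hence \<open>R x\<close> is a nonzero
  submodule.\<close>

lemma simple_left_module_cyclic:
  assumes "simple_left_module R M" "x \<in> carrier M" "x \<noteq> \<zero>\<^bsub>M\<^esub>" "y \<in> carrier M"
  shows "\<exists>a\<in>carrier R. a \<odot>\<^bsub>M\<^esub> x = y"
proof -
  interpret left_module R M using assms by (simp add: simple_left_module_def)
  let ?N = "{z \<in> carrier M. \<forall>a\<in>carrier R. a \<odot>\<^bsub>M\<^esub> z = \<zero>\<^bsub>M\<^esub>}"
  have "submodule ?N R M"
  proof (intro submodule.intro submodule_axioms.intro M.add.subgroupI)
    show "?N \<noteq> {}" by (auto intro!: exI[of _ "\<zero>\<^bsub>M\<^esub>"])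
  qed (auto simp: smult_r_minus smult_r_distr smult_closed)
  then have "?N = {\<zero>\<^bsub>M\<^esub>}" using assms(1) unfolding simple_left_module_def by blast
  then have "(\<lambda>a. a \<odot>\<^bsub>M\<^esub> x) ` carrier R \<noteq> {\<zero>\<^bsub>M\<^esub>}" using assms by blast
  then have "(\<lambda>a. a \<odot>\<^bsub>M\<^esub> x) ` carrier R = carrier M"
    using submodule_orbit[OF assms(2)] assms(1) unfolding simple_left_module_def by blast
  then show ?thesis using assms(4) by (metis imageE)
qed

text \<open>\<open>L\<close> is the annihilator of a nonzero vector \<open>m\<close> of a faithful
  simple module. Cyclicity yields \<open>c\<close> with \<open>c m = m\<close>, the right identity
  modulo \<open>L\<close>, and the core kills \<open>R m\<close>, which is the whole module.\<close>

lemma left_primitive_imp_max_modular: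
  fixes R :: "('a, 'c) ring_scheme" (structure)
  assumes "left_primitive R"
  shows "\<exists>L. max_modular R L \<and> ideal_core R L = {\<zero>\<^bsub>R\<^esub>}"
proof -
  obtain M :: "('a, 'a set) module" where simple: "simple_left_module R M" and faithful: "faithful_left_module R M"
    using assms unfolding left_primitive_def by blast
  interpret left_module R M using simple by (simp add: simple_left_module_def)
  obtain a0 m where a0: "a0 \<in> carrier R" and m: "m \<in> carrier M" "a0 \<odot>\<^bsub>M\<^esub> m \<noteq> \<zero>\<^bsub>M\<^esub>"
    using simple by (auto simp: simple_left_module_def)
  then have m0: "m \<noteq> \<zero>\<^bsub>M\<^esub>" by auto
  define L where "L = {a \<in> carrier R. a \<odot>\<^bsub>M\<^esub> m = \<zero>\<^bsub>M\<^esub>}"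
  have L: "left_ideal L R"
  proof (intro left_ideal.intro left_ideal_axioms.intro R.nonunital_ring_axioms
      additive_subgroup.intro R.add.subgroupI)
    show "L \<noteq> {}" using m by (auto simp: L_def intro!: exI[of _ \<zero>])
  qed (use m in \<open>auto simp: L_def smult_l_minus smult_l_distr smult_assoc R.m_closed\<close>)
  have diff: "(a \<ominus> b) \<odot>\<^bsub>M\<^esub> m = a \<odot>\<^bsub>M\<^esub> m \<ominus>\<^bsub>M\<^esub> b \<odot>\<^bsub>M\<^esub> m" if "a \<in> carrier R" "b \<in> carrier R" for a b
    using that m by (simp add: a_minus_def smult_l_distr smult_l_minus)
  obtain c where c: "c \<in> carrier R" "c \<odot>\<^bsub>M\<^esub> m = m"
    using simple_left_module_cyclic[OF simple m(1) m0 m(1)] by auto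
  have "max_modular R L"
    unfolding max_modular_def
  proof (rule conjI, rule L, rule bexI[of _ c], intro conjI ballI)
    show "c \<in> carrier R - L" using c m0 by (auto simp: L_def)
    show "r \<ominus> r \<otimes> c \<in> L" if "r \<in> carrier R" for r
      using that c m M.r_neg smult_closed
      by (simp add: L_def diff smult_assoc R.m_closed) (simp add: a_minus_def)
    show "\<exists>s\<in>carrier R. s \<otimes> y \<ominus> c \<in> L" if y: "y \<in> carrier R - L" for y
    proof -
      obtain s where s: "s \<in> carrier R" "s \<odot>\<^bsub>M\<^esub> (y \<odot>\<^bsub>M\<^esub> m) = m"
        using simple_left_module_cyclic[OF simple, of "y \<odot>\<^bsub>M\<^esub> m" m] y m smult_closed by (auto simp: L_def)
      have "(s \<otimes> y \<ominus> c) \<odot>\<^bsub>M\<^esub> m = m \<ominus>\<^bsub>M\<^esub> m"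
        using s c y m(1) by (simp add: diff smult_assoc R.m_closed)
      also have "\<dots> = \<zero>\<^bsub>M\<^esub>" using M.r_neg[OF m(1)] by (simp add: a_minus_def)
      finally show ?thesis using s c y R.m_closed by (auto simp: L_def)
    qed
  qed
  moreover have "a = \<zero>" if a: "a \<in> ideal_core R L" for a
  proof -
    have "a \<odot>\<^bsub>M\<^esub> x = \<zero>\<^bsub>M\<^esub>" if x: "x \<in> carrier M" for x
    proof -
      obtain r where r: "r \<in> carrier R" "r \<odot>\<^bsub>M\<^esub> m = x"
        using simple_left_module_cyclic[OF simple m(1) m0 x] by auto
      then have "(a \<otimes> r) \<odot>\<^bsub>M\<^esub> m = \<zero>\<^bsub>M\<^esub>" using a by (auto simp: ideal_core_def L_def)
      then show ?thesis using a r m by (simp add: ideal_core_def smult_assoc)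
    qed
    then show ?thesis using faithful a by (auto simp: faithful_left_module_def ideal_core_def)
  qed
  moreover have "\<zero> \<in> ideal_core R L"
    using m by (auto simp: ideal_core_def L_def)
  ultimately show ?thesis by blast
qed

section \<open>The simple module \<open>R/L\<close>\<close>

context max_modular_left_ideal
begin

text \<open>The module \<open>R/L\<close> is carried by chosen representatives, so that its elements
  are ring elements and each operation is followed by \<open>rep\<close>. The type that the
  definition of primitivity asks for is supplied by \<open>left_primitiveI\<close>.\<close>

lemma left_primitive:
  assumes core: "ideal_core R L = {\<zero>}"
  shows "left_primitive R"
proof -
  define rep where "rep x = (SOME y. y \<in> carrier R \<and> x \<ominus> y \<in> L)" for x
  have "\<exists>y. y \<in> carrier R \<and> x \<ominus> y \<in> L" if "x \<in> carrier R" for x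
    using that by (intro exI[of _ x]) (simp add: a_minus_def r_neg)
  then have rep: "rep x \<in> carrier R" "x \<ominus> rep x \<in> L" if "x \<in> carrier R" for x
    using that unfolding rep_def by (metis (mono_tags, lifting) someI_ex)+
  have rep_eq: "rep x = rep y \<longleftrightarrow> x \<ominus> y \<in> L" if xy: "x \<in> carrier R" "y \<in> carrier R" for x y
  proof
    assume "rep x = rep y"
    then show "x \<ominus> y \<in> L" using xy rep diff_sym diff_trans by metis
  next
    assume *: "x \<ominus> y \<in> L"
    \<comment> \<open>The predicates under \<open>SOME\<close> coincide, hence so do the chosen
      representatives.\<close>
    have "x \<ominus> z \<in> L \<longleftrightarrow> y \<ominus> z \<in> L" if "z \<in> carrier R" for z
      using * xy that diff_sym diff_trans by meson
    then show "rep x = rep y" unfolding rep_def by metis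
  qed
  have rep_add1: "rep (rep x \<oplus> y) = rep (x \<oplus> y)" if xy: "x \<in> carrier R" "y \<in> carrier R" for x y
  proof -
    have "(x \<oplus> y) \<ominus> (rep x \<oplus> y) = (x \<ominus> rep x) \<oplus> (y \<ominus> y)"
      using xy rep[OF xy(1)] by (simp add: a_minus_def minus_add a_ac)
    then show ?thesis using rep xy rep_eq[of "x \<oplus> y" "rep x \<oplus> y"]
      by (simp add: a_minus_def r_neg)
  qed
  have rep_add2: "rep (x \<oplus> rep y) = rep (x \<oplus> y)" if "x \<in> carrier R" "y \<in> carrier R" for x y
    using rep_add1[of y x] that rep by (simp add: a_comm)
  have rep_mult: "rep (a \<otimes> rep x) = rep (a \<otimes> x)" if "x \<in> carrier R" "a \<in> carrier R" for x a
  proof -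
    have "a \<otimes> x \<ominus> a \<otimes> rep x \<in> L"
      using that rep l_closed[of "x \<ominus> rep x" a] by (simp add: r_diff_distr)
    then show ?thesis using rep_eq[of "a \<otimes> x" "a \<otimes> rep x"] that rep m_closed by simp
  qed
  have rep_zero: "rep x = rep \<zero> \<longleftrightarrow> x \<in> L" if "x \<in> carrier R" for x
    using rep_eq[of x \<zero>] that minus_equality[of \<zero> \<zero>] by (simp add: a_minus_def)
  define N :: "('a, 'a) module" where
    "N = \<lparr>carrier = rep ` carrier R, mult = undefined, one = undefined, zero = rep \<zero>,
       add = (\<lambda>x y. rep (x \<oplus> y)), smult = (\<lambda>a x. rep (a \<otimes> x))\<rparr>"
  have rep_rep: "rep (rep x) = rep x" if "x \<in> carrier R" for x
    using rep_add1[of x \<zero>] that rep by simp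
  note simps = rep rep_add1 rep_add2 rep_rep rep_mult m_closed
  have abN: "abelian_group N"
  proof (rule abelian_groupI)
    fix x assume "x \<in> carrier N"
    then obtain x' where x': "x' \<in> carrier R" "x = rep x'" by (auto simp: N_def)
    show "\<exists>y\<in>carrier N. y \<oplus>\<^bsub>N\<^esub> x = \<zero>\<^bsub>N\<^esub>"
      using x' by (intro bexI[of _ "rep (\<ominus> x')"]) (auto simp: N_def simps l_neg)
  qed (auto simp: N_def simps, simp_all add: a_ac)
  have lmN: "left_module R N"
    by (intro left_module.intro left_module_axioms.intro abN nonunital_ring_axioms)
      (auto simp: N_def simps, simp_all add: l_distr r_distr m_assoc simps)
  obtain c where c: "c \<in> carrier R" "c \<notin> L" "\<And>r. r \<in> carrier R \<Longrightarrow> r \<ominus> r \<otimes> c \<in> L"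
    using max_modular by (auto simp: max_modular_def)
  have nz: "\<exists>a\<in>carrier R. \<exists>x\<in>carrier N. a \<odot>\<^bsub>N\<^esub> x \<noteq> \<zero>\<^bsub>N\<^esub>"
    using c mem_cong[of c "c \<otimes> c"] m_closed
    by (intro bexI[of _ c] bexI[of _ "rep c"]) (auto simp: N_def simps rep_zero)
  have sub: "P = {\<zero>\<^bsub>N\<^esub>} \<or> P = carrier N" if P: "submodule P R N" for P
  proof (rule disjCI)
    assume ne: "P \<noteq> carrier N"
    interpret P: submodule P R N by (rule P)
    have "x = \<zero>\<^bsub>N\<^esub>" if x: "x \<in> P" for x
    proof (rule ccontr)
      assume x0: "x \<noteq> \<zero>\<^bsub>N\<^esub>"
      obtain x' where x': "x' \<in> carrier R" "x = rep x'" using x P.subset by (auto simp: N_def)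
      then have "x' \<in> carrier R - L" using x0 rep_zero by (auto simp: N_def)
      have "rep z \<in> P" if z: "z \<in> carrier R" for z
      proof -
        obtain s where s: "s \<in> carrier R" "s \<otimes> x' \<ominus> z \<in> L" using simple z \<open>x' \<in> carrier R - L\<close> by blast
        then have "rep z = s \<odot>\<^bsub>N\<^esub> x" using x' z diff_sym[OF s(2)] by (simp add: N_def simps rep_eq)
        then show ?thesis using P.smult_closed[OF s(1) x] by simp
      qed
      then show False using ne P.subset by (auto simp: N_def)
    qed
    moreover have "\<zero>\<^bsub>N\<^esub> \<in> P" using P.one_closed by simp
    ultimately show "P = {\<zero>\<^bsub>N\<^esub>}" by blast
  qed
  have "faithful_left_module R N"
    unfolding faithful_left_module_def
  proof (intro conjI lmN ballI impI)
    fix a assume a: "a \<in> carrier R" "\<forall>x\<in>carrier N. a \<odot>\<^bsub>N\<^esub> x = \<zero>\<^bsub>N\<^esub>"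
    have "a \<otimes> r \<in> L" if r: "r \<in> carrier R" for r
    proof -
      have "a \<odot>\<^bsub>N\<^esub> rep r = \<zero>\<^bsub>N\<^esub>" using a r by (auto simp: N_def)
      then show ?thesis using a r by (simp add: N_def simps rep_zero)
    qed
    then have "a \<in> ideal_core R L" using a by (simp add: ideal_core_def)
    then show "a = \<zero>" using core by simp
  qed
  moreover have "simple_left_module R N" using lmN nz sub by (simp add: simple_left_module_def)
  ultimately show ?thesis by (intro left_primitiveI)
qed

text \<open>In a minimal left ideal every element outside the zero ideal generates, which gives
  \<open>a\<close>; conversely \<open>R a\<close> is minimal, because every nonzero
  \<open>r a\<close> can be multiplied back to \<open>a\<close>.\<close>

lemma minimal_left_ideal_iff:
  assumes core: "ideal_core R L = {\<zero>}"
  shows "(\<exists>A. minimal_left_ideal R A) \<longleftrightarrow> has_minimal R {\<zero>}"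
proof
  assume "\<exists>A. minimal_left_ideal R A"
  then obtain A where A: "submodule A R (left_regular_module R)"
      "simple_left_module R ((left_regular_module R)\<lparr>carrier := A\<rparr>)" (is "simple_left_module R ?A")
    by (auto simp: minimal_left_ideal_def)
  interpret A: submodule A R "left_regular_module R" by fact
  have sub: "A \<subseteq> carrier R" using A.subset by (simp add: left_regular_module_def)
  obtain b x where x: "x \<in> A" "b \<in> carrier R" "b \<otimes> x \<noteq> \<zero>"
    using A(2) by (auto simp: simple_left_module_def left_regular_module_def)
  then have "x \<noteq> \<zero>" by auto
  show "has_minimal R {\<zero>}" unfolding has_minimal_def
  proof (rule bexI[of _ x], intro ballI impI)
    show "x \<in> carrier R - {\<zero>}" using x \<open>x \<noteq> \<zero>\<close> sub by auto
    fix r assume r: "r \<in> carrier R" "r \<otimes> x \<notin> {\<zero>}"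
    have "r \<otimes> x \<in> A" using A.smult_closed[of r x] r x by (simp add: left_regular_module_def)
    then obtain s where "s \<in> carrier R" "s \<otimes> (r \<otimes> x) = x"
      using simple_left_module_cyclic[OF A(2), of "r \<otimes> x" x] r x
      by (auto simp: left_regular_module_def)
    moreover have "x \<ominus> x = \<zero>" using sub x(1) r_neg by (metis a_minus_def subsetD)
    ultimately show "\<exists>s\<in>carrier R. s \<otimes> (r \<otimes> x) \<ominus> x \<in> {\<zero>}"
      by (metis singletonI)
  qed
next
  assume "has_minimal R {\<zero>}"
  then obtain a where a: "a \<in> carrier R" "a \<noteq> \<zero>"
    and min0: "\<And>r. r \<in> carrier R \<Longrightarrow> r \<otimes> a \<noteq> \<zero> \<Longrightarrow> \<exists>s\<in>carrier R. s \<otimes> (r \<otimes> a) \<ominus> a = \<zero>"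
    by (auto simp: has_minimal_def)
  have min: "\<exists>s\<in>carrier R. s \<otimes> (r \<otimes> a) = a" if r: "r \<in> carrier R" "r \<otimes> a \<noteq> \<zero>" for r
  proof -
    obtain s where s: "s \<in> carrier R" "s \<otimes> (r \<otimes> a) \<oplus> \<ominus> a = \<zero>"
      using min0[OF r] by (auto simp: a_minus_def)
    then have "s \<otimes> (r \<otimes> a) = \<ominus> (\<ominus> a)"
      using r a m_closed by (intro minus_equality[symmetric]) auto
    then show ?thesis using s a by auto
  qed
  \<comment> \<open>Faithfulness is used here: if \<open>R a = 0\<close>, then \<open>R\<close>
    kills the classes of all \<open>a r\<close>, so these lie in \<open>L\<close> by
    \<open>simple_zero\<close>, and \<open>a\<close> is in the core.\<close>
  have "\<exists>r\<in>carrier R. r \<otimes> a \<noteq> \<zero>"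
  proof (rule ccontr)
    assume *: "\<not> ?thesis"
    have "a \<in> ideal_core R L"
      unfolding ideal_core_def
    proof safe
      fix r assume r: "r \<in> carrier R"
      show "a \<otimes> r \<in> L"
        by (rule simple_zero) (use r a * m_closed in \<open>auto simp: m_assoc[symmetric]\<close>)
    qed (rule a)
    then show False using core a by simp
  qed
  then obtain t where t: "t \<in> carrier R" "t \<otimes> a \<noteq> \<zero>" by auto
  interpret M: left_module R "left_regular_module R"
  proof (intro left_module.intro left_module_axioms.intro nonunital_ring_axioms)
    show "abelian_group (left_regular_module R)"
      by (rule abelian_groupI) (auto simp: left_regular_module_def a_ac intro: l_neg)
  qed (auto simp: left_regular_module_def l_distr r_distr m_assoc m_closed)
  define A where "A = (\<lambda>r. r \<otimes> a) ` carrier R"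
  \<comment> \<open>Without a unit, \<open>a \<in> R a\<close> is not automatic; it follows from
    \<open>a = s (t a)\<close>.\<close>
  have aA: "a \<in> A"
  proof -
    obtain s where "s \<in> carrier R" "s \<otimes> (t \<otimes> a) = a" using min[OF t] by auto
    then show ?thesis using t a m_closed by (auto simp: A_def m_assoc intro!: image_eqI[of _ _ "s \<otimes> t"])
  qed
  have A: "submodule A R (left_regular_module R)"
    using M.submodule_orbit[of a] a by (simp add: A_def left_regular_module_def)
  interpret A: submodule A R "left_regular_module R" by (rule A)
  let ?A = "(left_regular_module R)\<lparr>carrier := A\<rparr>"
  have "left_module R ?A" using M.left_module_submodule A by simp
  moreover have "\<exists>b\<in>carrier R. \<exists>x\<in>carrier ?A. b \<odot>\<^bsub>?A\<^esub> x \<noteq> \<zero>\<^bsub>?A\<^esub>"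
    using t aA by (auto simp: left_regular_module_def)
  moreover have "N = {\<zero>\<^bsub>?A\<^esub>} \<or> N = carrier ?A" if N: "submodule N R ?A" for N
  proof (rule disjCI)
    assume ne: "N \<noteq> carrier ?A"
    interpret N: submodule N R ?A by (rule N)
    have "x = \<zero>" if x: "x \<in> N" for x
    proof (rule ccontr)
      assume "x \<noteq> \<zero>"
      moreover obtain r where r: "r \<in> carrier R" "x = r \<otimes> a"
        using x N.subset by (auto simp: left_regular_module_def A_def)
      ultimately obtain s where s: "s \<in> carrier R" "s \<otimes> x = a" using min by auto
      then have "a \<in> N" using N.smult_closed[OF s(1), of x] x by (simp add: left_regular_module_def)
      then have "A \<subseteq> N" using N.smult_closed[of _ a] by (auto simp: left_regular_module_def A_def)
      then show False using ne N.subset by (auto simp: left_regular_module_def)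
    qed
    moreover have "\<zero> \<in> N" using N.one_closed by (simp add: left_regular_module_def)
    ultimately have "N = {\<zero>}" by blast
    then show "N = {\<zero>\<^bsub>?A\<^esub>}" by (simp add: left_regular_module_def)
  qed
  ultimately show "\<exists>A. minimal_left_ideal R A"
    using A unfolding minimal_left_ideal_def simple_left_module_def by blast
qed

end

context surj_ring_hom
begin

text \<open>The kernel is the core and hence lies in \<open>L\<close>. So the image of
  \<open>L\<close> is maximal modular in \<open>S\<close>, with zero core: \<open>S\<close> acts
  faithfully on the same simple module.\<close>

lemma primitive_quotient:
  assumes L: "max_modular R L" and ker: "\<And>x. x \<in> carrier R \<Longrightarrow> h x = \<zero>\<^bsub>S\<^esub> \<longleftrightarrow> x \<in> ideal_core R L"
  shows "left_primitive S"
    and "(\<exists>A. minimal_left_ideal S A) \<longleftrightarrow> has_minimal R (ideal_core R L)"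
proof -
  have ker_L: "x \<in> L" if "x \<in> carrier R" "h x = \<zero>\<^bsub>S\<^esub>" for x
    using ker that max_modular_left_ideal.core_subset[OF max_modular_left_idealI[OF L]] by blast
  have mL: "max_modular S (h ` L)" by (rule max_modular_image[OF L ker_L])
  have "preimage (h ` L) = L"
    by (rule preimage_image[OF _ ker_L]) (use L in \<open>auto simp: max_modular_def\<close>)
  then have I: "preimage (ideal_core S (h ` L)) = ideal_core R L"
    using core_preimage[of "h ` L"] by simp
  have core: "ideal_core S (h ` L) = {\<zero>\<^bsub>S\<^esub>}"
  proof (intro equalityI subsetI)
    fix y assume y: "y \<in> ideal_core S (h ` L)"
    then have "y \<in> carrier S" by (auto simp: ideal_core_def)
    then obtain x where x: "x \<in> carrier R" "y = h x" by (rule lift)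
    then have "x \<in> ideal_core R L" using y I by (auto simp: preimage_def)
    then show "y \<in> {\<zero>\<^bsub>S\<^esub>}" using ker x by simp
  next
    have "two_sided_ideal (ideal_core S (h ` L)) S"
      by (rule max_modular_left_ideal.core_ideal[OF max_modular_left_idealI[OF mL]])
    then show "y \<in> ideal_core S (h ` L)" if "y \<in> {\<zero>\<^bsub>S\<^esub>}" for y
      using that additive_subgroup.zero_closed two_sided_ideal.axioms(1) by fastforce
  qed
  show "left_primitive S"
    by (rule max_modular_left_ideal.left_primitive[OF max_modular_left_idealI[OF mL] core])
  show "(\<exists>A. minimal_left_ideal S A) \<longleftrightarrow> has_minimal R (ideal_core R L)"
    using max_modular_left_ideal.minimal_left_ideal_iff[OF max_modular_left_idealI[OF mL] core]
      has_minimal_preimage[of "{\<zero>\<^bsub>S\<^esub>}"] I core by simp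
qed

lemma primitive_quotient_lift:
  assumes "left_primitive S"
  shows "\<exists>L. max_modular R L \<and> ((\<exists>A. minimal_left_ideal S A) \<longleftrightarrow> has_minimal R (ideal_core R L))"
proof -
  obtain L where L: "max_modular S L" "ideal_core S L = {\<zero>\<^bsub>S\<^esub>}"
    using left_primitive_imp_max_modular assms by blast
  then show ?thesis
    using max_modular_preimage[OF L(1)] core_preimage[of L] has_minimal_preimage
      max_modular_left_ideal.minimal_left_ideal_iff[OF max_modular_left_idealI[OF L(1)] L(2)]
    by (intro exI[of _ "preimage L"]) simp
qed

end

text \<open>A core has a primitive quotient, and a faithful simple module of a quotient pulls back
  to a maximal modular left ideal of \<open>R\<close>. This removes quotient rings from all later
  arguments.\<close>

theorem GCR_iff:
  assumes R: "nonunital_ring R"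
  shows "GCR R \<longleftrightarrow> (\<forall>L. max_modular R L \<longrightarrow> has_minimal R (ideal_core R L))"
proof (intro iffI allI impI)
  fix L assume GCR: "GCR R" and L: "max_modular R L"
  let ?I = "ideal_core R L"
  have I: "two_sided_ideal ?I R"
    by (rule max_modular_left_ideal.core_ideal[OF max_modular_left_idealI[OF L]])
  then have sub: "additive_subgroup ?I R" by (rule two_sided_ideal.axioms)
  have ker: "?I +>\<^bsub>R\<^esub> x = \<zero>\<^bsub>R Quot ?I\<^esub> \<longleftrightarrow> x \<in> ?I" if "x \<in> carrier R" for x
  proof -
    have "?I +>\<^bsub>R\<^esub> x = ?I \<longleftrightarrow> x \<in> ?I"
      using abelian_group.a_coset_join1[OF nonunital_ring.axioms(1)[OF R] _ that]
        abelian_group.a_coset_join2[OF nonunital_ring.axioms(1)[OF R] that]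
        additive_subgroup.a_subgroup[OF sub] by blast
    then show ?thesis by (simp add: FactRing_def)
  qed
  show "has_minimal R ?I"
    using surj_ring_hom.primitive_quotient[OF surj_ring_hom_Quot[OF R I] L ker] GCR I
    unfolding GCR_def by blast
next
  assume *: "\<forall>L. max_modular R L \<longrightarrow> has_minimal R (ideal_core R L)"
  show "GCR R"
    unfolding GCR_def
    using surj_ring_hom.primitive_quotient_lift[OF surj_ring_hom_Quot[OF R]] * by blast
qed

section \<open>Corners\<close>

text \<open>For an idempotent \<open>e\<close> this is \<open>e R e\<close>. Describing it by fixed
  points keeps the operations of \<open>R\<close> and makes membership a pair of equations.\<close>

definition corner :: "('a, 'c) ring_scheme \<Rightarrow> 'a \<Rightarrow> ('a, 'c) ring_scheme" where
  "corner R e = R\<lparr>carrier := {x \<in> carrier R. e \<otimes>\<^bsub>R\<^esub> x = x \<and> x \<otimes>\<^bsub>R\<^esub> e = x}\<rparr>"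

lemma corner_simps [simp]:
  "x \<in> carrier (corner R e) \<longleftrightarrow> x \<in> carrier R \<and> e \<otimes>\<^bsub>R\<^esub> x = x \<and> x \<otimes>\<^bsub>R\<^esub> e = x"
  "mult (corner R e) = mult R" "add (corner R e) = add R" "zero (corner R e) = zero R"
  by (auto simp: corner_def)

locale idempotent = R?: nonunital_ring R for R (structure) and e +
  assumes e_closed [simp]: "e \<in> carrier R" and e_idem: "e \<otimes> e = e"
begin

lemma corner_ring: "nonunital_ring (corner R e)"
proof -
  have grp: "abelian_group (corner R e)"
  proof (rule abelian_groupI)
    show "\<exists>y\<in>carrier (corner R e). y \<oplus>\<^bsub>corner R e\<^esub> x = \<zero>\<^bsub>corner R e\<^esub>" if "x \<in> carrier (corner R e)" for x
      using that by (intro bexI[of _ "\<ominus> x"]) (auto simp: l_neg l_minus r_minus)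
  qed (auto simp: l_distr r_distr a_ac)
  show ?thesis
    by (intro nonunital_ring.intro nonunital_ring_axioms.intro grp)
      (auto simp: l_distr r_distr m_closed m_assoc, simp_all add: m_assoc[symmetric])
qed

lemma corner_minus: "x \<in> carrier (corner R e) \<Longrightarrow> \<ominus>\<^bsub>corner R e\<^esub> x = \<ominus> x"
  by (rule abelian_group.minus_equality[OF nonunital_ring.axioms(1)[OF corner_ring]])
    (auto simp: l_neg l_minus r_minus)

lemma corner_diff: "\<lbrakk>x \<in> carrier (corner R e); y \<in> carrier (corner R e)\<rbrakk> \<Longrightarrow> x \<ominus>\<^bsub>corner R e\<^esub> y = x \<ominus> y"
  by (simp only: a_minus_def corner_minus corner_simps)

lemma e_e: "x \<in> carrier R \<Longrightarrow> e \<otimes> (e \<otimes> x) = e \<otimes> x"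
  by (simp add: m_assoc[symmetric] e_idem)

lemma absorb: "\<lbrakk>x \<in> carrier R; y \<in> carrier R; e \<otimes> x = x\<rbrakk> \<Longrightarrow> e \<otimes> (x \<otimes> y) = x \<otimes> y"
  by (simp add: m_assoc[symmetric])

lemma compress: "x \<in> carrier R \<Longrightarrow> e \<otimes> (x \<otimes> e) \<in> carrier (corner R e)"
  by (simp add: m_closed e_e) (simp add: m_assoc m_closed e_idem)

text \<open>An element \<open>x\<close> is in \<open>L'\<close> when \<open>x e\<close> lies in the
  largest submodule of \<open>R e\<close> whose intersection with the corner is contained in
  \<open>L\<close>. So \<open>R/L'\<close> is the simple module of \<open>R\<close> on which
  \<open>e\<close> cuts out the given module of the corner, and \<open>e\<close> itself is a right
  identity modulo \<open>L'\<close>.\<close>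

lemma max_modular_induced:
  assumes L: "max_modular (corner R e) L"
  defines "L' \<equiv> {x \<in> carrier R. \<forall>r\<in>carrier R. e \<otimes> (r \<otimes> (x \<otimes> e)) \<in> L}"
  shows "max_modular R L'"
    and "ideal_core R L' \<inter> carrier (corner R e) = ideal_core (corner R e) L"
proof -
  interpret L: max_modular_left_ideal L "corner R e" using L by (rule max_modular_left_idealI)
  have LC: "x \<in> L \<Longrightarrow> x \<in> carrier R \<and> e \<otimes> x = x \<and> x \<otimes> e = x" for x using L.a_subset by auto
  have Lmult: "x \<in> carrier R \<Longrightarrow> y \<in> L \<Longrightarrow> e \<otimes> (x \<otimes> y) \<in> L" for x y
    using L.l_closed[of y "e \<otimes> (x \<otimes> e)"] compress[of x] LC[of y] by (simp add: m_assoc m_closed)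
  have Ladd: "x \<in> L \<Longrightarrow> y \<in> L \<Longrightarrow> x \<oplus> y \<in> L" for x y
    using L.a_closed[of x y] by simp
  have Lminus: "x \<in> L \<Longrightarrow> \<ominus> x \<in> L" for x
    using L.a_inv_closed[of x] corner_minus[of x] LC[of x] by simp
  have Lzero: "\<zero> \<in> L" using L.zero_closed by simp
  have left: "left_ideal L' R"
  proof (intro left_ideal.intro left_ideal_axioms.intro nonunital_ring_axioms
      additive_subgroup.intro add.subgroupI)
    show "L' \<noteq> {}" using Lzero by (auto simp: L'_def intro!: exI[of _ \<zero>])
    show "x \<otimes> a \<in> L'" if "a \<in> L'" "x \<in> carrier R" for a x
    proof -
      have "e \<otimes> (r \<otimes> ((x \<otimes> a) \<otimes> e)) = e \<otimes> ((r \<otimes> x) \<otimes> (a \<otimes> e))" if "r \<in> carrier R" for r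
        using that \<open>x \<in> carrier R\<close> \<open>a \<in> L'\<close> by (simp add: m_assoc m_closed L'_def)
      then show ?thesis using that m_closed by (auto simp: L'_def)
    qed
  qed (auto simp: L'_def l_minus r_minus l_distr r_distr Ladd Lminus m_closed)
  obtain c where c: "c \<in> carrier (corner R e)" "c \<notin> L" using L.proper by auto
  have eL: "e \<notin> L" using Lmult[of c e] c by auto
  have "e \<notin> L'" using eL by (auto simp: L'_def e_idem intro!: bexI[of _ e])
  moreover have "r \<ominus> r \<otimes> e \<in> L'" if "r \<in> carrier R" for r
    using that Lzero
    by (auto simp: L'_def l_diff_distr r_diff_distr m_closed m_assoc e_idem) (simp add: a_minus_def r_neg m_closed)
  moreover have "\<exists>s\<in>carrier R. s \<otimes> y \<ominus> e \<in> L'" if y: "y \<in> carrier R" "y \<notin> L'" for y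
  proof -
    obtain r where r: "r \<in> carrier R" "e \<otimes> (r \<otimes> (y \<otimes> e)) \<notin> L" using y by (auto simp: L'_def)
    have C: "e \<otimes> (r \<otimes> (y \<otimes> e)) \<in> carrier (corner R e)"
      using compress[of "r \<otimes> y"] r y by (simp add: m_assoc m_closed)
    have eC: "e \<in> carrier (corner R e)" by (simp add: e_idem)
    obtain s where s: "s \<in> carrier (corner R e)" "s \<otimes> (e \<otimes> (r \<otimes> (y \<otimes> e))) \<ominus>\<^bsub>corner R e\<^esub> e \<in> L"
      using L.simple[of "e \<otimes> (r \<otimes> (y \<otimes> e))" e] C r(2) eC by auto
    let ?z = "s \<otimes> r"
    have s': "s \<in> carrier R" "e \<otimes> s = s" "s \<otimes> e = s" using s by auto
    have se: "s \<otimes> (e \<otimes> x) = s \<otimes> x" if "x \<in> carrier R" for x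
      using that s' by (metis m_assoc e_closed)
    have "s \<otimes> (e \<otimes> (r \<otimes> (y \<otimes> e))) \<in> carrier (corner R e)"
      using nonunital_ring.m_closed[OF corner_ring s(1) C] by simp
    then have 1: "s \<otimes> (r \<otimes> (y \<otimes> e)) \<ominus> e \<in> L"
      using s(2) corner_diff[OF _ eC] r y by (simp add: m_closed se)
    have "e \<otimes> (t \<otimes> ((?z \<otimes> y \<ominus> e) \<otimes> e)) \<in> L" if t: "t \<in> carrier R" for t
      using Lmult[OF t 1] t s' r y by (simp add: l_diff_distr m_closed m_assoc e_idem)
    then show ?thesis using s' r y by (intro bexI[of _ ?z]) (auto simp: L'_def m_closed)
  qed
  ultimately show "max_modular R L'"
    using left unfolding max_modular_def
    by - (rule conjI, assumption, rule bexI[of _ e], intro conjI ballI, auto)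
  show "ideal_core R L' \<inter> carrier (corner R e) = ideal_core (corner R e) L"
  proof safe
    fix b assume b: "b \<in> ideal_core R L'" "b \<in> carrier (corner R e)"
    have "b \<otimes> x \<in> L" if x: "x \<in> carrier R" "e \<otimes> x = x" "x \<otimes> e = x" for x
    proof -
      have "b \<otimes> x \<in> L'" using b x by (auto simp: ideal_core_def)
      then have "e \<otimes> (e \<otimes> ((b \<otimes> x) \<otimes> e)) \<in> L" by (auto simp: L'_def)
      then show ?thesis using x b by (simp add: e_e m_closed m_assoc) (simp add: m_assoc[symmetric])
    qed
    then show "b \<in> ideal_core (corner R e) L" using b by (auto simp: ideal_core_def)
  next
    fix b assume b: "b \<in> ideal_core (corner R e) L"
    then have bC: "b \<in> carrier R" "e \<otimes> b = b" "b \<otimes> e = b" by (auto simp: ideal_core_def)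
    have be: "b \<otimes> (e \<otimes> x) = b \<otimes> x" if "x \<in> carrier R" for x
      using that bC by (metis m_assoc e_closed)
    have "e \<otimes> (r \<otimes> ((b \<otimes> x) \<otimes> e)) \<in> L" if rx: "r \<in> carrier R" "x \<in> carrier R" for r x
    proof -
      have "b \<otimes> (e \<otimes> (x \<otimes> e)) \<in> L" using b compress[OF rx(2)] by (auto simp: ideal_core_def)
      then show ?thesis using Lmult[OF rx(1)] rx bC by (simp add: be m_assoc m_closed)
    qed
    then show "b \<in> ideal_core R L'" using bC m_closed by (auto simp: ideal_core_def L'_def)
  qed (auto simp: ideal_core_def)
qed

text \<open>The corner acts on \<open>e (R/L)\<close>, and this module is again simple: an
  \<open>s\<close> that moves one of its vectors to another may be replaced by \<open>e s e\<close>.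
  The new ideal is the annihilator of the nonzero vector \<open>e q\<close>.\<close>

lemma max_modular_restrict:
  assumes L: "max_modular R L" and e: "e \<notin> ideal_core R L"
  obtains L' where "max_modular (corner R e) L'"
    "ideal_core (corner R e) L' = ideal_core R L \<inter> carrier (corner R e)"
proof -
  interpret L: max_modular_left_ideal L R using L by (rule max_modular_left_idealI)
  obtain q where q: "q \<in> carrier R" "e \<otimes> q \<notin> L" using e by (auto simp: ideal_core_def)
  define L' where "L' = {x \<in> carrier (corner R e). x \<otimes> q \<in> L}"
  have left: "left_ideal L' (corner R e)"
  proof (intro left_ideal.intro left_ideal_axioms.intro corner_ring
      additive_subgroup.intro group.subgroupI abelian_group.a_group nonunital_ring.axioms(1))
    show "inv\<^bsub>add_monoid (corner R e)\<^esub> a \<in> L'" if "a \<in> L'" for a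
      using that q corner_minus[of a] unfolding a_inv_def[symmetric]
      by (simp add: L'_def l_minus r_minus)
    show "L' \<noteq> {}" using q by (auto simp: L'_def intro!: exI[of _ \<zero>])
  qed (use q in \<open>auto simp: L'_def l_distr r_distr m_closed m_assoc absorb L.l_closed\<close>)
  have eC: "e \<in> carrier (corner R e)" by (simp add: e_idem)
  have "max_modular (corner R e) L'"
    unfolding max_modular_def
  proof (rule conjI, rule left, rule bexI[of _ e], intro conjI ballI)
    show "e \<in> carrier (corner R e) - L'" using q eC by (simp add: L'_def)
    show "r \<ominus>\<^bsub>corner R e\<^esub> r \<otimes>\<^bsub>corner R e\<^esub> e \<in> L'" if "r \<in> carrier (corner R e)" for r
      using that q corner_diff[OF that that] by (simp add: L'_def) (simp add: a_minus_def r_neg)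
    show "\<exists>s\<in>carrier (corner R e). s \<otimes>\<^bsub>corner R e\<^esub> y \<ominus>\<^bsub>corner R e\<^esub> e \<in> L'"
      if y: "y \<in> carrier (corner R e) - L'" for y
    proof -
      have y': "y \<in> carrier R" "e \<otimes> y = y" "y \<otimes> q \<notin> L" using y by (auto simp: L'_def)
      obtain s where s: "s \<in> carrier R" "s \<otimes> (y \<otimes> q) \<ominus> e \<otimes> q \<in> L"
        using L.simple[of "y \<otimes> q" "e \<otimes> q"] y' q m_closed by auto
      let ?s = "e \<otimes> (s \<otimes> e)"
      have sC: "?s \<in> carrier (corner R e)" by (rule compress[OF s(1)])
      have "(?s \<otimes> y) \<otimes> q = e \<otimes> (s \<otimes> (y \<otimes> q))"
        using s y' q by (simp add: m_assoc m_closed absorb)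
      moreover have "e \<otimes> (s \<otimes> (y \<otimes> q)) \<ominus> e \<otimes> q \<in> L"
        using L.l_closed[OF s(2), of e] s q y' by (simp add: r_diff_distr m_closed e_e)
      ultimately have "(?s \<otimes> y \<ominus> e) \<otimes> q \<in> L"
        using s q y' by (simp add: l_diff_distr m_closed)
      moreover have "?s \<otimes> y \<in> carrier (corner R e)"
        using nonunital_ring.m_closed[OF corner_ring sC, of y] y by simp
      moreover have "?s \<otimes> y \<ominus>\<^bsub>corner R e\<^esub> e \<in> carrier (corner R e)"
        by (rule abelian_group.minus_closed[OF nonunital_ring.axioms(1)[OF corner_ring] \<open>?s \<otimes> y \<in> _\<close> eC])
      ultimately have "?s \<otimes>\<^bsub>corner R e\<^esub> y \<ominus>\<^bsub>corner R e\<^esub> e \<in> L'"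
        using corner_diff[of "?s \<otimes> y" e] eC unfolding L'_def by simp
      then show ?thesis using sC by blast
    qed
  qed
  moreover have "ideal_core (corner R e) L' = ideal_core R L \<inter> carrier (corner R e)"
  proof safe
    fix b assume b: "b \<in> ideal_core (corner R e) L'"
    then have bC: "b \<in> carrier R" "e \<otimes> b = b" "b \<otimes> e = b" by (auto simp: ideal_core_def)
    have "b \<otimes> r \<in> L" if r: "r \<in> carrier R" for r
    proof -
      obtain s where s: "s \<in> carrier R" "s \<otimes> (e \<otimes> q) \<ominus> r \<in> L"
        using L.simple[of "e \<otimes> q" r] q r m_closed by auto
      have "b \<otimes> (e \<otimes> (s \<otimes> e)) \<in> L'" using b compress[OF s(1)] by (auto simp: ideal_core_def)
      then have "(b \<otimes> (e \<otimes> (s \<otimes> e))) \<otimes> q \<in> L" by (auto simp: L'_def)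
      moreover have "(b \<otimes> (e \<otimes> (s \<otimes> e))) \<otimes> q = ((b \<otimes> e) \<otimes> s) \<otimes> (e \<otimes> q)"
        using bC(1) s q by (simp add: m_assoc m_closed)
      ultimately have "b \<otimes> (s \<otimes> (e \<otimes> q)) \<in> L" using bC s q by (simp add: m_assoc m_closed)
      moreover have "b \<otimes> (s \<otimes> (e \<otimes> q)) \<ominus> b \<otimes> r \<in> L"
        using L.l_closed[OF s(2) bC(1)] bC s q r by (simp add: r_diff_distr m_closed)
      ultimately show ?thesis
        using L.mem_cong[of "b \<otimes> (s \<otimes> (e \<otimes> q))" "b \<otimes> r"] bC s q r m_closed by auto
    qed
    then show "b \<in> ideal_core R L" using bC by (auto simp: ideal_core_def)
  next
    fix b assume b: "b \<in> ideal_core R L" "b \<in> carrier (corner R e)"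
    have "b \<otimes> x \<in> L'" if "x \<in> carrier (corner R e)" for x
      using b that q nonunital_ring.m_closed[OF corner_ring b(2) that]
      by (auto simp: ideal_core_def L'_def m_assoc m_closed)
    then show "b \<in> ideal_core (corner R e) L'" using b by (auto simp: ideal_core_def)
  qed (auto simp: ideal_core_def)
  ultimately show thesis by (rule that)
qed

text \<open>Primeness does the work in both directions. From \<open>R\<close> to the corner it gives
  \<open>r\<close> and \<open>x\<close> such that \<open>e r a x e\<close> is nonzero modulo the
  core. Back from the corner the same \<open>a\<close> serves, since a nonzero \<open>r a\<close>
  has a nonzero \<open>e t r a\<close> with \<open>e t r e\<close> in the corner.\<close>

lemma has_minimal_corner:
  assumes L: "max_modular R L" and e: "e \<notin> ideal_core R L"
  shows "has_minimal (corner R e) (ideal_core R L \<inter> carrier (corner R e)) \<longleftrightarrow> has_minimal R (ideal_core R L)"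
proof -
  interpret L: max_modular_left_ideal L R using L by (rule max_modular_left_idealI)
  let ?I = "ideal_core R L" and ?C = "carrier (corner R e)"
  interpret I: two_sided_ideal ?I R by (rule L.core_ideal)
  note Cmult = nonunital_ring.m_closed[OF corner_ring, unfolded corner_simps(2)]
  show ?thesis
  proof
    assume "has_minimal R ?I"
    then obtain a where a: "a \<in> carrier R" "a \<notin> ?I"
      and min: "\<And>r. r \<in> carrier R \<Longrightarrow> r \<otimes> a \<notin> ?I \<Longrightarrow> \<exists>s\<in>carrier R. s \<otimes> (r \<otimes> a) \<ominus> a \<in> ?I"
      by (auto simp: has_minimal_def)
    obtain x where x: "x \<in> carrier R" "a \<otimes> (x \<otimes> e) \<notin> ?I"
      using L.core_prime[of a e] a e by auto
    obtain r where r: "r \<in> carrier R" "e \<otimes> (r \<otimes> (a \<otimes> (x \<otimes> e))) \<notin> ?I"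
      using L.core_prime[of e "a \<otimes> (x \<otimes> e)"] a x e m_closed by auto
    let ?b = "e \<otimes> (r \<otimes> (a \<otimes> (x \<otimes> e)))"
    have bC: "?b \<in> ?C" using compress[of "r \<otimes> (a \<otimes> x)"] r a x by (simp add: m_assoc m_closed)
    show "has_minimal (corner R e) (?I \<inter> ?C)"
      unfolding has_minimal_def
    proof (rule bexI[of _ ?b], intro ballI impI)
      show "?b \<in> ?C - ?I \<inter> ?C" using bC r by blast
      fix t assume t: "t \<in> ?C" "t \<otimes>\<^bsub>corner R e\<^esub> ?b \<notin> ?I \<inter> ?C"
      then have tb: "t \<otimes> ?b \<notin> ?I" using Cmult[OF t(1) bC] by auto
      have t': "t \<in> carrier R" using t by simp
      have "t \<otimes> ?b = ((t \<otimes> (e \<otimes> r)) \<otimes> a) \<otimes> (x \<otimes> e)"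
        using t' r a x by (simp add: m_assoc m_closed)
      then have "(t \<otimes> (e \<otimes> r)) \<otimes> a \<notin> ?I" using tb I.I_r_closed x m_closed by auto
      then obtain s where s: "s \<in> carrier R" "s \<otimes> ((t \<otimes> (e \<otimes> r)) \<otimes> a) \<ominus> a \<in> ?I"
        using min[of "t \<otimes> (e \<otimes> r)"] t' r m_closed by auto
      \<comment> \<open>The relation for \<open>a\<close> is multiplied by \<open>e r\<close> on the
        left and by \<open>x e\<close> on the right, which turns \<open>a\<close> into
        \<open>?b\<close>.\<close>
      have "(e \<otimes> r) \<otimes> ((s \<otimes> ((t \<otimes> (e \<otimes> r)) \<otimes> a) \<ominus> a) \<otimes> (x \<otimes> e)) \<in> ?I"
        using s r x m_closed by (intro I.I_l_closed I.I_r_closed) auto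
      also have "(e \<otimes> r) \<otimes> ((s \<otimes> ((t \<otimes> (e \<otimes> r)) \<otimes> a) \<ominus> a) \<otimes> (x \<otimes> e))
          = (e \<otimes> (r \<otimes> s)) \<otimes> (t \<otimes> ?b) \<ominus> ?b"
        using s r x t' a by (simp add: l_diff_distr r_diff_distr m_closed m_assoc)
      also have "t \<otimes> ?b = e \<otimes> (t \<otimes> ?b)"
        using Cmult[OF t(1) bC] by simp
      also have "(e \<otimes> (r \<otimes> s)) \<otimes> (e \<otimes> (t \<otimes> ?b)) = (e \<otimes> ((r \<otimes> s) \<otimes> e)) \<otimes> (t \<otimes> ?b)"
        using s r x t' a by (simp add: m_closed m_assoc)
      finally have 1: "(e \<otimes> ((r \<otimes> s) \<otimes> e)) \<otimes> (t \<otimes> ?b) \<ominus> ?b \<in> ?I" .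
      let ?s = "e \<otimes> ((r \<otimes> s) \<otimes> e)"
      have sC: "?s \<in> ?C" using compress[of "r \<otimes> s"] r s m_closed by simp
      have "?s \<otimes> (t \<otimes> ?b) \<in> ?C" by (rule Cmult[OF sC Cmult[OF t(1) bC]])
      then have "?s \<otimes> (t \<otimes> ?b) \<ominus>\<^bsub>corner R e\<^esub> ?b \<in> ?I \<inter> ?C"
        using corner_diff[OF _ bC] 1 abelian_group.minus_closed[OF nonunital_ring.axioms(1)[OF corner_ring] _ bC]
        by (metis IntI)
      then show "\<exists>s\<in>?C. s \<otimes>\<^bsub>corner R e\<^esub> (t \<otimes>\<^bsub>corner R e\<^esub> ?b) \<ominus>\<^bsub>corner R e\<^esub> ?b \<in> ?I \<inter> ?C"
        using sC by (metis corner_simps(2))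
    qed
  next
    assume "has_minimal (corner R e) (?I \<inter> ?C)"
    then obtain a where a: "a \<in> ?C" "a \<notin> ?I"
      and min: "\<And>r. r \<in> ?C \<Longrightarrow> r \<otimes> a \<notin> ?I \<inter> ?C \<Longrightarrow> \<exists>s\<in>?C. s \<otimes> (r \<otimes> a) \<ominus>\<^bsub>corner R e\<^esub> a \<in> ?I \<inter> ?C"
      unfolding has_minimal_def corner_simps(2) by blast
    have a': "a \<in> carrier R" "e \<otimes> a = a" using a by auto
    show "has_minimal R ?I"
      unfolding has_minimal_def
    proof (rule bexI[of _ a], intro ballI impI)
      show "a \<in> carrier R - ?I" using a by simp
      fix r assume r: "r \<in> carrier R" "r \<otimes> a \<notin> ?I"
      obtain t where t: "t \<in> carrier R" "e \<otimes> (t \<otimes> (r \<otimes> a)) \<notin> ?I"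
        using L.core_prime[of e "r \<otimes> a"] r a' e m_closed by auto
      let ?r = "e \<otimes> ((t \<otimes> r) \<otimes> e)"
      have rC: "?r \<in> ?C" using compress[of "t \<otimes> r"] t r m_closed by simp
      have ra: "?r \<otimes> a = e \<otimes> (t \<otimes> (r \<otimes> a))" using t r a' by (simp add: m_closed m_assoc)
      obtain s where s: "s \<in> ?C" "s \<otimes> (?r \<otimes> a) \<ominus>\<^bsub>corner R e\<^esub> a \<in> ?I"
        using min[OF rC] t(2) ra by auto
      then have "s \<otimes> (?r \<otimes> a) \<ominus> a \<in> ?I"
        using corner_diff[OF Cmult[OF s(1) Cmult[OF rC a(1)]] a(1)] by simp
      then have "(s \<otimes> (e \<otimes> t)) \<otimes> (r \<otimes> a) \<ominus> a \<in> ?I"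
        using s t r a' unfolding ra by (simp add: m_closed m_assoc)
      then show "\<exists>s\<in>carrier R. s \<otimes> (r \<otimes> a) \<ominus> a \<in> ?I"
        using s t m_closed by (intro bexI[of _ "s \<otimes> (e \<otimes> t)"]) auto
    qed
  qed
qed

theorem GCR_corner:
  assumes "GCR R"
  shows "GCR (corner R e)"
  unfolding GCR_iff[OF corner_ring]
proof (intro allI impI)
  fix L assume L: "max_modular (corner R e) L"
  define L' where "L' = {x \<in> carrier R. \<forall>r\<in>carrier R. e \<otimes> (r \<otimes> (x \<otimes> e)) \<in> L}"
  have L': "max_modular R L'"
    "ideal_core R L' \<inter> carrier (corner R e) = ideal_core (corner R e) L"
    unfolding L'_def by (rule max_modular_induced[OF L])+
  have "e \<notin> ideal_core R L'"
  proof
    assume e: "e \<in> ideal_core R L'"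
    interpret L: max_modular_left_ideal L "corner R e" using L by (rule max_modular_left_idealI)
    obtain c where c: "c \<in> carrier (corner R e)" "c \<notin> L" using L.proper by auto
    have "e \<in> carrier (corner R e)" by (simp add: e_idem)
    then have "e \<in> ideal_core (corner R e) L" using L'(2) e by blast
    then have "e \<in> L" using L.core_subset by blast
    then show False using L.l_closed[of e c] c by simp
  qed
  then show "has_minimal (corner R e) (ideal_core (corner R e) L)"
    using has_minimal_corner[OF L'(1)] assms L'(1) GCR_iff[OF nonunital_ring_axioms]
    unfolding L'(2) by blast
qed

end

theorem (in surj_ring_hom) GCR_image:
  assumes "GCR R"
  shows "GCR S"
  unfolding GCR_iff[OF S.nonunital_ring_axioms]
proof (intro allI impI)
  fix L assume L: "max_modular S L"
  then have "has_minimal R (preimage (ideal_core S L))"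
    using assms max_modular_preimage[OF L] core_preimage[of L] GCR_iff[OF R.nonunital_ring_axioms] by auto
  then show "has_minimal S (ideal_core S L)" using has_minimal_preimage by simp
qed

text \<open>If the kernel of \<open>h\<close> lies in the core, the corner modulo the core is a
  quotient of \<open>S\<close>, so \<open>S\<close> being GCR supplies the minimal element, first in
  the corner and then in \<open>R\<close>.\<close>

theorem (in idempotent) has_minimal_of_corner_hom:
  assumes L: "max_modular R L" and e: "e \<notin> ideal_core R L"
    and h: "surj_ring_hom (corner R e) S h" and S: "GCR S"
    and ker: "\<And>x. x \<in> carrier (corner R e) \<Longrightarrow> h x = \<zero>\<^bsub>S\<^esub> \<Longrightarrow> x \<in> ideal_core R L"
  shows "has_minimal R (ideal_core R L)"
proof -
  interpret h: surj_ring_hom "corner R e" S h by (rule h)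
  obtain L' where L': "max_modular (corner R e) L'"
    "ideal_core (corner R e) L' = ideal_core R L \<inter> carrier (corner R e)"
    using max_modular_restrict[OF L e] .
  have ker': "x \<in> L'" if "x \<in> carrier (corner R e)" "h x = \<zero>\<^bsub>S\<^esub>" for x
    using ker[OF that] L'(2) that max_modular_left_ideal.core_subset[OF max_modular_left_idealI[OF L'(1)]] by blast
  have mL: "max_modular S (h ` L')" by (rule h.max_modular_image[OF L'(1) ker'])
  have "h.preimage (h ` L') = L'"
    by (rule h.preimage_image[OF _ ker']) (use L' in \<open>auto simp: max_modular_def\<close>)
  then have "h.preimage (ideal_core S (h ` L')) = ideal_core (corner R e) L'"
    using h.core_preimage[of "h ` L'"] by simp
  moreover have "has_minimal S (ideal_core S (h ` L'))"
    using S mL GCR_iff[OF h.S.nonunital_ring_axioms] by blast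
  ultimately have "has_minimal (corner R e) (ideal_core (corner R e) L')"
    using h.has_minimal_preimage by metis
  then show ?thesis using has_minimal_corner[OF L e] L'(2) by simp
qed

section \<open>Convolution\<close>

context topological_groupoid
begin

abbreviation Arr :: "'a set" where "Arr \<equiv> topspace (arrows G)"

lemma src_units [simp]: "x \<in> Arr \<Longrightarrow> src G x \<in> units G"
  by (auto simp: units_def)

lemma unit_arrow: "u \<in> units G \<Longrightarrow> u \<in> Arr"
  using units_subset by auto

lemma comp_simps [simp]:
  assumes "x \<in> Arr" "y \<in> Arr" "src G x = tgt G y"
  shows "gcomp G x y \<in> Arr" "src G (gcomp G x y) = src G y" "tgt G (gcomp G x y) = tgt G x"
  using assms comp_arrow src_comp tgt_comp by (auto simp: composable_def)

declare tgt_unit [simp] src_of_unit [simp] tgt_of_unit [simp] inv_arrow [simp] src_inv [simp] tgt_inv [simp]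
  comp_src [simp] comp_tgt [simp] comp_inv [simp] inv_comp [simp]

lemma comp_assoc':
  "\<lbrakk>x \<in> Arr; y \<in> Arr; z \<in> Arr; src G x = tgt G y; src G y = tgt G z\<rbrakk>
    \<Longrightarrow> gcomp G (gcomp G x y) z = gcomp G x (gcomp G y z)"
  using comp_assoc by (auto simp: composable_def)

lemma comp_cancel [simp]:
  "\<lbrakk>x \<in> Arr; y \<in> Arr; src G x = tgt G y\<rbrakk> \<Longrightarrow> gcomp G (gcomp G x y) (ginv G y) = x"
  "\<lbrakk>x \<in> Arr; y \<in> Arr; src G x = src G y\<rbrakk> \<Longrightarrow> gcomp G (gcomp G x (ginv G y)) y = x"
  "\<lbrakk>x \<in> Arr; y \<in> Arr; src G x = tgt G y\<rbrakk> \<Longrightarrow> gcomp G (ginv G x) (gcomp G x y) = y"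
  "\<lbrakk>x \<in> Arr; y \<in> Arr; tgt G x = tgt G y\<rbrakk> \<Longrightarrow> gcomp G x (gcomp G (ginv G x) y) = y"
proof -
  show "gcomp G (gcomp G x y) (ginv G y) = x" if "x \<in> Arr" "y \<in> Arr" "src G x = tgt G y"
    using that comp_assoc'[of x y "ginv G y"] comp_src[of x] by simp
  show "gcomp G (gcomp G x (ginv G y)) y = x" if "x \<in> Arr" "y \<in> Arr" "src G x = src G y"
    using that comp_assoc'[of x "ginv G y" y] comp_src[of x] by simp
  show "gcomp G (ginv G x) (gcomp G x y) = y" if "x \<in> Arr" "y \<in> Arr" "src G x = tgt G y"
    using that comp_assoc'[of "ginv G x" x y] comp_tgt[of y] by simp
  show "gcomp G x (gcomp G (ginv G x) y) = y" if "x \<in> Arr" "y \<in> Arr" "tgt G x = tgt G y"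
    using that comp_assoc'[of x "ginv G x" y] comp_tgt[of y] by simp
qed

lemma inv_inv [simp]: "x \<in> Arr \<Longrightarrow> ginv G (ginv G x) = x"
  using comp_cancel(1)[of x "ginv G x"] comp_tgt[of "ginv G (ginv G x)"]
    by simp

lemma inv_comp_rev:
  assumes "x \<in> Arr" "y \<in> Arr" "src G x = tgt G y"
  shows "ginv G (gcomp G x y) = gcomp G (ginv G y) (ginv G x)"
proof -
  have "gcomp G (ginv G y) (ginv G x) = gcomp G (gcomp G (gcomp G (ginv G y) (ginv G x)) (gcomp G x y)) (ginv G (gcomp G x y))"
    using assms by (intro comp_cancel(1)[symmetric]) auto
  also have "gcomp G (gcomp G (ginv G y) (ginv G x)) (gcomp G x y) = src G y"
    using assms comp_assoc'[of "ginv G y" "ginv G x" "gcomp G x y"] by simp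
  finally show ?thesis using assms comp_tgt[of "ginv G (gcomp G x y)"] by simp
qed

lemma unit_inv [simp]: "u \<in> units G \<Longrightarrow> ginv G u = u"
  using comp_inv[of u] comp_tgt[of "ginv G u"] unit_arrow[of u] by simp

section \<open>Convolution of functions with finite support on source fibres\<close>

definition fib :: "'a \<Rightarrow> 'a set" where
  "fib u = {x \<in> Arr. src G x = u}"

text \<open>This condition makes convolution distributive and associative. It holds in Steinberg
  algebras and in group rings alike, so the ring laws are derived once for both.\<close>

definition source_finite :: "('a \<Rightarrow> 'k::field) \<Rightarrow> bool" where
  "source_finite f \<longleftrightarrow> (\<forall>x. x \<notin> Arr \<longrightarrow> f x = 0) \<and> (\<forall>u. finite {x \<in> fib u. f x \<noteq> 0})"

definition conv :: "('a \<Rightarrow> 'k::field) \<Rightarrow> ('a \<Rightarrow> 'k) \<Rightarrow> 'a \<Rightarrow> 'k" where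
  "conv f g x = (if x \<in> Arr then \<Sum>y\<in>{y \<in> fib (src G x). g y \<noteq> 0}. f (gcomp G x (ginv G y)) * g y else 0)"

lemma mult_steinberg: "mult (steinberg_algebra G) = conv"
  by (intro ext) (simp add: steinberg_algebra_def conv_def fib_def)

lemma conv_outside: "x \<notin> Arr \<Longrightarrow> conv f g x = 0"
  by (simp add: conv_def)

lemma source_finiteD:
  "source_finite f \<Longrightarrow> x \<notin> Arr \<Longrightarrow> f x = 0"
  "source_finite f \<Longrightarrow> finite {x \<in> fib u. f x \<noteq> 0}"
  by (auto simp: source_finite_def)

lemma conv_eq:
  assumes "x \<in> Arr" "finite Y" "Y \<subseteq> fib (src G x)" "\<And>y. y \<in> fib (src G x) \<Longrightarrow> g y \<noteq> 0 \<Longrightarrow> y \<in> Y"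
  shows "conv f g x = (\<Sum>y\<in>Y. f (gcomp G x (ginv G y)) * g y)"
  unfolding conv_def using assms by (auto intro!: sum.mono_neutral_left)

lemma conv_add_left: "conv (\<lambda>x. f x + f' x) g = (\<lambda>x. conv f g x + conv f' g x)"
  by (auto simp: conv_def sum.distrib distrib_right)

lemma conv_add_right:
  assumes "source_finite g" "source_finite g'"
  shows "conv f (\<lambda>x. g x + g' x) = (\<lambda>x. conv f g x + conv f g' x)"
proof
  fix x
  show "conv f (\<lambda>x. g x + g' x) x = conv f g x + conv f g' x"
  proof (cases "x \<in> Arr")
    case True
    let ?Y = "{y \<in> fib (src G x). g y \<noteq> 0} \<union> {y \<in> fib (src G x). g' y \<noteq> 0}"
    have "finite ?Y" using assms source_finiteD(2) by blast
    then have *: "conv f h x = (\<Sum>y\<in>?Y. f (gcomp G x (ginv G y)) * h y)"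
      if "h = g \<or> h = g' \<or> h = (\<lambda>x. g x + g' x)" for h
      using that True by (intro conv_eq) auto
    show ?thesis
      unfolding *[OF disjI1[OF refl]] *[OF disjI2[OF disjI1[OF refl]]] *[OF disjI2[OF disjI2[OF refl]]]
      by (simp only: distrib_left sum.distrib)
  qed (simp add: conv_def)
qed

lemma source_finite_add:
  assumes "source_finite g" "source_finite g'"
  shows "source_finite (\<lambda>x. g x + g' x)"
  unfolding source_finite_def
proof (intro conjI allI impI)
  fix u
  have "{x \<in> fib u. g x + g' x \<noteq> 0} \<subseteq> {x \<in> fib u. g x \<noteq> 0} \<union> {x \<in> fib u. g' x \<noteq> 0}" by auto
  then show "finite {x \<in> fib u. g x + g' x \<noteq> 0}"
    by (rule finite_subset) (use assms in \<open>simp add: source_finite_def\<close>)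
qed (use assms in \<open>simp add: source_finite_def\<close>)

text \<open>Both sides sum over factorisations of \<open>x\<close> into three arrows. The finite set
  \<open>B\<close> of products \<open>w z\<close> of supported arrows contains the support of
  \<open>conv g h\<close> on the fibre, so the sums can be exchanged and reindexed by
  \<open>y = w z\<close>.\<close>

lemma conv_assoc:
  fixes f :: "'a \<Rightarrow> 'k::field"
  assumes g: "source_finite g" and h: "source_finite h"
  shows "conv (conv f g) h = conv f (conv g h)"
proof
  fix x
  show "conv (conv f g) h x = conv f (conv g h) x"
  proof (cases "x \<in> Arr")
    case x: True
    define A where "A = {z \<in> fib (src G x). h z \<noteq> 0}"
    define W where "W z = {w \<in> fib (tgt G z). g w \<noteq> 0}" for z
    define B where "B = (\<Union>z\<in>A. (\<lambda>w. gcomp G w z) ` W z)"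
    have fin: "finite A" "\<And>z. finite (W z)" "finite B"
      using source_finiteD(2)[OF g] source_finiteD(2)[OF h] by (auto simp: A_def W_def B_def)
    have B: "B \<subseteq> fib (src G x)" by (auto simp: B_def A_def W_def fib_def)
    have gh: "conv g h y = (\<Sum>z\<in>A. g (gcomp G y (ginv G z)) * h z)" if "y \<in> fib (src G x)" for y
      using that by (simp add: conv_def A_def fib_def)
    have supp: "y \<in> (\<lambda>w. gcomp G w z) ` W z"
      if "y \<in> fib (src G x)" "z \<in> A" "g (gcomp G y (ginv G z)) \<noteq> 0" for y z
    proof (rule image_eqI)
      show "y = gcomp G (gcomp G y (ginv G z)) z" using that by (simp add: A_def fib_def)
      show "gcomp G y (ginv G z) \<in> W z" using that by (simp add: A_def W_def fib_def)
    qed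
    have "conv f (conv g h) x = (\<Sum>y\<in>B. f (gcomp G x (ginv G y)) * conv g h y)"
    proof (rule conv_eq[OF x fin(3) B])
      fix y assume y: "y \<in> fib (src G x)" "conv g h y \<noteq> 0"
      then obtain z where "z \<in> A" "g (gcomp G y (ginv G z)) * h z \<noteq> 0"
        using gh sum.not_neutral_contains_not_neutral by (metis (no_types, lifting))
      then show "y \<in> B" using supp[OF y(1), of z] by (auto simp: B_def)
    qed
    also have "\<dots> = (\<Sum>y\<in>B. \<Sum>z\<in>A. f (gcomp G x (ginv G y)) * (g (gcomp G y (ginv G z)) * h z))"
      using B by (intro sum.cong refl) (simp add: gh subset_iff sum_distrib_left)
    also have "\<dots> = (\<Sum>z\<in>A. \<Sum>y\<in>B. f (gcomp G x (ginv G y)) * (g (gcomp G y (ginv G z)) * h z))"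
      by (rule sum.swap)
    also have "\<dots> = (\<Sum>z\<in>A. conv f g (gcomp G x (ginv G z)) * h z)"
    proof (rule sum.cong[OF refl])
      fix z assume z: "z \<in> A"
      then have z': "z \<in> Arr" "src G z = src G x" by (auto simp: A_def fib_def)
      have inj: "inj_on (\<lambda>w. gcomp G w z) (W z)"
        by (rule inj_on_inverseI[of _ "\<lambda>y. gcomp G y (ginv G z)"]) (use z' in \<open>auto simp: W_def fib_def\<close>)
      have "(\<Sum>y\<in>B. f (gcomp G x (ginv G y)) * (g (gcomp G y (ginv G z)) * h z)) =
          (\<Sum>y\<in>(\<lambda>w. gcomp G w z) ` W z. f (gcomp G x (ginv G y)) * (g (gcomp G y (ginv G z)) * h z))"
        using z B supp[OF _ z] fin by (intro sum.mono_neutral_right) (auto simp: B_def)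
      also have "\<dots> = (\<Sum>w\<in>W z. f (gcomp G (gcomp G x (ginv G z)) (ginv G w)) * g w) * h z"
        unfolding sum.reindex[OF inj] sum_distrib_right
      proof (rule sum.cong[OF refl])
        fix w assume "w \<in> W z"
        then have w: "w \<in> Arr" "src G w = tgt G z" by (auto simp: W_def fib_def)
        have "gcomp G x (ginv G (gcomp G w z)) = gcomp G (gcomp G x (ginv G z)) (ginv G w)"
          using w z' x inv_comp_rev[of w z] comp_assoc'[of x "ginv G z" "ginv G w"] by simp
        then show "((\<lambda>y. f (gcomp G x (ginv G y)) * (g (gcomp G y (ginv G z)) * h z)) \<circ> (\<lambda>w. gcomp G w z)) w =
            f (gcomp G (gcomp G x (ginv G z)) (ginv G w)) * g w * h z"
          using w z' by simp
      qed
      also have "(\<Sum>w\<in>W z. f (gcomp G (gcomp G x (ginv G z)) (ginv G w)) * g w) = conv f g (gcomp G x (ginv G z))"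
        using x z' by (simp add: conv_def W_def)
      finally show "(\<Sum>y\<in>B. f (gcomp G x (ginv G y)) * (g (gcomp G y (ginv G z)) * h z)) =
        conv f g (gcomp G x (ginv G z)) * h z" .
    qed
    also have "\<dots> = conv (conv f g) h x"
      using x by (simp add: conv_def[of "conv f g"] A_def)
    finally show ?thesis by simp
  qed (simp add: conv_def)
qed

text \<open>The ranges of \<open>x y^-1\<close> and \<open>x\<close> agree and \<open>B\<close> has
  at most one arrow \<open>b\<close> with that range, so only the term \<open>y = b^-1 x\<close> can
  survive.\<close>

lemma conv_indicator_left:
  fixes f :: "'a \<Rightarrow> 'k::field"
  assumes B: "B \<subseteq> Arr" "inj_on (tgt G) B" and f: "source_finite f" and x: "x \<in> Arr"
  shows "b \<in> B \<Longrightarrow> tgt G b = tgt G x \<Longrightarrow> conv (indicator B) f x = f (gcomp G (ginv G b) x)"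
    and "tgt G x \<notin> tgt G ` B \<Longrightarrow> conv (indicator B) f x = 0"
proof -
  let ?Y = "{y \<in> fib (src G x). f y \<noteq> 0}"
  have t: "tgt G (gcomp G x (ginv G y)) = tgt G x" if "y \<in> ?Y" for y
    using that x by (simp add: fib_def)
  show "conv (indicator B) f x = 0" if "tgt G x \<notin> tgt G ` B"
  proof -
    have "gcomp G x (ginv G y) \<notin> B" if "y \<in> ?Y" for y
      using t[OF that] \<open>tgt G x \<notin> _\<close> by (metis imageI)
    then show ?thesis using x by (simp add: conv_def)
  qed
  show "conv (indicator B) f x = f (gcomp G (ginv G b) x)" if b: "b \<in> B" "tgt G b = tgt G x"
  proof -
    have bA: "b \<in> Arr" using b B by auto
    let ?y = "gcomp G (ginv G b) x"
    have y: "?y \<in> fib (src G x)" using bA b x by (simp add: fib_def)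
    have eq: "gcomp G x (ginv G y) \<in> B \<longleftrightarrow> y = ?y" if y: "y \<in> fib (src G x)" for y
    proof
      assume *: "gcomp G x (ginv G y) \<in> B"
      have y': "y \<in> Arr" "src G y = src G x" using y by (auto simp: fib_def)
      have "gcomp G x (ginv G y) = b" using inj_onD[OF B(2) _ * b(1)] y' b x by simp
      then have "gcomp G b y = x" using y' x by (metis comp_cancel(2))
      moreover have "src G b = tgt G y" using \<open>_ = b\<close> y' x by auto
      ultimately show "y = ?y" using comp_cancel(3)[OF bA y'(1)] by simp
    next
      assume "y = ?y"
      then show "gcomp G x (ginv G y) \<in> B" using b bA x inv_comp_rev[of "ginv G b" x]
        by simp
    qed
    have "conv (indicator B) f x = (\<Sum>y\<in>?Y. if y = ?y then f y else 0)"
      using x unfolding conv_def by (auto intro!: sum.cong simp: eq)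
    also have "\<dots> = f ?y" using y source_finiteD(2)[OF f] by simp
    finally show ?thesis .
  qed
qed

lemma conv_indicator_right:
  fixes f :: "'a \<Rightarrow> 'k::field"
  assumes B: "B \<subseteq> Arr" "inj_on (src G) B" and x: "x \<in> Arr"
  shows "b \<in> B \<Longrightarrow> src G b = src G x \<Longrightarrow> conv f (indicator B) x = f (gcomp G x (ginv G b))"
    and "src G x \<notin> src G ` B \<Longrightarrow> conv f (indicator B) x = 0"
proof -
  show "conv f (indicator B) x = f (gcomp G x (ginv G b))" if b: "b \<in> B" "src G b = src G x"
  proof -
    have "conv f (indicator B) x = (\<Sum>y\<in>{b}. f (gcomp G x (ginv G y)) * indicator B y)"
      using b B x by (intro conv_eq) (auto simp: fib_def indicator_def inj_on_def split: if_splits)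
    then show ?thesis using b by simp
  qed
  show "conv f (indicator B) x = 0" if "src G x \<notin> src G ` B"
  proof -
    have "y \<notin> B" if "y \<in> fib (src G x)" for y
      using that \<open>src G x \<notin> _\<close> by (metis (mono_tags, lifting) fib_def image_eqI mem_Collect_eq)
    then show ?thesis by (auto simp: conv_def intro!: sum.neutral)
  qed
qed

lemma source_finite_indicator:
  assumes "B \<subseteq> Arr" "inj_on (src G) B"
  shows "source_finite (\<lambda>x. c * indicator B x)"
  unfolding source_finite_def
proof (intro conjI allI impI)
  fix u
  have "inj_on (src G) {x \<in> fib u. c * indicator B x \<noteq> 0}"
    by (rule inj_on_subset[OF assms(2)]) (auto simp: indicator_def)
  moreover have "src G ` {x \<in> fib u. c * indicator B x \<noteq> 0} \<subseteq> {u}" by (auto simp: fib_def)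
  ultimately show "finite {x \<in> fib u. c * indicator B x \<noteq> 0}"
    by (rule inj_on_finite) simp
qed (use assms in \<open>auto simp: indicator_def\<close>)

lemma units_inj_on:
  assumes "V \<subseteq> units G"
  shows "V \<subseteq> Arr" "inj_on (src G) V" "inj_on (tgt G) V" "src G ` V = V" "tgt G ` V = V"
proof -
  have V: "src G v = v" "tgt G v = v" "v \<in> Arr" if "v \<in> V" for v
    using that assms unit_arrow by auto
  then show "V \<subseteq> Arr" "inj_on (src G) V" "inj_on (tgt G) V" "src G ` V = V" "tgt G ` V = V"
    by (auto simp: inj_on_def image_iff)
qed

lemma conv_unit_left:
  fixes f :: "'a \<Rightarrow> 'k::field"
  assumes "V \<subseteq> units G" "source_finite f"
  shows "conv (indicator V) f = (\<lambda>x. if x \<in> Arr \<and> tgt G x \<in> V then f x else 0)"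
proof
  fix x
  note V = units_inj_on(1,3,5)[OF assms(1)]
  consider "x \<notin> Arr" | "x \<in> Arr" "tgt G x \<in> V" | "x \<in> Arr" "tgt G x \<notin> V" by blast
  then show "conv (indicator V) f x = (if x \<in> Arr \<and> tgt G x \<in> V then f x else 0)"
  proof cases
    case 2
    then have "tgt G (tgt G x) = tgt G x" by simp
    then show ?thesis using 2 conv_indicator_left(1)[OF V(1,2) assms(2) 2(1,2)] by simp
  next
    case 3
    then show ?thesis using conv_indicator_left(2)[OF V(1,2) assms(2) 3(1)] V(3) by simp
  qed (simp add: conv_def)
qed

lemma conv_unit_right:
  fixes f :: "'a \<Rightarrow> 'k::field"
  assumes "V \<subseteq> units G"
  shows "conv f (indicator V) = (\<lambda>x. if x \<in> Arr \<and> src G x \<in> V then f x else 0)"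
proof
  fix x
  note V = units_inj_on(1,2,4)[OF assms]
  consider "x \<notin> Arr" | "x \<in> Arr" "src G x \<in> V" | "x \<in> Arr" "src G x \<notin> V" by blast
  then show "conv f (indicator V) x = (if x \<in> Arr \<and> src G x \<in> V then f x else 0)"
  proof cases
    case 2
    then have "src G (src G x) = src G x" by simp
    then show ?thesis using 2 conv_indicator_right(1)[OF V(1,2) 2(1,2)] by simp
  next
    case 3
    then show ?thesis using conv_indicator_right(2)[OF V(1,2) 3(1)] V(3) by simp
  qed (simp add: conv_def)
qed

end

section \<open>Ample groupoids\<close>

lemma open_map_local_homeomorphism:
  assumes "local_homeomorphism X Y f"
  shows "open_map X Y f"
  unfolding open_map_def
proof (intro allI impI)
  fix W assume W: "openin X W"
  have "\<exists>V. openin Y V \<and> y \<in> V \<and> V \<subseteq> f ` W" if y: "y \<in> f ` W" for y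
  proof -
    obtain x where x: "x \<in> W" "y = f x" using y by auto
    then have "x \<in> topspace X" using W openin_subset by blast
    then obtain U where U: "openin X U" "x \<in> U" "openin Y (f ` U)"
        "homeomorphic_map (subtopology X U) (subtopology Y (f ` U)) f"
      using assms by (auto simp: local_homeomorphism_def)
    have "openin (subtopology X U) (W \<inter> U)" using W by (rule openin_subtopology_Int)
    then have "openin (subtopology Y (f ` U)) (f ` (W \<inter> U))"
      using homeomorphic_imp_open_map[OF U(4)] by (auto simp: open_map_def)
    then have "openin Y (f ` (W \<inter> U))" using U(3) by (rule openin_trans_full)
    then show ?thesis using x U(2) by (intro exI[of _ "f ` (W \<inter> U)"]) auto
  qed
  then show "openin Y (f ` W)" by (subst openin_subopen) blast
qed

context etale_groupoid
begin

lemma open_map_src: "open_map (arrows G) (unit_space G) (src G)"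
  by (rule open_map_local_homeomorphism[OF etale])

lemma openin_src_image: "openin (arrows G) U \<Longrightarrow> openin (unit_space G) (src G ` U)"
  using open_map_src by (auto simp: open_map_def)

lemma openin_src_vimage: "openin (unit_space G) V \<Longrightarrow> openin (arrows G) {x \<in> Arr. src G x \<in> V}"
  by (rule openin_continuous_map_preimage[OF continuous_src])

lemma openin_tgt_vimage: "openin (unit_space G) V \<Longrightarrow> openin (arrows G) {x \<in> Arr. tgt G x \<in> V}"
  by (rule openin_continuous_map_preimage[OF continuous_tgt])

lemma ginv_image: "U \<subseteq> Arr \<Longrightarrow> ginv G ` U = {x \<in> Arr. ginv G x \<in> U}"
  by (force simp: image_iff)

lemma openin_ginv_image: "openin (arrows G) U \<Longrightarrow> openin (arrows G) (ginv G ` U)"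
  using openin_continuous_map_preimage[OF continuous_inv] ginv_image openin_subset by metis

lemma src_ginv_image: "U \<subseteq> Arr \<Longrightarrow> src G ` (ginv G ` U) = tgt G ` U"
  unfolding image_image by (rule image_cong) auto

lemma openin_tgt_image: "openin (arrows G) U \<Longrightarrow> openin (unit_space G) (tgt G ` U)"
  using openin_src_image[OF openin_ginv_image] src_ginv_image openin_subset by metis

lemma locally_inj_src:
  assumes "x \<in> Arr"
  obtains U where "openin (arrows G) U" "x \<in> U" "inj_on (src G) U"
proof -
  obtain U where U: "openin (arrows G) U" "x \<in> U"
      "homeomorphic_map (subtopology (arrows G) U) (subtopology (unit_space G) (src G ` U)) (src G)"
    using etale assms by (auto simp: local_homeomorphism_def)
  have "topspace (subtopology (arrows G) U) = U" using U(1) openin_subset by auto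
  then have "inj_on (src G) U" using U(3) by (metis homeomorphic_imp_injective_map)
  then show thesis using that U by blast
qed

text \<open>Near a unit choose \<open>U\<close> on which the source map is injective. If
  \<open>x\<close> and \<open>src G x\<close> both lie in \<open>U\<close>, they have the same
  source and therefore coincide.\<close>

lemma openin_units: "openin (arrows G) (units G)"
proof (subst openin_subopen, intro ballI)
  fix u assume u: "u \<in> units G"
  obtain U where U: "openin (arrows G) U" "u \<in> U" "inj_on (src G) U"
    using locally_inj_src unit_arrow[OF u] .
  define W where "W = {x \<in> Arr. src G x \<in> U}"
  have "openin (arrows G) {x \<in> Arr. src G x \<in> U \<inter> units G}"
    using U(1) by (intro openin_src_vimage) (auto simp: unit_space_def intro: openin_subtopology_Int)
  also have "{x \<in> Arr. src G x \<in> U \<inter> units G} = W" by (auto simp: W_def)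
  finally have "openin (arrows G) (U \<inter> W)" using U(1) by blast
  moreover have "u \<in> U \<inter> W" using U(2) u unit_arrow by (simp add: W_def)
  moreover have "U \<inter> W \<subseteq> units G"
  proof
    fix x assume x: "x \<in> U \<inter> W"
    then have "src G (src G x) = src G x" by (auto simp: W_def)
    then have "src G x = x" using inj_onD[OF U(3), of "src G x" x] x unfolding W_def by blast
    then show "x \<in> units G" using x src_units[of x] unfolding W_def by simp
  qed
  ultimately show "\<exists>T. openin (arrows G) T \<and> u \<in> T \<and> T \<subseteq> units G" by blast
qed

lemma openin_unit_space: "openin (unit_space G) V \<longleftrightarrow> openin (arrows G) V \<and> V \<subseteq> units G"
  unfolding unit_space_def by (rule openin_open_subtopology[OF openin_units])

lemma compactin_unit_space: "compactin (unit_space G) V \<longleftrightarrow> compactin (arrows G) V \<and> V \<subseteq> units G"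
  unfolding unit_space_def by (rule compactin_subtopology)

lemma bisectionD:
  assumes "bisection G U"
  shows "openin (arrows G) U" "U \<subseteq> Arr" "inj_on (src G) U" "inj_on (tgt G) U"
  using assms openin_subset by (auto simp: bisection_def)

lemma bisection_subset:
  assumes "bisection G U" "openin (arrows G) W" "W \<subseteq> U"
  shows "bisection G W"
  using assms inj_on_subset unfolding bisection_def by blast

lemma ginv_inj_on: "U \<subseteq> Arr \<Longrightarrow> inj_on (ginv G) U"
  by (rule inj_on_inverseI[of _ "ginv G"]) auto

lemma inj_on_ginv_image:
  assumes "U \<subseteq> Arr"
  shows "inj_on (src G) (ginv G ` U) \<longleftrightarrow> inj_on (tgt G) U"
    and "inj_on (tgt G) (ginv G ` U) \<longleftrightarrow> inj_on (src G) U"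
proof -
  have "inj_on (src G) (ginv G ` U) \<longleftrightarrow> inj_on (src G \<circ> ginv G) U"
    by (metis comp_inj_on_iff ginv_inj_on[OF assms])
  also have "\<dots> \<longleftrightarrow> inj_on (tgt G) U" using assms by (intro inj_on_cong) auto
  finally show "inj_on (src G) (ginv G ` U) \<longleftrightarrow> inj_on (tgt G) U" .
  have "inj_on (tgt G) (ginv G ` U) \<longleftrightarrow> inj_on (tgt G \<circ> ginv G) U"
    by (metis comp_inj_on_iff ginv_inj_on[OF assms])
  also have "\<dots> \<longleftrightarrow> inj_on (src G) U" using assms by (intro inj_on_cong) auto
  finally show "inj_on (tgt G) (ginv G ` U) \<longleftrightarrow> inj_on (src G) U" .
qed

lemma bisection_ginv:
  assumes "bisection G U"
  shows "bisection G (ginv G ` U)"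
proof -
  note U = bisectionD[OF assms]
  show ?thesis
    unfolding bisection_def inj_on_ginv_image[OF U(2)] using openin_ginv_image[OF U(1)] U(3,4) by blast
qed

text \<open>The section is the inverse of the source map on \<open>U\<close>; it is continuous
  because the source map is open.\<close>

lemma bisection_section:
  assumes "bisection G U"
  obtains \<sigma> where "continuous_map (subtopology (unit_space G) (src G ` U)) (arrows G) \<sigma>"
    "\<And>x. x \<in> U \<Longrightarrow> \<sigma> (src G x) = x"
proof -
  note U = bisectionD[OF assms]
  let ?\<sigma> = "inv_into U (src G)"
  have \<sigma>: "?\<sigma> (src G x) = x" if "x \<in> U" for x using U(3) that by simp
  have top: "topspace (subtopology (unit_space G) (src G ` U)) = src G ` U"
    using U(2) by (auto simp: topspace_unit_space)
  have "continuous_map (subtopology (unit_space G) (src G ` U)) (arrows G) ?\<sigma>"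
    unfolding continuous_map_def top
  proof (intro conjI allI impI)
    show "?\<sigma> \<in> src G ` U \<rightarrow> Arr" using \<sigma> U(2) by auto
    fix W assume W: "openin (arrows G) W"
    have "{v \<in> src G ` U. ?\<sigma> v \<in> W} = src G ` (U \<inter> W) \<inter> src G ` U"
    proof (intro equalityI subsetI)
      fix v assume "v \<in> {v \<in> src G ` U. ?\<sigma> v \<in> W}"
      then obtain x where x: "x \<in> U" "v = src G x" "?\<sigma> v \<in> W" by blast
      then have "x \<in> W" using \<sigma>[OF x(1)] by simp
      then show "v \<in> src G ` (U \<inter> W) \<inter> src G ` U" using x by blast
    next
      fix v assume "v \<in> src G ` (U \<inter> W) \<inter> src G ` U"
      then obtain x where x: "x \<in> U" "x \<in> W" "v = src G x" by blast
      then show "v \<in> {v \<in> src G ` U. ?\<sigma> v \<in> W}" using \<sigma>[OF x(1)] by simp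
    qed
    then show "openin (subtopology (unit_space G) (src G ` U)) {v \<in> src G ` U. ?\<sigma> v \<in> W}"
      using openin_src_image[OF openin_Int[OF U(1) W]] by (simp add: openin_subtopology_Int)
  qed
  then show thesis using \<sigma> that by blast
qed

end

section \<open>Compact open bisections and compact open sets of units\<close>

definition compact_bisection :: "'a groupoid \<Rightarrow> 'a set \<Rightarrow> bool" where
  "compact_bisection G U \<longleftrightarrow> bisection G U \<and> compact_Hausdorff_in (arrows G) U"

definition compact_open_units :: "'a groupoid \<Rightarrow> 'a set \<Rightarrow> bool" where
  "compact_open_units G V \<longleftrightarrow> openin (unit_space G) V \<and> compactin (unit_space G) V"

context ample_groupoid
begin

text \<open>A bisection injects continuously into the Hausdorff unit space.\<close>

lemma compact_bisection_iff: "compact_bisection G U \<longleftrightarrow> bisection G U \<and> compactin (arrows G) U"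
proof -
  have "Hausdorff_space (subtopology (arrows G) U)" if U: "bisection G U"
    by (rule Hausdorff_space_injective_preimage[OF Hausdorff_units, of _ "src G"])
      (use bisectionD[OF U] in \<open>auto intro: continuous_map_from_subtopology[OF continuous_src] inj_on_subset\<close>)
  then show ?thesis by (auto simp: compact_bisection_def compact_Hausdorff_in_def)
qed

lemma compact_bisectionD:
  assumes "compact_bisection G U"
  shows "bisection G U" "compactin (arrows G) U" "openin (arrows G) U" "U \<subseteq> Arr"
    "inj_on (src G) U" "inj_on (tgt G) U"
  using assms bisectionD unfolding compact_bisection_iff by blast+

lemma compact_open_unitsD:
  assumes "compact_open_units G V"
  shows "openin (unit_space G) V" "compactin (unit_space G) V" "closedin (unit_space G) V" "V \<subseteq> units G"
  using assms compactin_imp_closedin[OF Hausdorff_units] compactin_subset_topspace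
  by (fastforce simp: compact_open_units_def topspace_unit_space)+

lemma compact_open_units_bisection:
  assumes "compact_open_units G V"
  shows "compact_bisection G V"
  using compact_open_unitsD[OF assms] units_inj_on
  by (simp add: compact_bisection_iff bisection_def openin_unit_space compactin_unit_space)

lemma compact_open_units_src: "compact_bisection G U \<Longrightarrow> compact_open_units G (src G ` U)"
  using compact_bisectionD openin_src_image image_compactin[OF _ continuous_src]
  by (auto simp: compact_open_units_def)

lemma compact_open_units_tgt: "compact_bisection G U \<Longrightarrow> compact_open_units G (tgt G ` U)"
  using compact_bisectionD openin_tgt_image image_compactin[OF _ continuous_tgt]
  by (auto simp: compact_open_units_def)

lemma compact_open_units_Int:
  "\<lbrakk>compact_open_units G V; compact_open_units G W\<rbrakk> \<Longrightarrow> compact_open_units G (V \<inter> W)"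
  using compact_Int_closedin compact_open_unitsD by (metis compact_open_units_def openin_Int)

lemma compact_open_units_Diff:
  assumes "compact_open_units G V" "compact_open_units G W"
  shows "compact_open_units G (V - W)"
proof -
  note V = compact_open_unitsD[OF assms(1)] and W = compact_open_unitsD[OF assms(2)]
  have "V - W = V \<inter> (topspace (unit_space G) - W)" using V(4) topspace_unit_space by blast
  moreover have "closedin (unit_space G) (topspace (unit_space G) - W)" using W(1) by blast
  ultimately have "compactin (unit_space G) (V - W)" using compact_Int_closedin V(2) by metis
  then show ?thesis using V W by (simp add: compact_open_units_def openin_diff)
qed

lemma compact_open_units_basis:
  assumes "openin (unit_space G) W" "u \<in> W"
  obtains V where "compact_open_units G V" "u \<in> V" "V \<subseteq> W"
  using compact_open_basis[OF assms] by (auto simp: compact_open_units_def compact_Hausdorff_in_def)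

text \<open>Compact sets of arrows need not be closed, so two compact bisections may have a
  non-compact intersection. Cutting with a compact open set of units is safe: it is closed in the
  Hausdorff unit space, and so is its preimage in the arrow space.\<close>

lemma compact_bisection_src_restrict:
  assumes U: "compact_bisection G U" and V: "compact_open_units G V"
  shows "compact_bisection G {x \<in> U. src G x \<in> V}"
proof -
  note U = compact_bisectionD[OF U] and V = compact_open_unitsD[OF V]
  have eq: "{x \<in> U. src G x \<in> V} = U \<inter> {x \<in> Arr. src G x \<in> V}" using U(4) by blast
  have "openin (arrows G) {x \<in> U. src G x \<in> V}"
    unfolding eq using U(3) openin_src_vimage[OF V(1)] by blast
  moreover have "compactin (arrows G) {x \<in> U. src G x \<in> V}"
    unfolding eq using U(2) closedin_continuous_map_preimage[OF continuous_src V(3)]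
    by (rule compact_Int_closedin)
  ultimately show ?thesis using bisection_subset[OF U(1)] by (simp add: compact_bisection_iff)
qed

lemma compact_bisection_tgt_restrict:
  assumes U: "compact_bisection G U" and V: "compact_open_units G V"
  shows "compact_bisection G {x \<in> U. tgt G x \<in> V}"
proof -
  note U = compact_bisectionD[OF U] and V = compact_open_unitsD[OF V]
  have eq: "{x \<in> U. tgt G x \<in> V} = U \<inter> {x \<in> Arr. tgt G x \<in> V}" using U(4) by blast
  have "openin (arrows G) {x \<in> U. tgt G x \<in> V}"
    unfolding eq using U(3) openin_tgt_vimage[OF V(1)] by blast
  moreover have "compactin (arrows G) {x \<in> U. tgt G x \<in> V}"
    unfolding eq using U(2) closedin_continuous_map_preimage[OF continuous_tgt V(3)]
    by (rule compact_Int_closedin)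
  ultimately show ?thesis using bisection_subset[OF U(1)] by (simp add: compact_bisection_iff)
qed

lemma compact_bisection_ginv:
  assumes "compact_bisection G U"
  shows "compact_bisection G (ginv G ` U)"
  using compact_bisectionD[OF assms] bisection_ginv image_compactin[OF _ continuous_inv]
  by (simp add: compact_bisection_iff)

text \<open>Local injectivity of the source map at \<open>x\<close> and at its inverse gives an open
  bisection inside \<open>W\<close>. A compact open neighbourhood of \<open>src G x\<close> then
  lifts to a compact set through the continuous section.\<close>

lemma compact_bisection_basis:
  assumes W: "openin (arrows G) W" "x \<in> W"
  obtains U where "compact_bisection G U" "x \<in> U" "U \<subseteq> W"
proof -
  have x: "x \<in> Arr" using W openin_subset by blast
  obtain U1 where U1: "openin (arrows G) U1" "x \<in> U1" "inj_on (src G) U1" using locally_inj_src[OF x] .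
  obtain U2 where U2: "openin (arrows G) U2" "ginv G x \<in> U2" "inj_on (src G) U2"
    using locally_inj_src[of "ginv G x"] x by auto
  have A2: "U2 \<subseteq> Arr" using U2(1) openin_subset by auto
  define U where "U = W \<inter> U1 \<inter> ginv G ` U2"
  have U: "openin (arrows G) U" using W U1 openin_ginv_image[OF U2(1)] by (auto simp: U_def)
  have "x \<in> ginv G ` U2" using ginv_image[OF A2] U2(2) x by auto
  then have xU: "x \<in> U" using W U1 by (simp add: U_def)
  have "inj_on (src G) U" using U1(3) by (rule inj_on_subset) (auto simp: U_def)
  moreover have "inj_on (tgt G) (ginv G ` U2)"
    using U2(3) inj_on_ginv_image[OF A2] by blast
  then have "inj_on (tgt G) U" by (rule inj_on_subset) (auto simp: U_def)
  ultimately have bis: "bisection G U" using U by (simp add: bisection_def)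
  obtain V where V: "compact_open_units G V" "src G x \<in> V" "V \<subseteq> src G ` U"
    by (rule compact_open_units_basis[OF openin_src_image[OF U] imageI[OF xU]])
  obtain \<sigma> where \<sigma>: "continuous_map (subtopology (unit_space G) (src G ` U)) (arrows G) \<sigma>"
    "\<And>x. x \<in> U \<Longrightarrow> \<sigma> (src G x) = x" using bisection_section[OF bis] by blast
  have eq: "{x \<in> U. src G x \<in> V} = \<sigma> ` V" using \<sigma>(2) V(3) by (force simp: image_iff)
  have "compactin (subtopology (unit_space G) (src G ` U)) V"
    using compact_open_unitsD[OF V(1)] V(3) by (simp add: compactin_subtopology)
  then have "compactin (arrows G) {x \<in> U. src G x \<in> V}"
    unfolding eq by (rule image_compactin[OF _ \<sigma>(1)])
  moreover have "{x \<in> U. src G x \<in> V} = U \<inter> {x \<in> Arr. src G x \<in> V}"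
    using bisectionD[OF bis] by auto
  then have "openin (arrows G) {x \<in> U. src G x \<in> V}"
    using U openin_src_vimage[OF compact_open_unitsD(1)[OF V(1)]] by auto
  ultimately have "compact_bisection G {x \<in> U. src G x \<in> V}"
    using bisection_subset[OF bis] by (simp add: compact_bisection_iff)
  then show thesis using xU V(2) by (intro that[of "{x \<in> U. src G x \<in> V}"]) (auto simp: U_def)
qed

section \<open>Products of bisections\<close>

definition setprod :: "'a set \<Rightarrow> 'a set \<Rightarrow> 'a set" where
  "setprod U V = {gcomp G x y |x y. x \<in> U \<and> y \<in> V \<and> src G x = tgt G y}"

lemma continuous_map_gcomp:
  assumes "continuous_map X (arrows G) f" "continuous_map X (arrows G) g"
    "\<And>x. x \<in> topspace X \<Longrightarrow> src G (f x) = tgt G (g x)"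
  shows "continuous_map X (arrows G) (\<lambda>x. gcomp G (f x) (g x))"
proof -
  have "continuous_map X (subtopology (prod_topology (arrows G) (arrows G)) (composable G)) (\<lambda>x. (f x, g x))"
    using assms continuous_map_funspace[OF assms(1)] continuous_map_funspace[OF assms(2)]
    by (auto simp: continuous_map_in_subtopology composable_def intro: continuous_map_pairedI)
  from continuous_map_compose[OF this continuous_comp] show ?thesis by (simp add: o_def)
qed

text \<open>With a continuous section \<open>\<sigma>\<close> over the sources of \<open>V\<close>,
  an arrow \<open>z\<close> lies in the product exactly when its source is one of them and
  \<open>z \<sigma>(s(z))^-1\<close> is in \<open>U\<close>; this is an open condition.\<close>

lemma bisection_setprod:
  assumes U: "bisection G U" and V: "bisection G V"
  shows "bisection G (setprod U V)"
proof -
  note U = bisectionD[OF U] and V' = bisectionD[OF V]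
  have "inj_on (src G) (setprod U V)"
  proof (rule inj_onI)
    fix a b assume "a \<in> setprod U V" "b \<in> setprod U V" "src G a = src G b"
    then obtain x y x' y' where *: "a = gcomp G x y" "b = gcomp G x' y'" "x \<in> U" "y \<in> V" "x' \<in> U" "y' \<in> V"
      "src G x = tgt G y" "src G x' = tgt G y'" unfolding setprod_def by blast
    then have A: "x \<in> Arr" "y \<in> Arr" "x' \<in> Arr" "y' \<in> Arr" using U(2) V'(2) by blast+
    have "src G y = src G y'" using * A \<open>src G a = src G b\<close> by simp
    then have "y = y'" using inj_onD[OF V'(3)] * by blast
    moreover then have "x = x'" using inj_onD[OF U(3), of x x'] * by metis
    ultimately show "a = b" using * by simp
  qed
  moreover have "inj_on (tgt G) (setprod U V)"
  proof (rule inj_onI)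
    fix a b assume "a \<in> setprod U V" "b \<in> setprod U V" "tgt G a = tgt G b"
    then obtain x y x' y' where *: "a = gcomp G x y" "b = gcomp G x' y'" "x \<in> U" "y \<in> V" "x' \<in> U" "y' \<in> V"
      "src G x = tgt G y" "src G x' = tgt G y'" unfolding setprod_def by blast
    then have A: "x \<in> Arr" "y \<in> Arr" "x' \<in> Arr" "y' \<in> Arr" using U(2) V'(2) by blast+
    have "tgt G x = tgt G x'" using * A \<open>tgt G a = tgt G b\<close> by simp
    then have "x = x'" using inj_onD[OF U(4)] * by blast
    moreover then have "y = y'" using inj_onD[OF V'(4), of y y'] * by metis
    ultimately show "a = b" using * by simp
  qed
  moreover have "openin (arrows G) (setprod U V)"
  proof -
    obtain \<sigma> where \<sigma>: "continuous_map (subtopology (unit_space G) (src G ` V)) (arrows G) \<sigma>"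
      "\<And>x. x \<in> V \<Longrightarrow> \<sigma> (src G x) = x" using bisection_section[OF V] by blast
    define W where "W = {x \<in> Arr. src G x \<in> src G ` V}"
    have W: "openin (arrows G) W" unfolding W_def by (rule openin_src_vimage[OF openin_src_image[OF V'(1)]])
    have topW: "topspace (subtopology (arrows G) W) = W" by (auto simp: W_def)
    have "continuous_map (subtopology (arrows G) W) (subtopology (unit_space G) (src G ` V)) (src G)"
      using continuous_map_from_subtopology[OF continuous_src]
      by (auto simp: continuous_map_in_subtopology W_def)
    then have c: "continuous_map (subtopology (arrows G) W) (arrows G) (\<lambda>x. ginv G (\<sigma> (src G x)))"
      using continuous_map_compose[OF continuous_map_compose[OF _ \<sigma>(1)] continuous_inv] by (simp add: o_def)
    have sW: "\<exists>y\<in>V. \<sigma> (src G x) = y \<and> src G y = src G x" if "x \<in> W" for x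
      using that \<sigma>(2) by (auto simp: W_def)
    have "src G x = tgt G (ginv G (\<sigma> (src G x)))" if "x \<in> W" for x
      using sW[OF that] V'(2) by auto
    then have "continuous_map (subtopology (arrows G) W) (arrows G) (\<lambda>x. gcomp G x (ginv G (\<sigma> (src G x))))"
      by (intro continuous_map_gcomp[OF continuous_map_from_subtopology[OF continuous_map_id[unfolded id_def]] c])
        (simp only: topW)
    from openin_continuous_map_preimage[OF this U(1)]
    have "openin (arrows G) {x \<in> W. gcomp G x (ginv G (\<sigma> (src G x))) \<in> U}"
      unfolding topW using W openin_trans_full by blast
    also have "{x \<in> W. gcomp G x (ginv G (\<sigma> (src G x))) \<in> U} = setprod U V"
    proof safe
      fix x assume x: "x \<in> W" "gcomp G x (ginv G (\<sigma> (src G x))) \<in> U"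
      obtain y where y: "y \<in> V" "\<sigma> (src G x) = y" "src G y = src G x" using sW[OF x(1)] by auto
      have A: "x \<in> Arr" "y \<in> Arr" using x y V' by (auto simp: W_def)
      have "x = gcomp G (gcomp G x (ginv G y)) y" "src G (gcomp G x (ginv G y)) = tgt G y"
        using A y by simp_all
      then show "x \<in> setprod U V" using x y unfolding setprod_def by blast
    next
      fix z assume "z \<in> setprod U V"
      then obtain x y where *: "z = gcomp G x y" "x \<in> U" "y \<in> V" "src G x = tgt G y" by (auto simp: setprod_def)
      then have A: "x \<in> Arr" "y \<in> Arr" using U V' by auto
      then show "z \<in> W" using * by (simp add: W_def)
      show "gcomp G z (ginv G (\<sigma> (src G z))) \<in> U" using * A \<sigma>(2) by simp
    qed
    finally show ?thesis .
  qed
  ultimately show ?thesis by (simp add: bisection_def)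
qed

text \<open>The product is the continuous image of a compact set: of the part \<open>W\<close> of
  \<open>V\<close> whose ranges are sources of \<open>U\<close>, under
  \<open>y \<mapsto> \<sigma>(r(y)) y\<close>.\<close>

lemma compact_bisection_setprod:
  assumes U: "compact_bisection G U" and V: "compact_bisection G V"
  shows "compact_bisection G (setprod U V)"
proof -
  define W where "W = {x \<in> V. tgt G x \<in> src G ` U}"
  have W: "compact_bisection G W"
    unfolding W_def by (rule compact_bisection_tgt_restrict[OF V compact_open_units_src[OF U]])
  note U' = compact_bisectionD[OF U] and W' = compact_bisectionD[OF W]
  obtain \<sigma> where \<sigma>: "continuous_map (subtopology (unit_space G) (src G ` U)) (arrows G) \<sigma>"
    "\<And>x. x \<in> U \<Longrightarrow> \<sigma> (src G x) = x" using bisection_section[OF U'(1)] by blast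
  have "continuous_map (subtopology (arrows G) W) (subtopology (unit_space G) (src G ` U)) (tgt G)"
    using continuous_map_from_subtopology[OF continuous_tgt]
    by (auto simp: continuous_map_in_subtopology W_def)
  then have c: "continuous_map (subtopology (arrows G) W) (arrows G) (\<lambda>y. \<sigma> (tgt G y))"
    using continuous_map_compose[OF _ \<sigma>(1)] by (simp add: o_def)
  have sW: "\<sigma> (tgt G y) \<in> U \<and> src G (\<sigma> (tgt G y)) = tgt G y" if "y \<in> W" for y
    using that \<sigma>(2) by (auto simp: W_def)
  have topW: "topspace (subtopology (arrows G) W) = W" using W'(4) by auto
  have cont: "continuous_map (subtopology (arrows G) W) (arrows G) (\<lambda>y. gcomp G (\<sigma> (tgt G y)) y)"
    by (intro continuous_map_gcomp[OF c continuous_map_from_subtopology[OF continuous_map_id[unfolded id_def]]])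
      (simp only: topW sW)
  have "compactin (subtopology (arrows G) W) W" using W'(2) by (simp add: compactin_subtopology)
  from image_compactin[OF this cont]
  have "compactin (arrows G) ((\<lambda>y. gcomp G (\<sigma> (tgt G y)) y) ` W)" .
  also have "(\<lambda>y. gcomp G (\<sigma> (tgt G y)) y) ` W = setprod U V"
  proof safe
    fix y assume y: "y \<in> W"
    then show "gcomp G (\<sigma> (tgt G y)) y \<in> setprod U V"
      using sW[OF y] by (auto simp: setprod_def W_def)
  next
    fix z assume "z \<in> setprod U V"
    then obtain x y where *: "z = gcomp G x y" "x \<in> U" "y \<in> V" "src G x = tgt G y" by (auto simp: setprod_def)
    then have "y \<in> W" using image_eqI[of "tgt G y" "src G" x U] by (simp add: W_def)
    moreover have "\<sigma> (tgt G y) = x" using * \<sigma>(2) by metis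
    ultimately show "z \<in> (\<lambda>y. gcomp G (\<sigma> (tgt G y)) y) ` W" using * by auto
  qed
  finally show ?thesis
    using bisection_setprod[OF U'(1)] compact_bisectionD[OF V] by (simp add: compact_bisection_iff)
qed

end

section \<open>Orbits\<close>

lemma second_countableE:
  assumes "second_countable X"
  obtains \<B> where "countable \<B>" "\<And>V. V \<in> \<B> \<Longrightarrow> openin X V"
    "\<And>U x. \<lbrakk>openin X U; x \<in> U\<rbrakk> \<Longrightarrow> \<exists>V\<in>\<B>. x \<in> V \<and> V \<subseteq> U"
proof -
  obtain \<B> where *: "countable \<B> \<and> (\<forall>V\<in>\<B>. openin X V) \<and>
      (\<forall>U x. openin X U \<and> x \<in> U \<longrightarrow> (\<exists>V\<in>\<B>. x \<in> V \<and> V \<subseteq> U))"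
    using assms unfolding second_countable_def ..
  show thesis by (rule that[of \<B>]) (simp_all add: *)
qed

section \<open>Invariant sets, saturations and the orbit space\<close>

context etale_groupoid
begin

definition invariant :: "'a set \<Rightarrow> bool" where
  "invariant W \<longleftrightarrow> W \<subseteq> units G \<and> (\<forall>x\<in>Arr. src G x \<in> W \<longleftrightarrow> tgt G x \<in> W)"

definition saturation :: "'a set \<Rightarrow> 'a set" where
  "saturation B = tgt G ` {x \<in> Arr. src G x \<in> B}"

definition orbit :: "'a \<Rightarrow> 'a set" where
  "orbit u = tgt G ` fib u"

lemma orbit_rel_iff: "(u, v) \<in> orbit_rel G \<longleftrightarrow> v \<in> orbit u"
  by (auto simp: orbit_rel_def orbit_def fib_def)

lemma orbit_units: "orbit u \<subseteq> units G"
  by (auto simp: orbit_def fib_def)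

lemma orbit_self: "u \<in> units G \<Longrightarrow> u \<in> orbit u"
  unfolding orbit_def by (rule image_eqI[of _ _ u]) (simp_all add: fib_def unit_arrow)

lemma invariantD: "\<lbrakk>invariant W; x \<in> Arr\<rbrakk> \<Longrightarrow> src G x \<in> W \<longleftrightarrow> tgt G x \<in> W"
  by (simp add: invariant_def)

lemma invariant_orbit: "\<lbrakk>invariant W; v \<in> orbit u\<rbrakk> \<Longrightarrow> u \<in> W \<longleftrightarrow> v \<in> W"
  by (auto simp: invariant_def orbit_def fib_def)

lemma orbit_invariant: "invariant (orbit u)"
  unfolding invariant_def
proof (intro conjI orbit_units ballI iffI)
  fix x assume x: "x \<in> Arr" "src G x \<in> orbit u"
  then obtain y where y: "y \<in> Arr" "src G y = u" "src G x = tgt G y" by (auto simp: orbit_def fib_def)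
  show "tgt G x \<in> orbit u"
    unfolding orbit_def by (rule image_eqI[of _ _ "gcomp G x y"]) (use x y in \<open>auto simp: fib_def\<close>)
next
  fix x assume x: "x \<in> Arr" "tgt G x \<in> orbit u"
  then obtain y where y: "y \<in> Arr" "src G y = u" "tgt G x = tgt G y" by (auto simp: orbit_def fib_def)
  show "src G x \<in> orbit u"
    unfolding orbit_def by (rule image_eqI[of _ _ "gcomp G (ginv G x) y"]) (use x y in \<open>auto simp: fib_def\<close>)
qed

lemma openin_saturation: "openin (unit_space G) B \<Longrightarrow> openin (unit_space G) (saturation B)"
  unfolding saturation_def by (intro openin_tgt_image openin_src_vimage)

lemma mem_saturation: "v \<in> saturation B \<longleftrightarrow> (\<exists>u\<in>B. v \<in> orbit u)"
  by (auto simp: saturation_def orbit_def fib_def)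

lemma saturation_superset: "B \<subseteq> units G \<Longrightarrow> B \<subseteq> saturation B"
  using orbit_self mem_saturation by blast

lemma invariant_saturation: "invariant (saturation B)"
proof -
  have "saturation B = (\<Union>u\<in>B. orbit u)" by (auto simp: mem_saturation)
  moreover have "(src G x \<in> (\<Union>u\<in>B. orbit u)) = (tgt G x \<in> (\<Union>u\<in>B. orbit u))" if "x \<in> Arr" for x
    using invariantD[OF orbit_invariant that] by simp
  moreover have "(\<Union>u\<in>B. orbit u) \<subseteq> units G" using orbit_units by (rule UN_least)
  ultimately show ?thesis by (simp add: invariant_def)
qed

lemma saturation_least: "\<lbrakk>B \<subseteq> W; invariant W\<rbrakk> \<Longrightarrow> saturation B \<subseteq> W"
  by (auto simp: saturation_def invariant_def)

text \<open>Open sets of orbits correspond to open invariant sets of units by taking unions, so the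
  separation axiom can be tested with invariant sets and the quotient topology is not met
  again.\<close>

lemma t0_orbit_space_iff:
  "t0_space (orbit_space G) \<longleftrightarrow> (\<forall>u\<in>units G. \<forall>v\<in>units G.
     (\<forall>W. openin (unit_space G) W \<and> invariant W \<longrightarrow> (u \<in> W \<longleftrightarrow> v \<in> W)) \<longrightarrow> v \<in> orbit u)"
proof -
  have cls: "orbit_rel G `` {u} = orbit u" for u by (auto simp: orbit_rel_iff)
  have quot: "C \<in> units G // orbit_rel G \<longleftrightarrow> (\<exists>u\<in>units G. C = orbit u)" for C
    by (auto simp: quotient_def cls)
  have same: "v \<in> orbit u \<longleftrightarrow> orbit u = orbit v" if "u \<in> units G" "v \<in> units G" for u v
    using eq_equiv_class_iff[OF equiv_orbit_rel that] by (simp add: cls orbit_rel_iff)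
  have inv_Union: "invariant (\<Union>V)" if "V \<subseteq> units G // orbit_rel G" for V
  proof -
    have inv: "invariant C" if C: "C \<in> V" for C
    proof -
      have "C \<in> units G // orbit_rel G" using C \<open>V \<subseteq> _\<close> by blast
      then obtain u where "C = orbit u" using quot by blast
      then show ?thesis using orbit_invariant by simp
    qed
    have "C \<subseteq> units G" if "C \<in> V" for C using inv[OF that] by (simp add: invariant_def)
    then show ?thesis using invariantD[OF inv] unfolding invariant_def by blast
  qed
  have mem_Union: "u \<in> \<Union>V \<longleftrightarrow> orbit u \<in> V" if V: "V \<subseteq> units G // orbit_rel G" and u: "u \<in> units G" for V u
  proof
    assume "u \<in> \<Union>V"
    then obtain C where C: "C \<in> V" "u \<in> C" by blast
    then obtain w where w: "w \<in> units G" "C = orbit w" using V quot by blast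
    then have "orbit w = orbit u" using same[OF w(1) u] C by blast
    then show "orbit u \<in> V" using C w by simp
  qed (use orbit_self[OF u] in blast)
  show ?thesis
  proof (intro iffI ballI impI)
    fix u v assume t0: "t0_space (orbit_space G)" and uv: "u \<in> units G" "v \<in> units G"
      and ind: "\<forall>W. openin (unit_space G) W \<and> invariant W \<longrightarrow> (u \<in> W \<longleftrightarrow> v \<in> W)"
    show "v \<in> orbit u"
    proof (rule ccontr)
      assume "v \<notin> orbit u"
      then have ne: "orbit u \<noteq> orbit v" using same[OF uv] by simp
      have "orbit w \<in> topspace (orbit_space G)" if "w \<in> units G" for w
        unfolding topspace_orbit_space quot using that by blast
      then obtain V where V: "openin (orbit_space G) V" "orbit u \<notin> V \<longleftrightarrow> orbit v \<in> V"
        using t0[unfolded t0_space_def, rule_format, OF _ _ ne] uv by metis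
      then have Vq: "V \<subseteq> units G // orbit_rel G" and "openin (unit_space G) (\<Union>V)"
        by (simp_all add: openin_orbit_space)
      then have "u \<in> \<Union>V \<longleftrightarrow> v \<in> \<Union>V" using ind[rule_format, OF conjI[OF _ inv_Union[OF Vq]]] by simp
      then show False using V(2) unfolding mem_Union[OF Vq uv(1)] mem_Union[OF Vq uv(2)] by simp
    qed
  next
    assume *: "\<forall>u\<in>units G. \<forall>v\<in>units G.
     (\<forall>W. openin (unit_space G) W \<and> invariant W \<longrightarrow> (u \<in> W \<longleftrightarrow> v \<in> W)) \<longrightarrow> v \<in> orbit u"
    show "t0_space (orbit_space G)"
      unfolding t0_space_def topspace_orbit_space
    proof (intro ballI impI)
      fix C D assume CD: "C \<in> units G // orbit_rel G" "D \<in> units G // orbit_rel G" "C \<noteq> D"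
      obtain u v where uv: "u \<in> units G" "C = orbit u" "v \<in> units G" "D = orbit v"
        using CD(1,2) unfolding quot by auto
      then have "v \<notin> orbit u" using CD(3) same[OF uv(1,3)] by simp
      then obtain W where W: "openin (unit_space G) W" "invariant W" "\<not> (u \<in> W \<longleftrightarrow> v \<in> W)"
        using *[rule_format, OF uv(1,3)] by blast
      define V where "V = orbit ` W"
      have Wu: "W \<subseteq> units G" using W(2) by (simp add: invariant_def)
      have V: "V \<subseteq> units G // orbit_rel G" 
        using Wu unfolding V_def by (auto simp: quot intro!: bexI)
      have mem: "w \<in> W \<longleftrightarrow> orbit w \<in> V" if w: "w \<in> units G" for w
      proof
        assume "orbit w \<in> V"
        then obtain z where "z \<in> W" "orbit w = orbit z" by (auto simp: V_def)
        then show "w \<in> W" using orbit_self[OF w] invariant_orbit[OF W(2)] by metis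
      qed (simp add: V_def)
      have Vu: "\<Union>V \<subseteq> units G" using orbit_units unfolding V_def by blast
      have "\<Union>V = W"
      proof (intro equalityI subsetI)
        show "w \<in> W" if "w \<in> \<Union>V" for w using that Vu mem[of w] mem_Union[OF V, of w] by blast
        show "w \<in> \<Union>V" if "w \<in> W" for w using that Wu mem[of w] mem_Union[OF V, of w] by blast
      qed
      then have "openin (orbit_space G) V" using V W by (simp add: openin_orbit_space)
      moreover have "C \<notin> V \<longleftrightarrow> D \<in> V" using W(3) mem[OF uv(1)] mem[OF uv(3)] uv(2,4) by simp
      ultimately show "\<exists>U. openin (orbit_space G) U \<and> (C \<notin> U \<longleftrightarrow> D \<in> U)" by blast
    qed
  qed
qed

text \<open>Source fibres are discrete: every arrow has a basic neighbourhood that meets its fibre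
  in no other arrow. A countable base therefore enumerates the fibre.\<close>

lemma countable_orbit:
  assumes "second_countable (arrows G)"
  shows "countable (orbit u)"
proof -
  obtain \<B> where B: "countable \<B>" "\<And>U x. openin (arrows G) U \<Longrightarrow> x \<in> U \<Longrightarrow> \<exists>V\<in>\<B>. x \<in> V \<and> V \<subseteq> U"
    using second_countableE[OF assms] by metis
  have "fib u \<subseteq> (\<lambda>b. the_elem (b \<inter> fib u)) ` \<B>"
  proof
    fix x assume x: "x \<in> fib u"
    then have "x \<in> Arr" by (simp add: fib_def)
    then obtain U where U: "openin (arrows G) U" "x \<in> U" "inj_on (src G) U" by (rule locally_inj_src)
    obtain b where b: "b \<in> \<B>" "x \<in> b" "b \<subseteq> U" using B(2)[OF U(1,2)] by blast
    have "y = x" if "y \<in> b" "y \<in> fib u" for y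
      using inj_onD[OF U(3), of y x] that b U x by (auto simp: fib_def)
    then have "b \<inter> fib u = {x}" using b x by blast
    then show "x \<in> (\<lambda>b. the_elem (b \<inter> fib u)) ` \<B>" using b(1) by (intro image_eqI[of _ _ b]) simp_all
  qed
  then have "countable (fib u)" using B(1) countable_image countable_subset by blast
  then show ?thesis by (simp add: orbit_def)
qed

end

section \<open>Baire category on closed invariant sets\<close>

context ample_groupoid
begin

lemma locally_compact_units: "locally_compact_space (unit_space G)"
  unfolding locally_compact_space_def
proof
  fix u assume "u \<in> topspace (unit_space G)"
  then obtain V where "compact_open_units G V" "u \<in> V" by (rule compact_open_units_basis[OF openin_topspace])
  then show "\<exists>U K. openin (unit_space G) U \<and> compactin (unit_space G) K \<and> u \<in> U \<and> U \<subseteq> K"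
    by (auto simp: compact_open_units_def)
qed

text \<open>Both points produced by the Baire category theorem have a dense orbit in \<open>X\<close>.  The second one
  avoids the orbit of the first, which is countable, unless that orbit has an isolated point.\<close>

lemma isolated_point_of_irreducible:
  assumes sc: "second_countable (arrows G)" and t0: "t0_space (orbit_space G)"
    and X: "closedin (unit_space G) X" "invariant X" "X \<noteq> {}"
    and irr: "\<And>U V. \<lbrakk>openin (unit_space G) U; openin (unit_space G) V; invariant U; invariant V;
        U \<inter> X \<noteq> {}; V \<inter> X \<noteq> {}\<rbrakk> \<Longrightarrow> U \<inter> V \<inter> X \<noteq> {}"
  shows "\<exists>u\<in>X. \<exists>V. openin (unit_space G) V \<and> V \<inter> X = {u}"
proof (rule ccontr)
  assume no: "\<not> ?thesis"
  define Y where "Y = subtopology (unit_space G) X"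
  have Xu: "X \<subseteq> units G" using X(2) by (simp add: invariant_def)
  have top: "topspace Y = X" using Xu by (auto simp: Y_def topspace_unit_space)
  have openY: "openin Y T \<longleftrightarrow> (\<exists>V. openin (unit_space G) V \<and> T = V \<inter> X)" for T
    by (auto simp: Y_def openin_subtopology)
  have Haus: "Hausdorff_space Y" unfolding Y_def by (rule Hausdorff_space_subtopology[OF Hausdorff_units])
  have lc: "locally_compact_space Y"
    unfolding Y_def by (rule locally_compact_space_closed_subset[OF locally_compact_units X(1)])
  have reg: "regular_space Y" by (rule locally_compact_Hausdorff_imp_regular_space[OF lc Haus])
  have "second_countable (unit_space G)"
    unfolding unit_space_def by (rule second_countable_subtopology[OF sc])
  then obtain \<B> where B: "countable \<B>" "\<And>V. V \<in> \<B> \<Longrightarrow> openin (unit_space G) V"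
      "\<And>U x. openin (unit_space G) U \<Longrightarrow> x \<in> U \<Longrightarrow> \<exists>V\<in>\<B>. x \<in> V \<and> V \<subseteq> U"
    using second_countableE by metis
  \<comment> \<open>Adjoining \<open>X\<close> forces the intersection into \<open>X\<close>. The
    other members are dense by irreducibility: the saturations of \<open>b\<close> and of an open
    set that meets \<open>X\<close> have a common point in \<open>X\<close>, which some arrow leads
    back into that open set.\<close>
  define \<D> where "\<D> = insert X ((\<lambda>b. saturation b \<inter> X) ` {b \<in> \<B>. b \<inter> X \<noteq> {}})"
  have Dc: "countable \<D>" using B(1) by (simp add: \<D>_def)
  have D: "openin Y T \<and> Y closure_of T = topspace Y" if "T \<in> \<D>" for T
  proof -
    consider "T = X" | b where "b \<in> \<B>" "b \<inter> X \<noteq> {}" "T = saturation b \<inter> X"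
      using \<open>T \<in> \<D>\<close> unfolding \<D>_def by blast
    then show ?thesis
    proof cases
      case 1
      then show ?thesis using top openin_topspace[of Y] closure_of_topspace[of Y] by simp
    next
      case (2 b)
      have bo: "openin (unit_space G) b" using B(2) 2(1) by blast
      have so: "openin (unit_space G) (saturation b)" by (rule openin_saturation[OF bo])
      have bu: "b \<subseteq> units G" using openin_subset[OF bo] by (simp add: topspace_unit_space)
      have "T \<inter> S \<noteq> {}" if S: "openin Y S" "S \<noteq> {}" for S
      proof -
        obtain V where V: "openin (unit_space G) V" "S = V \<inter> X" using S openY by blast
        have Vu: "V \<subseteq> units G" using openin_subset[OF V(1)] by (simp add: topspace_unit_space)
        have "saturation V \<inter> saturation b \<inter> X \<noteq> {}"
          by (rule irr[OF openin_saturation[OF V(1)] so invariant_saturation invariant_saturation])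
            (use saturation_superset[OF Vu] saturation_superset[OF bu] S V(2) 2(2) in \<open>blast+\<close>)
        then obtain w where w: "w \<in> saturation V" "w \<in> saturation b" "w \<in> X" by blast
        then obtain x where x: "x \<in> Arr" "src G x \<in> V" "w = tgt G x" by (auto simp: saturation_def)
        have "src G x \<in> saturation b" "src G x \<in> X"
          using invariantD[OF invariant_saturation x(1)] invariantD[OF X(2) x(1)] w x by simp_all
        then show ?thesis using V 2 x by blast
      qed
      moreover have "openin Y T" using 2(3) so openY by blast
      ultimately show ?thesis using dense_intersects_open[of Y T] by simp
    qed
  qed
  have ne: "S \<noteq> {}" if "Y closure_of S = topspace Y" for S
    using that top X(3) by auto
  have "Y closure_of \<Inter>\<D> = topspace Y"
    using lc reg by (intro Baire_category Dc D) simp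
  then obtain u where u: "u \<in> \<Inter>\<D>" using ne by blast
  then have uX: "u \<in> X" by (simp add: \<D>_def)
  then have uu: "u \<in> units G" using Xu by blast
  have orb: "orbit u \<subseteq> X" using invariant_orbit[OF X(2)] uX by blast
  \<comment> \<open>In the absence of isolated points, deleting a single point leaves a dense open
    set, and only countably many points are deleted.\<close>
  define \<E> where "\<E> = \<D> \<union> (\<lambda>w. X - {w}) ` orbit u"
  have "countable \<E>" using Dc countable_orbit[OF sc] by (simp add: \<E>_def)
  moreover have "openin Y T \<and> Y closure_of T = topspace Y" if T: "T \<in> \<E>" for T
  proof (cases "T \<in> \<D>")
    case False
    then obtain w where w: "w \<in> orbit u" "T = X - {w}" using T by (auto simp: \<E>_def)
    have "closedin Y {w}" using Haus w orb top by (auto intro: closedin_Hausdorff_singleton)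
    then have "openin Y (topspace Y - {w})" by (intro openin_diff openin_topspace)
    then have "openin Y T" using w top by simp
    moreover have "T \<inter> S \<noteq> {}" if S: "openin Y S" "S \<noteq> {}" for S
    proof
      assume "T \<inter> S = {}"
      moreover obtain V where V: "openin (unit_space G) V" "S = V \<inter> X" using S openY by blast
      ultimately have "V \<inter> X = {w}" using S w by blast
      then show False using no V w orb by blast
    qed
    ultimately show ?thesis using dense_intersects_open[of Y T] by simp
  qed (rule D)
  ultimately have "Y closure_of \<Inter>\<E> = topspace Y"
    using lc reg by (intro Baire_category) auto
  then obtain v where v: "v \<in> \<Inter>\<E>" using ne by blast
  have vD: "v \<in> \<Inter>\<D>" using v by (auto simp: \<E>_def)
  then have vX: "v \<in> X" by (simp add: \<D>_def)
  have vu: "v \<notin> orbit u" using v by (auto simp: \<E>_def)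
  \<comment> \<open>A point common to all members of \<open>\<D>\<close> lies in every open
    invariant set that meets \<open>X\<close>. Applied to \<open>u\<close> and \<open>v\<close> in
    turn, this leaves no open invariant set to separate them.\<close>
  have dense: "q \<in> W" if W: "openin (unit_space G) W" "invariant W" "p \<in> W" "p \<in> X" "q \<in> \<Inter>\<D>" for W p q
  proof -
    obtain b where b: "b \<in> \<B>" "p \<in> b" "b \<subseteq> W" using B(3)[OF W(1,3)] by blast
    then have "saturation b \<inter> X \<in> \<D>" using W(4) by (auto simp: \<D>_def)
    then have "q \<in> saturation b" using W(5) by blast
    then show ?thesis using saturation_least[OF b(3) W(2)] by blast
  qed
  have "v \<in> orbit u"
    using t0 uu vX Xu dense[OF _ _ _ uX vD] dense[OF _ _ _ vX u]
    unfolding t0_orbit_space_iff by blast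
  then show False using vu by contradiction
qed

text \<open>Under the \<open>T\<^sub>0\<close> hypothesis orbits are locally closed.\<close>

lemma isolated_in_orbit:
  assumes sc: "second_countable (arrows G)" and t0: "t0_space (orbit_space G)" and u: "u \<in> units G"
  obtains V where "compact_open_units G V" "V \<inter> orbit u = {u}"
proof -
  define X where "X = unit_space G closure_of (orbit u)"
  have meets: "W \<inter> orbit u \<noteq> {}" if W: "openin (unit_space G) W" "p \<in> W" "p \<in> X" for W p
    using W unfolding X_def in_closure_of by blast
  have orbX: "orbit u \<subseteq> X"
    unfolding X_def by (rule closure_of_subset) (simp add: topspace_unit_space orbit_units)
  \<comment> \<open>The closure of an orbit is invariant: a neighbourhood of the range of
    \<open>x\<close> pulls back along arrows to a neighbourhood of the source of \<open>x\<close>,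
    which meets the orbit.\<close>
  have push: "tgt G x \<in> X" if x: "x \<in> Arr" "src G x \<in> X" for x
    unfolding X_def in_closure_of
  proof (intro conjI allI impI)
    show "tgt G x \<in> topspace (unit_space G)" using x by (simp add: topspace_unit_space)
    fix W assume W: "tgt G x \<in> W \<and> openin (unit_space G) W"
    have "openin (unit_space G) (src G ` {y \<in> Arr. tgt G y \<in> W})"
      using W by (intro openin_src_image openin_tgt_vimage) simp
    moreover have "src G x \<in> src G ` {y \<in> Arr. tgt G y \<in> W}" using W x by blast
    ultimately obtain y where "y \<in> Arr" "tgt G y \<in> W" "src G y \<in> orbit u"
      using meets x(2) by blast
    then show "\<exists>z. z \<in> orbit u \<and> z \<in> W" using invariantD[OF orbit_invariant] by blast
  qed
  have "tgt G x \<in> X \<Longrightarrow> src G x \<in> X" if "x \<in> Arr" for x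
    using push[of "ginv G x"] that by simp
  then have inv: "invariant X"
    unfolding invariant_def using push closure_of_subset_topspace[of "unit_space G" "orbit u"]
    by (auto simp: X_def topspace_unit_space)
  \<comment> \<open>Every open invariant set that meets the closure contains \<open>u\<close>, so
    the irreducibility hypothesis is witnessed by \<open>u\<close> itself.\<close>
  have uW: "u \<in> W" if W: "openin (unit_space G) W" "invariant W" "W \<inter> X \<noteq> {}" for W
    using meets[OF W(1)] W(3) invariant_orbit[OF W(2)] by blast
  have uX: "u \<in> X" using orbX orbit_self[OF u] by blast
  have "\<exists>w\<in>X. \<exists>V. openin (unit_space G) V \<and> V \<inter> X = {w}"
  proof (rule isolated_point_of_irreducible[OF sc t0 _ inv])
    show "closedin (unit_space G) X" by (simp add: X_def)
    show "X \<noteq> {}" using uX by blast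
  qed (use uW uX in blast)
  then obtain w V where w: "w \<in> X" "openin (unit_space G) V" "V \<inter> X = {w}" by blast
  have "w \<in> V" using w(3) by auto
  then obtain z where "z \<in> V" "z \<in> orbit u" using meets[OF w(2) _ w(1)] by auto
  then have "w \<in> orbit u" using w(3) orbX by auto
  then obtain g where g: "g \<in> Arr" "src G g = u" "tgt G g = w" by (auto simp: orbit_def fib_def)
  obtain B where B: "compact_bisection G B" "g \<in> B"
    by (rule compact_bisection_basis[OF openin_topspace g(1)])
  note B' = compact_bisectionD[OF B(1)]
  \<comment> \<open>The isolated point found is \<open>w\<close>, in the orbit of \<open>u\<close>
    but possibly different from it. A bisection through an arrow \<open>g\<close> from
    \<open>u\<close> to \<open>w\<close>, with ranges cut down to \<open>V\<close>, transports
    isolation: orbit points among its sources have range \<open>w\<close>, so the arrow above them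
    is \<open>g\<close>.\<close>
  define S where "S = B \<inter> {y \<in> Arr. tgt G y \<in> V}"
  have S: "openin (arrows G) S" using B'(3) openin_tgt_vimage[OF w(2)] by (auto simp: S_def)
  have "u \<in> src G ` S" using g B(2) w by (auto simp: S_def image_iff intro!: bexI[of _ g])
  then obtain V' where V': "compact_open_units G V'" "u \<in> V'" "V' \<subseteq> src G ` S"
    by (rule compact_open_units_basis[OF openin_src_image[OF S]])
  have "p = u" if p: "p \<in> V'" "p \<in> orbit u" for p
  proof -
    obtain y where y: "y \<in> S" "p = src G y" using p V' by blast
    then have yA: "y \<in> Arr" by (simp add: S_def)
    have "src G y \<in> X" using y p orbX by blast
    then have "tgt G y \<in> X" by (rule push[OF yA])
    moreover have "tgt G y \<in> V" "y \<in> B" using y(1) by (simp_all add: S_def)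
    ultimately have "tgt G y = tgt G g" using w(3) g(3) by blast
    then have "y = g" by (rule inj_onD[OF B'(6) _ \<open>y \<in> B\<close> B(2)])
    then show ?thesis using y g by simp
  qed
  then have "V' \<inter> orbit u = {u}" using V' orbit_self[OF u] by blast
  then show thesis using V' that by blast
qed

end

section \<open>The Steinberg algebra\<close>

context topological_groupoid
begin

lemma conv_scale_left: "conv (\<lambda>x. c * f x) g = (\<lambda>x. c * conv f g x)"
  by (auto simp: conv_def sum_distrib_left mult.assoc)

lemma conv_scale_right: "conv f (\<lambda>x. c * g x) = (\<lambda>x. c * conv f g x)"
proof (cases "c = 0")
  case True
  then show ?thesis by (auto simp: conv_def)
next
  case False
  then have "{y \<in> fib u. c * g y \<noteq> 0} = {y \<in> fib u. g y \<noteq> 0}" for u by auto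
  then show ?thesis by (simp add: conv_def sum_distrib_left mult.left_commute fun_eq_iff)
qed

lemma conv_zero_right: "conv f (\<lambda>x. 0) = (\<lambda>x. 0)"
  by (auto simp: conv_def)

lemma conv_zero_left: "conv (\<lambda>x. 0) f = (\<lambda>x. 0)"
  by (auto simp: conv_def)

end

context ample_groupoid
begin

definition St :: "('a \<Rightarrow> 'k::field) set" where
  "St = carrier (steinberg_algebra G)"

lemma St_iff: "f \<in> St \<longleftrightarrow> (\<exists>F c. finite F \<and> (\<forall>U\<in>F. compact_bisection G U)
    \<and> f = (\<lambda>x. \<Sum>U\<in>F. c U * indicator U x))"
  by (simp add: St_def steinberg_algebra_def compact_bisection_def)

lemma St_simps:
  "carrier (steinberg_algebra G) = St" "mult (steinberg_algebra G) = conv"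
  "zero (steinberg_algebra G) = (\<lambda>x. 0)" "add (steinberg_algebra G) = (\<lambda>f g x. f x + g x)"
  by (simp_all add: St_def mult_steinberg) (simp_all add: steinberg_algebra_def)

lemma St_indicator:
  assumes "compact_bisection G U"
  shows "(\<lambda>x. c * indicator U x) \<in> St"
  unfolding St_iff using assms by (intro exI[of _ "{U}"] exI[of _ "\<lambda>_. c"]) (simp del: sum_mult_indicator)

lemma St_indicator1: "compact_bisection G U \<Longrightarrow> indicator U \<in> St"
  using St_indicator[of U 1] by simp

lemma St_zero: "(\<lambda>x. 0) \<in> St"
  unfolding St_iff by (intro exI[of _ "{}"]) simp

lemma St_add:
  assumes "f \<in> St" "g \<in> St"
  shows "(\<lambda>x. f x + g x) \<in> St"
proof -
  obtain F c where F: "finite F" "\<forall>U\<in>F. compact_bisection G U" "f = (\<lambda>x. \<Sum>U\<in>F. c U * indicator U x)"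
    using assms(1) unfolding St_iff by blast
  obtain H d where H: "finite H" "\<forall>U\<in>H. compact_bisection G U" "g = (\<lambda>x. \<Sum>U\<in>H. d U * indicator U x)"
    using assms(2) unfolding St_iff by blast
  define b where "b U = (if U \<in> F then c U else 0) + (if U \<in> H then d U else 0)" for U
  have "f x + g x = (\<Sum>U\<in>F \<union> H. b U * indicator U x)" for x
  proof -
    have "f x = (\<Sum>U\<in>F \<union> H. (if U \<in> F then c U else 0) * indicator U x)"
      unfolding F(3) using F(1) H(1) by (intro sum.mono_neutral_cong_left) auto
    moreover have "g x = (\<Sum>U\<in>F \<union> H. (if U \<in> H then d U else 0) * indicator U x)"
      unfolding H(3) using F(1) H(1) by (intro sum.mono_neutral_cong_left) auto
    ultimately show ?thesis by (simp only: b_def distrib_right sum.distrib)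
  qed
  then show ?thesis unfolding St_iff using F H by (intro exI[of _ "F \<union> H"] exI[of _ b]) auto
qed

lemma St_scale:
  assumes "f \<in> St"
  shows "(\<lambda>x. k * f x) \<in> St"
proof -
  obtain F c where F: "finite F" "\<forall>U\<in>F. compact_bisection G U" "f = (\<lambda>x. \<Sum>U\<in>F. c U * indicator U x)"
    using assms(1) unfolding St_iff by blast
  show ?thesis unfolding St_iff
    by (intro exI[of _ F] exI[of _ "\<lambda>U. k * c U"]) (simp add: F sum_distrib_left mult.assoc del: sum_mult_indicator)
qed

lemma St_induct [consumes 1, case_names zero add]:
  assumes f: "f \<in> St" and zero: "P (\<lambda>x. 0)"
    and add: "\<And>U c g. \<lbrakk>compact_bisection G U; g \<in> St; P g\<rbrakk> \<Longrightarrow> P (\<lambda>x. c * indicator U x + g x)"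
  shows "P f"
proof -
  obtain F c where F: "finite F" "\<forall>U\<in>F. compact_bisection G U" "f = (\<lambda>x. \<Sum>U\<in>F. c U * indicator U x)"
    using f unfolding St_iff by blast
  from F(1,2) have "P (\<lambda>x. \<Sum>U\<in>F. c U * indicator U x) \<and> (\<lambda>x. \<Sum>U\<in>F. c U * indicator U x) \<in> St"
  proof (induction F rule: finite_induct)
    case empty
    then show ?case using zero St_zero by simp
  next
    case (insert U F)
    then have "P (\<lambda>x. c U * indicator U x + (\<Sum>U\<in>F. c U * indicator U x))"
      by (intro add) (simp_all del: sum_mult_indicator)
    moreover have "(\<lambda>x. c U * indicator U x + (\<Sum>U\<in>F. c U * indicator U x)) \<in> St"
      using insert by (intro St_add St_indicator) (simp_all del: sum_mult_indicator)
    ultimately show ?case using insert by (simp del: sum_mult_indicator)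
  qed
  then show ?thesis by (simp add: F(3))
qed

lemma St_source_finite: "f \<in> St \<Longrightarrow> source_finite f"
proof (induction rule: St_induct)
  case zero
  then show ?case by (simp add: source_finite_def)
next
  case (add U c g)
  then show ?case
    using compact_bisectionD[OF add(1)] by (intro source_finite_add source_finite_indicator)
qed

text \<open>At most one arrow \<open>b\<close> of \<open>V\<close> has the source of
  \<open>x\<close>, so \<open>x\<close> can factor through \<open>U\<close> and \<open>V\<close>
  only as \<open>(x b^-1) b\<close>. Hence products of generators are again generators.\<close>

lemma conv_indicators:
  assumes "compact_bisection G U" "compact_bisection G V"
  shows "conv (indicator U) (indicator V) = (indicator (setprod U V) :: 'a \<Rightarrow> 'k::field)"
proof
  fix x
  note U = compact_bisectionD[OF assms(1)] and V = compact_bisectionD[OF assms(2)]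
  have UV: "setprod U V \<subseteq> Arr"
    using compact_bisectionD(4)[OF compact_bisection_setprod[OF assms]] .
  show "conv (indicator U) (indicator V) x = (indicator (setprod U V) x :: 'k)"
  proof (cases "x \<in> Arr")
    case False
    then have "x \<notin> setprod U V" using UV by blast
    then show ?thesis using False by (simp add: conv_outside)
  next
    case x: True
    show ?thesis
    proof (cases "src G x \<in> src G ` V")
      case True
      then obtain b where b: "b \<in> V" "src G b = src G x" by force
      have bA: "b \<in> Arr" using b V(4) by blast
      have "gcomp G x (ginv G b) \<in> U \<longleftrightarrow> x \<in> setprod U V"
      proof
        assume *: "gcomp G x (ginv G b) \<in> U"
        have "x = gcomp G (gcomp G x (ginv G b)) b" "src G (gcomp G x (ginv G b)) = tgt G b"
          using x b bA by simp_all
        then show "x \<in> setprod U V" unfolding setprod_def using * b(1) by blast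
      next
        assume "x \<in> setprod U V"
        then obtain a c where ac: "x = gcomp G a c" "a \<in> U" "c \<in> V" "src G a = tgt G c"
          unfolding setprod_def by blast
        have A: "a \<in> Arr" "c \<in> Arr" using ac U(4) V(4) by blast+
        have "c = b" using inj_onD[OF V(5) _ ac(3) b(1)] ac A b by simp
        then show "gcomp G x (ginv G b) \<in> U" using ac A by simp
      qed
      then show ?thesis using conv_indicator_right(1)[OF V(4,5) x b, of "indicator U :: 'a \<Rightarrow> 'k"]
        by (simp add: indicator_def)
    next
      case False
      have "x \<notin> setprod U V"
      proof
        assume "x \<in> setprod U V"
        then obtain a c where ac: "x = gcomp G a c" "a \<in> U" "c \<in> V" "src G a = tgt G c"
          unfolding setprod_def by blast
        have "a \<in> Arr" "c \<in> Arr" using ac U(4) V(4) by blast+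
        then have "src G x = src G c" using ac by simp
        then show False using False ac(3) by simp
      qed
      then show ?thesis using conv_indicator_right(2)[OF V(4,5) x False] by simp
    qed
  qed
qed

lemma St_conv:
  assumes "f \<in> St" "g \<in> St"
  shows "conv f g \<in> St"
  using assms(1)
proof (induction rule: St_induct)
  case zero
  then show ?case by (simp add: conv_zero_left St_zero)
next
  case (add U c f)
  have "conv (indicator U) g \<in> St"
    using assms(2)
  proof (induction rule: St_induct)
    case zero
    then show ?case by (simp add: conv_zero_right St_zero)
  next
    case (add V d h)
    have V: "source_finite (\<lambda>x. d * indicator V x)" "source_finite h"
      using St_source_finite St_indicator add by blast+
    show ?case
      unfolding conv_add_right[OF V] conv_scale_right conv_indicators[OF \<open>compact_bisection G U\<close> add(1)]
      by (intro St_add St_indicator compact_bisection_setprod add \<open>compact_bisection G U\<close>)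
  qed
  then show ?case
    unfolding conv_add_left conv_scale_left by (intro St_add St_scale add)
qed

lemma St_diff: "\<lbrakk>f \<in> St; g \<in> St\<rbrakk> \<Longrightarrow> (\<lambda>x. f x - g x) \<in> St"
  using St_add[OF _ St_scale[of g "-1"], of f] by simp

theorem nonunital_ring_steinberg: "nonunital_ring (steinberg_algebra G :: ('a \<Rightarrow> 'k::field) ring)"
proof -
  have "abelian_group (steinberg_algebra G :: ('a \<Rightarrow> 'k::field) ring)"
  proof (rule abelian_groupI, unfold St_simps)
    fix f :: "'a \<Rightarrow> 'k" assume "f \<in> St"
    then show "\<exists>g\<in>St. (\<lambda>x. g x + f x) = (\<lambda>x. 0)"
      using St_scale[of f "-1"] by (intro bexI[of _ "\<lambda>x. -1 * f x"]) simp_all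
  qed (auto simp: St_add St_zero add.assoc add.commute)
  then show ?thesis
    by (intro nonunital_ring.intro nonunital_ring_axioms.intro, unfold St_simps)
      (simp_all add: St_conv conv_assoc St_source_finite conv_add_left conv_add_right)
qed

lemma St_minus:
  assumes "f \<in> St" "g \<in> St"
  shows "f \<ominus>\<^bsub>steinberg_algebra G\<^esub> g = (\<lambda>x. f x - g x)"
proof -
  have "\<ominus>\<^bsub>steinberg_algebra G\<^esub> g = (\<lambda>x. - g x)"
    using assms(2) St_scale[of g "-1"]
    by (intro abelian_group.minus_equality[OF nonunital_ring.axioms(1)[OF nonunital_ring_steinberg]])
      (simp_all add: St_simps)
  then show ?thesis by (simp add: a_minus_def St_simps)
qed

lemma idempotent_unit:
  assumes "compact_open_units G V"
  shows "idempotent (steinberg_algebra G :: ('a \<Rightarrow> 'k::field) ring) (indicator V)"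
proof (intro idempotent.intro idempotent_axioms.intro nonunital_ring_steinberg, unfold St_simps)
  have V: "V \<subseteq> units G" using compact_open_unitsD(4)[OF assms] .
  show "(indicator V :: 'a \<Rightarrow> 'k) \<in> St" by (rule St_indicator1[OF compact_open_units_bisection[OF assms]])
  show "conv (indicator V) (indicator V) = (indicator V :: 'a \<Rightarrow> 'k)"
    unfolding conv_unit_right[OF V] using units_inj_on(1)[OF V] V
    by (auto simp: indicator_def fun_eq_iff subset_iff)
qed

lemma corner_St_iff:
  assumes V: "compact_open_units G V"
  shows "f \<in> carrier (corner (steinberg_algebra G) (indicator V)) \<longleftrightarrow>
     f \<in> St \<and> (\<forall>x. f x \<noteq> 0 \<longrightarrow> x \<in> Arr \<and> src G x \<in> V \<and> tgt G x \<in> V)"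
proof -
  have Vu: "V \<subseteq> units G" using compact_open_unitsD(4)[OF V] .
  have "conv (indicator V) f = f \<and> conv f (indicator V) = f \<longleftrightarrow>
      (\<forall>x. f x \<noteq> 0 \<longrightarrow> x \<in> Arr \<and> src G x \<in> V \<and> tgt G x \<in> V)" if "f \<in> St"
    unfolding conv_unit_left[OF Vu St_source_finite[OF that]] conv_unit_right[OF Vu] fun_eq_iff
    by (auto split: if_splits; metis)
  then show ?thesis by (auto simp: St_simps)
qed

text \<open>Two bisections may have inseparable arrows over \<open>u\<close>; but two of them that share an arrow over
  \<open>u\<close> agree over a neighbourhood of \<open>u\<close>, and this suffices.\<close>

lemma St_vanish_nbhd:
  fixes f :: "'a \<Rightarrow> 'k::field"
  assumes f: "f \<in> St" and u: "u \<in> units G" and vanish: "\<And>x. x \<in> fib u \<Longrightarrow> f x = 0"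
  obtains W where "openin (unit_space G) W" "u \<in> W" "\<And>x. \<lbrakk>x \<in> Arr; src G x \<in> W\<rbrakk> \<Longrightarrow> f x = 0"
proof -
  obtain F c where F: "finite F" "\<forall>U\<in>F. compact_bisection G U" "f = (\<lambda>x. \<Sum>U\<in>F. c U * indicator U x)"
    using f unfolding St_iff by blast
  \<comment> \<open>Three cases: if \<open>U\<close> has no arrow over \<open>u\<close>, its closed
    set of sources is removed; if \<open>U\<close> and \<open>U'\<close> share an arrow over
    \<open>u\<close>, only sources of common arrows are kept; otherwise nothing is imposed.\<close>
  define N where "N U U' = (if u \<in> src G ` U then if u \<in> src G ` (U \<inter> U') then src G ` (U \<inter> U') else units G
     else units G - src G ` U)" for U U'
  have N: "openin (unit_space G) (N U U') \<and> u \<in> N U U'" if "U \<in> F" "U' \<in> F" for U U'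
  proof -
    have U: "compact_bisection G U" "compact_bisection G U'" using F that by blast+
    have "openin (unit_space G) (src G ` (U \<inter> U'))"
      using compact_bisectionD(3)[OF U(1)] compact_bisectionD(3)[OF U(2)] by (intro openin_src_image openin_Int)
    moreover have "closedin (unit_space G) (src G ` U)"
      using compact_open_unitsD(3)[OF compact_open_units_src[OF U(1)]] .
    moreover have "openin (unit_space G) (units G)" using openin_topspace[of "unit_space G"] topspace_unit_space by simp
    ultimately show ?thesis using u by (auto simp: N_def)
  qed
  define W where "W = units G \<inter> (\<Inter>U\<in>F. \<Inter>U'\<in>F. N U U')"
  have W: "openin (unit_space G) W"
  proof -
    have "W = \<Inter> (insert (units G) ((\<lambda>p. N (fst p) (snd p)) ` (F \<times> F)))" by (auto simp: W_def)
    moreover have "openin (unit_space G) \<dots>"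
      using N F(1) openin_topspace[of "unit_space G"] topspace_unit_space by (intro openin_Inter) auto
    ultimately show ?thesis by simp
  qed
  have "u \<in> W" using N u by (auto simp: W_def)
  moreover have "f x = 0" if x: "x \<in> Arr" "src G x \<in> W" for x
  proof -
    define S where "S = {U \<in> F. x \<in> U}"
    define a where "a U = inv_into U (src G) u" for U
    have SF: "S \<subseteq> F" "finite S" using F(1) by (auto simp: S_def)
    have a: "a U \<in> U \<and> src G (a U) = u" if "U \<in> S" for U
    proof -
      have "src G x \<in> N U U" using x that SF unfolding W_def by blast
      then have "u \<in> src G ` U" using that by (auto simp: N_def S_def split: if_splits)
      then show ?thesis unfolding a_def by (simp add: inv_into_into f_inv_into_f)
    qed
    \<comment> \<open>Group the bisections through \<open>x\<close> by their arrow over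
      \<open>u\<close>. Within \<open>W\<close>, each group consists of all members of
      \<open>F\<close> that contain that arrow, so its coefficients add up to the value of
      \<open>f\<close> there, which is zero.\<close>
    have same: "{U' \<in> S. a U' = a U} = {U' \<in> F. a U \<in> U'}" if U: "U \<in> S" for U
    proof safe
      fix U' assume "U' \<in> S" "a U' = a U"
      then show "U' \<in> F" "a U \<in> U'" using a[of U'] SF by auto
    next
      fix U' assume U': "U' \<in> F" "a U \<in> U'"
      have B: "compact_bisection G U" "compact_bisection G U'" using U U' SF F(2) by blast+
      have "u \<in> src G ` (U \<inter> U')" "u \<in> src G ` U" using a[OF U] U' by force+
      then have "N U U' = src G ` (U \<inter> U')" by (simp add: N_def)
      moreover have "src G x \<in> N U U'" using x U U' SF unfolding W_def by blast
      ultimately obtain y where y: "y \<in> U" "y \<in> U'" "src G y = src G x" by force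
      have "y = x" using inj_onD[OF compact_bisectionD(5)[OF B(1)] y(3) y(1)] U by (simp add: S_def)
      then show "U' \<in> S" using y U' by (simp add: S_def)
      then show "a U' = a U" using inj_onD[OF compact_bisectionD(5)[OF B(2)], of "a U'" "a U"] a[OF U] a[of U'] U'(2) by simp
    qed
    have "f x = (\<Sum>U\<in>S. c U)"
      unfolding F(3) S_def using F(1) by simp
    also have "\<dots> = (\<Sum>g\<in>a ` S. \<Sum>U\<in>{U \<in> S. a U = g}. c U)"
      using SF(2) by (rule sum.image_gen)
    also have "\<dots> = 0"
    proof (rule sum.neutral, safe)
      fix U assume U: "U \<in> S"
      have "(\<Sum>U'\<in>{U' \<in> S. a U' = a U}. c U') = f (a U)"
        unfolding same[OF U] F(3) using F(1) by simp
      also have "U \<in> F" using U SF by blast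
      then have "U \<subseteq> Arr" using F(2) compact_bisectionD(4) by blast
      then have "f (a U) = 0" using a[OF U] by (intro vanish) (auto simp: fib_def)
      finally show "(\<Sum>U'\<in>{U' \<in> S. a U' = a U}. c U') = 0" .
    qed
    finally show ?thesis .
  qed
  ultimately show thesis using that W by blast
qed

end

section \<open>Group rings and isotropy\<close>

text \<open>A group viewed as a discrete groupoid with one unit. Its convolution is the product of
  the group ring, which thereby inherits the ring laws.\<close>

definition group_groupoid :: "('a, 'c) monoid_scheme \<Rightarrow> 'a groupoid" where
  "group_groupoid H = \<lparr>arrows = discrete_topology (carrier H), src = \<lambda>_. \<one>\<^bsub>H\<^esub>, tgt = \<lambda>_. \<one>\<^bsub>H\<^esub>,
     gcomp = mult H, ginv = m_inv H\<rparr>"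

context group
begin

lemma topological_groupoid_group: "topological_groupoid (group_groupoid G)"
proof -
  have units: "units (group_groupoid G) = {\<one>}"
    by (auto simp: units_def group_groupoid_def)
  have us: "unit_space (group_groupoid G) = discrete_topology {\<one>}"
    by (simp add: unit_space_def units) (simp add: group_groupoid_def)
  show ?thesis
    by unfold_locales
      (auto simp: units us, auto simp: group_groupoid_def composable_def m_assoc
        prod_topology_discrete_topology[symmetric] simp del: prod_topology_discrete_topology)
qed

definition finite_support :: "('a \<Rightarrow> 'k::field) \<Rightarrow> bool" where
  "finite_support f \<longleftrightarrow> finite {x. f x \<noteq> 0} \<and> {x. f x \<noteq> 0} \<subseteq> carrier G"

lemma group_ring_simps:
  "carrier (group_ring G) = {f :: 'a \<Rightarrow> 'k::field. finite_support f}"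
  "mult (group_ring G) = (topological_groupoid.conv (group_groupoid G) :: ('a \<Rightarrow> 'k) \<Rightarrow> _)"
  "zero (group_ring G) = (\<lambda>x. 0 :: 'k)" "add (group_ring G) = (\<lambda>f g x. f x + g x :: 'k)"
proof -
  interpret T: topological_groupoid "group_groupoid G" by (rule topological_groupoid_group)
  show "mult (group_ring G) = (T.conv :: ('a \<Rightarrow> 'k) \<Rightarrow> _)"
    by (intro ext) (simp add: group_ring_def T.conv_def T.fib_def, simp add: group_groupoid_def)
qed (simp_all add: group_ring_def finite_support_def)

lemma finite_support_add:
  assumes "finite_support f" "finite_support g"
  shows "finite_support (\<lambda>x. f x + g x)"
proof -
  have "{x. f x + g x \<noteq> 0} \<subseteq> {x. f x \<noteq> 0} \<union> {x. g x \<noteq> 0}" by auto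
  then show ?thesis using assms unfolding finite_support_def by (meson finite_Un finite_subset le_sup_iff order_trans)
qed

lemma finite_support_scale: "finite_support f \<Longrightarrow> finite_support (\<lambda>x. c * f x)"
  unfolding finite_support_def by (auto intro: finite_subset)

lemma finite_support_zero: "finite_support (\<lambda>x. 0)"
  by (simp add: finite_support_def)

lemma finite_support_source_finite: "finite_support f \<Longrightarrow> topological_groupoid.source_finite (group_groupoid G) f"
  unfolding topological_groupoid.source_finite_def[OF topological_groupoid_group] finite_support_def
  by (auto simp: group_groupoid_def intro: finite_subset)

lemma finite_support_conv:
  fixes f g :: "'a \<Rightarrow> 'k::field"
  assumes "finite_support f" "finite_support g"
  shows "finite_support (topological_groupoid.conv (group_groupoid G) f g)"
proof -
  interpret T: topological_groupoid "group_groupoid G" by (rule topological_groupoid_group)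
  have conv: "T.conv f g x = (if x \<in> carrier G then \<Sum>y\<in>{y \<in> carrier G. g y \<noteq> 0}. f (x \<otimes> inv y) * g y else 0)" for x
    by (simp add: T.conv_def T.fib_def, simp add: group_groupoid_def)
  have "{x. T.conv f g x \<noteq> 0} \<subseteq> (\<lambda>(a, b). a \<otimes> b) ` ({x. f x \<noteq> 0} \<times> {x. g x \<noteq> 0})"
  proof
    fix x assume "x \<in> {x. T.conv f g x \<noteq> 0}"
    then have x: "x \<in> carrier G" "(\<Sum>y\<in>{y \<in> carrier G. g y \<noteq> 0}. f (x \<otimes> inv y) * g y) \<noteq> 0"
      by (auto simp: conv split: if_splits)
    then obtain y where y: "y \<in> {y \<in> carrier G. g y \<noteq> 0}" "f (x \<otimes> inv y) * g y \<noteq> 0"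
      by (meson sum.not_neutral_contains_not_neutral)
    then have "x = (x \<otimes> inv y) \<otimes> y" using x by (simp add: m_assoc)
    then show "x \<in> (\<lambda>(a, b). a \<otimes> b) ` ({x. f x \<noteq> 0} \<times> {x. g x \<noteq> 0})"
      using y by (intro image_eqI[of _ _ "(x \<otimes> inv y, y)"]) auto
  qed
  then have "finite {x. T.conv f g x \<noteq> 0}"
    using assms by (auto simp: finite_support_def intro: finite_subset)
  then show ?thesis unfolding finite_support_def by (auto simp: conv split: if_splits)
qed

theorem nonunital_ring_group_ring: "nonunital_ring (group_ring G :: ('a \<Rightarrow> 'k::field) ring)"
proof -
  interpret T: topological_groupoid "group_groupoid G" by (rule topological_groupoid_group)
  have "abelian_group (group_ring G :: ('a \<Rightarrow> 'k::field) ring)"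
  proof (rule abelian_groupI, unfold group_ring_simps mem_Collect_eq)
    fix f :: "'a \<Rightarrow> 'k" assume "finite_support f"
    then show "\<exists>g\<in>{f. finite_support f}. (\<lambda>x. g x + f x) = (\<lambda>x. 0)"
      using finite_support_scale[of f "-1"] by (intro bexI[of _ "\<lambda>x. -1 * f x"]) simp_all
  qed (auto simp: finite_support_add finite_support_zero add.assoc add.commute)
  then show ?thesis
    by (intro nonunital_ring.intro nonunital_ring_axioms.intro, unfold group_ring_simps mem_Collect_eq)
      (simp_all add: finite_support_conv T.conv_assoc finite_support_source_finite T.conv_add_left T.conv_add_right)
qed

end

section \<open>Restriction of a corner to the isotropy group\<close>

context ample_groupoid
begin

lemma isotropy_inv:
  assumes u: "u \<in> units G" and x: "x \<in> carrier (isotropy_group G u)"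
  shows "inv\<^bsub>isotropy_group G u\<^esub> x = ginv G x"
  by (rule group.inv_equality[OF group_isotropy_group[OF u]]) (use x in \<open>auto simp: isotropy_group_def\<close>)

text \<open>An arrow from \<open>u\<close> into \<open>V\<close> ends in
  \<open>V \<inter> orbit u = {u}\<close>. So on the fibre over \<open>u\<close> an element of the
  corner is supported in the isotropy group, and the convolution sums there are those of the group
  ring. For surjectivity, every isotropy arrow is separated from the others by a bisection.\<close>

lemma surj_ring_hom_isotropy:
  assumes u: "u \<in> units G" and V: "compact_open_units G V" and Vu: "V \<inter> orbit u = {u}"
  defines "H \<equiv> isotropy_group G u"
  shows "surj_ring_hom (corner (steinberg_algebra G) (indicator V)) (group_ring H :: ('a \<Rightarrow> 'k::field) ring)
     (\<lambda>f x. if x \<in> carrier H then f x else 0)"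
proof -
  interpret H: group H unfolding H_def by (rule group_isotropy_group[OF u])
  interpret I: idempotent "steinberg_algebra G :: ('a \<Rightarrow> 'k) ring" "indicator V" by (rule idempotent_unit[OF V])
  let ?C = "corner (steinberg_algebra G :: ('a \<Rightarrow> 'k) ring) (indicator V)"
  let ?h = "\<lambda>(f :: 'a \<Rightarrow> 'k) x. if x \<in> carrier H then f x else 0"
  have uV: "u \<in> V" using Vu by auto
  have carH: "x \<in> carrier H \<longleftrightarrow> x \<in> fib u \<and> tgt G x \<in> V" for x
  proof -
    have "tgt G x \<in> V \<longleftrightarrow> tgt G x = u" if "x \<in> fib u"
    proof -
      have "tgt G x \<in> orbit u" using that by (simp add: orbit_def)
      then show ?thesis using Vu by blast
    qed
    then show ?thesis by (auto simp: H_def isotropy_group_def fib_def)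
  qed
  note C = corner_St_iff[OF V]
  have inC: "x \<in> carrier H" if "f \<in> carrier ?C" "x \<in> fib u" "f x \<noteq> 0" for f x
    using that unfolding C carH by blast
  have closed: "?h f \<in> carrier (group_ring H)" if f: "f \<in> carrier ?C" for f
  proof -
    have "{x. ?h f x \<noteq> 0} \<subseteq> {x \<in> fib u. f x \<noteq> 0}" by (auto simp: carH)
    moreover have "finite {x \<in> fib u. f x \<noteq> 0}" using f source_finiteD(2)[OF St_source_finite] unfolding C by blast
    ultimately show ?thesis
      unfolding H.group_ring_simps H.finite_support_def by (auto intro: finite_subset split: if_splits)
  qed
  have mult: "?h (conv f g) = ?h f \<otimes>\<^bsub>group_ring H\<^esub> ?h g" if f: "f \<in> carrier ?C" and g: "g \<in> carrier ?C" for f g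
  proof
    fix x
    show "?h (conv f g) x = (?h f \<otimes>\<^bsub>group_ring H\<^esub> ?h g) x"
    proof (cases "x \<in> carrier H")
      case False
      then show ?thesis by (simp add: group_ring_def)
    next
      case x: True
      then have xA: "x \<in> Arr" "src G x = u" "tgt G x = u" by (auto simp: H_def isotropy_group_def)
      have Y: "{y \<in> fib u. g y \<noteq> 0} = {y \<in> carrier H. ?h g y \<noteq> 0}"
        using inC[OF g] carH by auto
      have "(?h f \<otimes>\<^bsub>group_ring H\<^esub> ?h g) x =
          (\<Sum>y\<in>{y \<in> carrier H. ?h g y \<noteq> 0}. ?h f (x \<otimes>\<^bsub>H\<^esub> inv\<^bsub>H\<^esub> y) * ?h g y)"
        using x by (simp add: group_ring_def)
      also have "\<dots> = (\<Sum>y\<in>{y \<in> carrier H. ?h g y \<noteq> 0}. f (gcomp G x (ginv G y)) * g y)"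
      proof (rule sum.cong[OF refl])
        fix y assume "y \<in> {y \<in> carrier H. ?h g y \<noteq> 0}"
        then have y: "y \<in> carrier H" by simp
        have "x \<otimes>\<^bsub>H\<^esub> inv\<^bsub>H\<^esub> y \<in> carrier H" using x y by simp
        moreover have "x \<otimes>\<^bsub>H\<^esub> inv\<^bsub>H\<^esub> y = gcomp G x (ginv G y)"
          using isotropy_inv[OF u] y unfolding H_def by (simp add: isotropy_group_def)
        ultimately show "?h f (x \<otimes>\<^bsub>H\<^esub> inv\<^bsub>H\<^esub> y) * ?h g y = f (gcomp G x (ginv G y)) * g y"
          using y by simp
      qed
      also have "\<dots> = conv f g x" unfolding conv_def xA(2) Y[symmetric] using xA by simp
      finally show ?thesis using x by simp
    qed
  qed
  have add: "?h (\<lambda>x. f x + g x) = (\<lambda>x. ?h f x + ?h g x)" for f g by auto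
  have Cadd: "(\<lambda>x. f x + g x) \<in> carrier ?C" if "f \<in> carrier ?C" "g \<in> carrier ?C" for f g
  proof -
    have "x \<in> Arr \<and> src G x \<in> V \<and> tgt G x \<in> V" if "f x + g x \<noteq> 0" for x
    proof -
      have "f x \<noteq> 0 \<or> g x \<noteq> 0" using that by auto
      then show ?thesis using \<open>f \<in> carrier ?C\<close> \<open>g \<in> carrier ?C\<close> unfolding C by blast
    qed
    then show ?thesis using that St_add unfolding C by blast
  qed
  have onto: "\<exists>f\<in>carrier ?C. ?h f = \<phi>" if "finite S" "{x. \<phi> x \<noteq> 0} \<subseteq> S" "S \<subseteq> carrier H" for \<phi> :: "'a \<Rightarrow> 'k" and S
    using that
  proof (induction S arbitrary: \<phi> rule: finite_induct)
    case empty
    then have "\<phi> = (\<lambda>x. 0)" by auto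
    moreover have "(\<lambda>x. 0) \<in> carrier ?C" unfolding C by (simp add: St_zero)
    ultimately show ?case by (intro bexI[of _ "\<lambda>x. 0"]) auto
  next
    case (insert g S)
    have g: "g \<in> Arr" "src G g = u" "tgt G g = u"
      using insert.prems by (auto simp: H_def isotropy_group_def)
    obtain B0 where B0: "compact_bisection G B0" "g \<in> B0"
      by (rule compact_bisection_basis[OF openin_topspace g(1)])
    \<comment> \<open>Both ends are restricted to \<open>V\<close> so that the indicator lies in the
      corner. Since sources are injective on \<open>B\<close>, its only isotropy arrow at
      \<open>u\<close> is \<open>g\<close>.\<close>
    define B where "B = {x \<in> {x \<in> B0. src G x \<in> V}. tgt G x \<in> V}"
    have B: "compact_bisection G B"
      unfolding B_def by (intro compact_bisection_tgt_restrict compact_bisection_src_restrict B0 V)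
    have gB: "g \<in> B" using B0 g uV by (simp add: B_def)
    have one: "x = g" if "x \<in> B" "x \<in> carrier H" for x
      using inj_onD[OF compact_bisectionD(5)[OF B] _ that(1) gB] that(2) g
      by (simp add: H_def isotropy_group_def)
    define \<psi> where "\<psi> = \<phi>(g := 0)"
    have "{x. \<psi> x \<noteq> 0} \<subseteq> S" using insert.prems by (auto simp: \<psi>_def)
    moreover have "S \<subseteq> carrier H" using insert.prems by simp
    ultimately obtain f where f: "f \<in> carrier ?C" "?h f = \<psi>" using insert.IH[of \<psi>] by auto
    define b where "b = (\<lambda>x. \<phi> g * indicator B x)"
    have b: "b \<in> carrier ?C"
      unfolding C b_def using compact_bisectionD(4)[OF B]
      by (auto intro!: St_indicator[OF B]) (auto simp: indicator_def B_def split: if_splits)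
    have "?h b x + \<psi> x = \<phi> x" for x
    proof (cases "x = g")
      case True
      moreover have "g \<in> carrier H" using insert.prems by simp
      ultimately show ?thesis using gB by (simp add: b_def \<psi>_def)
    next
      case False
      then have "?h b x = 0" using one[of x] by (auto simp: b_def indicator_def)
      then show ?thesis using False by (simp add: \<psi>_def)
    qed
    then have "?h (\<lambda>x. b x + f x) x = \<phi> x" for x
      using fun_cong[OF f(2), of x] by (cases "x \<in> carrier H") (metis add_0)+
    then have "?h (\<lambda>x. b x + f x) = \<phi>" by (rule ext)
    then show ?case by (rule bexI[OF _ Cadd[OF b f(1)]])
  qed
  show ?thesis
  proof (intro surj_ring_hom.intro surj_ring_hom_axioms.intro I.corner_ring H.nonunital_ring_group_ring)
    show "?h ` carrier ?C = carrier (group_ring H)"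
    proof
      show "carrier (group_ring H) \<subseteq> ?h ` carrier ?C"
      proof
        fix \<phi> :: "'a \<Rightarrow> 'k" assume "\<phi> \<in> carrier (group_ring H)"
        then have "finite {x. \<phi> x \<noteq> 0}" "{x. \<phi> x \<noteq> 0} \<subseteq> carrier H"
          by (auto simp: H.group_ring_simps H.finite_support_def)
        from onto[OF this(1) order_refl this(2)] show "\<phi> \<in> ?h ` carrier ?C"
          by (elim bexE) (rule image_eqI, erule sym)
      qed
    qed (use closed in blast)
    show "?h (f \<oplus>\<^bsub>?C\<^esub> g) = ?h f \<oplus>\<^bsub>group_ring H\<^esub> ?h g" for f g
      by (simp only: corner_simps St_simps add H.group_ring_simps)
    show "?h (f \<otimes>\<^bsub>?C\<^esub> g) = ?h f \<otimes>\<^bsub>group_ring H\<^esub> ?h g" if "f \<in> carrier ?C" "g \<in> carrier ?C" for f g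
      using mult[OF that] by (simp only: corner_simps St_simps)
  qed
qed

lemma GCR_isotropy:
  assumes GCR: "GCR (steinberg_algebra G :: ('a \<Rightarrow> 'k::field) ring)"
    and V: "compact_open_units G V" "V \<inter> orbit u = {u}" and u: "u \<in> units G"
  shows "GCR (group_ring (isotropy_group G u) :: ('a \<Rightarrow> 'k) ring)"
  using surj_ring_hom.GCR_image[OF surj_ring_hom_isotropy[OF u V]
      idempotent.GCR_corner[OF idempotent_unit[OF V(1)] GCR]] .

end

section \<open>Rings that are finite over a commutative subring\<close>

inductive_set left_span :: "('a, 'c) ring_scheme \<Rightarrow> 'a set \<Rightarrow> 'a set \<Rightarrow> 'a set" for R A S where
  zero: "\<zero>\<^bsub>R\<^esub> \<in> left_span R A S"
| add: "\<lbrakk>x \<in> left_span R A S; y \<in> left_span R A S\<rbrakk> \<Longrightarrow> x \<oplus>\<^bsub>R\<^esub> y \<in> left_span R A S"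
| gen: "\<lbrakk>c \<in> A; s \<in> S\<rbrakk> \<Longrightarrow> c \<otimes>\<^bsub>R\<^esub> s \<in> left_span R A S"

text \<open>The intended case is a group ring: \<open>A\<close> consists of the functions supported
  on an abelian subgroup of finite index, \<open>S\<close> of the coset representatives, and
  \<open>i\<close> is the unit.\<close>

locale finite_over_commutative = R?: nonunital_ring R for R (structure) and A S and i +
  assumes i: "i \<in> A" "\<And>x. x \<in> carrier R \<Longrightarrow> i \<otimes> x = x"
    and A_subset: "A \<subseteq> carrier R"
    and A_add: "\<lbrakk>a \<in> A; b \<in> A\<rbrakk> \<Longrightarrow> a \<oplus> b \<in> A"
    and A_minus: "a \<in> A \<Longrightarrow> \<ominus> a \<in> A"
    and A_mult: "\<lbrakk>a \<in> A; b \<in> A\<rbrakk> \<Longrightarrow> a \<otimes> b \<in> A"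
    and A_comm: "\<lbrakk>a \<in> A; b \<in> A\<rbrakk> \<Longrightarrow> a \<otimes> b = b \<otimes> a"
    and S: "finite S" "S \<subseteq> carrier R" "left_span R A S = carrier R"
begin

definition A_submodule :: "'a set \<Rightarrow> bool" where
  "A_submodule P \<longleftrightarrow> P \<subseteq> carrier R \<and> \<zero> \<in> P \<and> (\<forall>x\<in>P. \<forall>y\<in>P. x \<oplus> y \<in> P) \<and> (\<forall>x\<in>P. \<ominus> x \<in> P)
     \<and> (\<forall>a\<in>A. \<forall>x\<in>P. a \<otimes> x \<in> P)"

lemma A_submoduleD:
  assumes "A_submodule P"
  shows "x \<in> P \<Longrightarrow> x \<in> carrier R" "\<zero> \<in> P" "\<lbrakk>x \<in> P; y \<in> P\<rbrakk> \<Longrightarrow> x \<oplus> y \<in> P" "x \<in> P \<Longrightarrow> \<ominus> x \<in> P"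
    "\<lbrakk>a \<in> A; x \<in> P\<rbrakk> \<Longrightarrow> a \<otimes> x \<in> P" "\<lbrakk>x \<in> P; y \<in> P\<rbrakk> \<Longrightarrow> x \<ominus> y \<in> P"
  using assms by (auto simp: A_submodule_def a_minus_def)

lemma A_carrier: "a \<in> A \<Longrightarrow> a \<in> carrier R"
  using A_subset by auto

lemma minus_zero [simp]: "\<ominus> \<zero> = \<zero>"
  by (rule minus_equality) auto

lemma submodule_eq_carrier:
  assumes P: "A_submodule P" and "S \<subseteq> P"
  shows "P = carrier R"
proof -
  have "x \<in> P" if "x \<in> left_span R A S" for x
    using that by induction (use assms A_submoduleD[OF P] in auto)
  then show ?thesis using S(3) A_submoduleD(1)[OF P] by blast
qed

text \<open>Zorn's lemma applies because the finite generating set \<open>S\<close>, if contained in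
  the union of a chain, is contained in one of its members. Maximality makes \<open>R/P\<close> a
  simple module over \<open>A\<close>, which the last conclusion expresses.\<close>

lemma exists_maximal_submodule:
  assumes L: "A_submodule L" "L \<noteq> carrier R"
  obtains P where "A_submodule P" "L \<subseteq> P" "P \<noteq> carrier R"
    "\<And>y z. \<lbrakk>y \<in> carrier R - P; z \<in> carrier R\<rbrakk> \<Longrightarrow> \<exists>d\<in>A. z \<ominus> d \<otimes> y \<in> P"
proof -
  define \<P> where "\<P> = {P. A_submodule P \<and> L \<subseteq> P \<and> \<not> S \<subseteq> P}"
  have "L \<in> \<P>" using L submodule_eq_carrier by (auto simp: \<P>_def)
  have "\<exists>P\<in>\<P>. \<forall>X\<in>\<P>. P \<subseteq> X \<longrightarrow> X = P"
  proof (rule subset_Zorn_nonempty)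
    show "\<P> \<noteq> {}" using \<open>L \<in> \<P>\<close> by blast
    fix \<C> assume C: "\<C> \<noteq> {}" "subset.chain \<P> \<C>"
    then have sub: "\<And>P. P \<in> \<C> \<Longrightarrow> A_submodule P \<and> L \<subseteq> P \<and> \<not> S \<subseteq> P"
      by (auto simp: subset.chain_def \<P>_def)
    have both: "\<exists>P\<in>\<C>. x \<in> P \<and> y \<in> P" if "x \<in> \<Union>\<C>" "y \<in> \<Union>\<C>" for x y
      using that C(2) unfolding subset.chain_def by blast
    have "A_submodule (\<Union>\<C>)"
      unfolding A_submodule_def
    proof (intro conjI ballI)
      show "\<Union>\<C> \<subseteq> carrier R" using sub unfolding A_submodule_def by blast
      show "\<zero> \<in> \<Union>\<C>" using sub C(1) unfolding A_submodule_def by blast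
      show "x \<oplus> y \<in> \<Union>\<C>" if "x \<in> \<Union>\<C>" "y \<in> \<Union>\<C>" for x y
        using both[OF that] sub A_submoduleD(3) by blast
      show "\<ominus> x \<in> \<Union>\<C>" if "x \<in> \<Union>\<C>" for x
        using that sub A_submoduleD(4) by blast
      show "a \<otimes> x \<in> \<Union>\<C>" if "a \<in> A" "x \<in> \<Union>\<C>" for a x
        using that sub A_submoduleD(5) by blast
    qed
    moreover have "\<not> S \<subseteq> \<Union>\<C>"
    proof
      assume "S \<subseteq> \<Union>\<C>"
      moreover have "subset.chain UNIV \<C>" using C(2) by (auto simp: subset.chain_def)
      ultimately obtain P where "P \<in> \<C>" "S \<subseteq> P" using finite_subset_Union_chain[OF S(1) _ C(1)] by blast
      then show False using sub by blast
    qed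
    ultimately show "\<Union>\<C> \<in> \<P>" using sub C(1) by (auto simp: \<P>_def)
  qed
  then obtain P where "P \<in> \<P>" and max': "\<forall>X\<in>\<P>. P \<subseteq> X \<longrightarrow> X = P" by blast
  then have P: "A_submodule P" "L \<subseteq> P" "\<not> S \<subseteq> P" by (simp_all add: \<P>_def)
  have max: "X = P" if "A_submodule X" "L \<subseteq> X" "\<not> S \<subseteq> X" "P \<subseteq> X" for X
    using max' that by (simp add: \<P>_def)
  note PD = A_submoduleD[OF P(1)]
  have "\<exists>d\<in>A. z \<ominus> d \<otimes> y \<in> P" if y: "y \<in> carrier R" "y \<notin> P" and z: "z \<in> carrier R" for y z
  proof -
    \<comment> \<open>This is \<open>P + A y\<close>, strictly larger than \<open>P\<close> because
      the left identity \<open>i\<close> of \<open>A\<close> puts \<open>y\<close> into it.\<close>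
    define X where "X = {x \<in> carrier R. \<exists>d\<in>A. x \<ominus> d \<otimes> y \<in> P}"
    have "\<ominus> i \<oplus> i = \<zero>" using i(1) A_carrier by (simp add: l_neg)
    then have A0: "\<zero> \<in> A" using A_add[OF A_minus[OF i(1)] i(1)] by simp
    have sub: "A_submodule X"
      unfolding A_submodule_def
    proof (intro conjI ballI)
      show "X \<subseteq> carrier R" by (auto simp: X_def)
      show "\<zero> \<in> X" using A0 PD(2) y by (auto simp: X_def a_minus_def intro!: bexI[of _ \<zero>])
      show "x \<oplus> x' \<in> X" if xx: "x \<in> X" "x' \<in> X" for x x'
      proof -
        obtain d d' where d: "d \<in> A" "x \<ominus> d \<otimes> y \<in> P" "d' \<in> A" "x' \<ominus> d' \<otimes> y \<in> P" "x \<in> carrier R" "x' \<in> carrier R"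
          using xx by (auto simp: X_def)
        have "(x \<oplus> x') \<ominus> (d \<oplus> d') \<otimes> y = (x \<ominus> d \<otimes> y) \<oplus> (x' \<ominus> d' \<otimes> y)"
          using d y A_carrier by (simp add: a_minus_def l_distr m_closed minus_add a_ac)
        then show ?thesis using d PD(3) A_add unfolding X_def by (auto intro!: bexI[of _ "d \<oplus> d'"])
      qed
      show "\<ominus> x \<in> X" if xx: "x \<in> X" for x
      proof -
        obtain d where d: "d \<in> A" "x \<ominus> d \<otimes> y \<in> P" "x \<in> carrier R"
          using xx by (auto simp: X_def)
        have "\<ominus> x \<ominus> (\<ominus> d) \<otimes> y = \<ominus> (x \<ominus> d \<otimes> y)"
          using d y A_carrier by (simp add: a_minus_def l_minus m_closed minus_add)
        then show ?thesis using d PD(4) A_minus unfolding X_def by (auto intro!: bexI[of _ "\<ominus> d"])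
      qed
      show "a \<otimes> x \<in> X" if xx: "a \<in> A" "x \<in> X" for a x
      proof -
        obtain d where d: "d \<in> A" "x \<ominus> d \<otimes> y \<in> P" "x \<in> carrier R"
          using xx by (auto simp: X_def)
        have "a \<otimes> x \<ominus> (a \<otimes> d) \<otimes> y = a \<otimes> (x \<ominus> d \<otimes> y)"
          using d y A_carrier that by (simp add: r_diff_distr m_closed m_assoc)
        then show ?thesis using d PD(5) A_mult that A_carrier m_closed
          unfolding X_def by (auto intro!: bexI[of _ "a \<otimes> d"])
      qed
    qed
    have PX: "P \<subseteq> X"
      using PD(1) A0 y by (auto simp: X_def a_minus_def intro!: bexI[of _ \<zero>])
    have "y \<ominus> i \<otimes> y \<in> P" using y i PD(2) by (simp add: a_minus_def r_neg)
    then have "y \<in> X" using i(1) y by (auto simp: X_def)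
    then have "S \<subseteq> X" using max[OF sub _ _ PX] P(2) PX y by blast
    then show ?thesis using submodule_eq_carrier[OF sub] z by (auto simp: X_def)
  qed
  then show thesis using that[OF P(1,2)] P(3) S(2) by blast
qed

text \<open>Gaussian elimination: \<open>R/P\<close> is a one-dimensional space over the field that \<open>A\<close> induces on it.\<close>

lemma finite_test_set:
  assumes P: "A_submodule P"
    and simple: "\<And>y z. \<lbrakk>y \<in> carrier R - P; z \<in> carrier R\<rbrakk> \<Longrightarrow> \<exists>d\<in>A. z \<ominus> d \<otimes> y \<in> P"
    and "finite B" "B \<subseteq> carrier R"
  shows "\<exists>T. finite T \<and> T \<subseteq> carrier R \<and>
    (\<forall>f\<in>left_span R A B. (\<forall>m\<in>T. f \<otimes> m \<in> P) \<longrightarrow> (\<forall>m\<in>carrier R. f \<otimes> m \<in> P))"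
  using assms(3,4)
proof (induction "card B" arbitrary: B rule: less_induct)
  case (less B)
  note PD = A_submoduleD[OF P]
  have zero_A: "\<zero> \<in> A" using A_add[OF A_minus[OF i(1)] i(1)] i(1) A_carrier by (simp add: l_neg)
  show ?case
  proof (cases "B = {}")
    case True
    have "f = \<zero>" if "f \<in> left_span R A {}" for f
      using that by induction auto
    then have "f \<otimes> m \<in> P" if "f \<in> left_span R A {}" "m \<in> carrier R" for f m
      using that PD(2) by (metis l_null)
    then show ?thesis unfolding True by (intro exI[of _ "{}"]) auto
  next
    case False
    then obtain g C where B: "B = insert g C" "g \<notin> C" by (metis all_not_in_conv mk_disjoint_insert)
    have fin: "finite C" "C \<subseteq> carrier R" "g \<in> carrier R" using less.prems B by auto
    have cardC: "card C < card B" using B fin by simp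
    \<comment> \<open>By commutativity, an element of \<open>A\<close> that kills one nonzero class
      of \<open>R/P\<close> kills all of them: elements of \<open>A\<close> act as scalars from a
      field.\<close>
    have prime: "c \<otimes> z \<in> P" if c: "c \<in> A" "c \<otimes> y \<in> P" and y: "y \<in> carrier R" "y \<notin> P" and z: "z \<in> carrier R" for c y z
    proof -
      obtain d where d: "d \<in> A" "z \<ominus> d \<otimes> y \<in> P" using simple[of y z] y z by blast
      have "c \<otimes> (d \<otimes> y) = d \<otimes> (c \<otimes> y)"
        using c d y A_carrier A_comm by (simp add: m_assoc[symmetric])
      then have 1: "c \<otimes> (d \<otimes> y) \<in> P" using PD(5)[OF d(1) c(2)] by simp
      have 2: "c \<otimes> z \<ominus> c \<otimes> (d \<otimes> y) \<in> P"
        using PD(5)[OF c(1) d(2)] c d y z A_carrier by (simp add: r_diff_distr m_closed)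
      have "c \<otimes> z = (c \<otimes> z \<ominus> c \<otimes> (d \<otimes> y)) \<oplus> c \<otimes> (d \<otimes> y)"
        using c d y z A_carrier by (simp add: a_minus_def m_closed add.m_assoc l_neg)
      then show ?thesis using PD(3)[OF 2 1] by simp
    qed
    have decomp: "\<exists>f'\<in>left_span R A ((\<lambda>s. s \<ominus> d s \<otimes> g) ` C). \<exists>c\<in>A. f = f' \<oplus> c \<otimes> g"
      if f: "f \<in> left_span R A B" and d: "\<And>s. s \<in> C \<Longrightarrow> d s \<in> A" for f d
      using f
    proof induction
      case zero
      show ?case using fin zero_A by (intro bexI[of _ \<zero>] left_span.zero) auto
    next
      case (add x y)
      then obtain x' c y' c' where *: "x' \<in> left_span R A ((\<lambda>s. s \<ominus> d s \<otimes> g) ` C)" "c \<in> A" "x = x' \<oplus> c \<otimes> g"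
        "y' \<in> left_span R A ((\<lambda>s. s \<ominus> d s \<otimes> g) ` C)" "c' \<in> A" "y = y' \<oplus> c' \<otimes> g" by blast
      have car: "z \<in> carrier R" if "z \<in> left_span R A ((\<lambda>s. s \<ominus> d s \<otimes> g) ` C)" for z
        using that by induction (use fin d A_carrier m_closed in auto)
      have "x \<oplus> y = (x' \<oplus> y') \<oplus> (c \<oplus> c') \<otimes> g"
        using * car A_carrier fin by (simp add: l_distr m_closed a_ac)
      then show ?case using left_span.add[OF *(1,4)] A_add[OF *(2,5)] by blast
    next
      case (gen c s)
      show ?case
      proof (cases "s = g")
        case True
        then show ?thesis using gen fin A_carrier m_closed by (intro bexI[of _ \<zero>] bexI[of _ c] left_span.zero) auto
      next
        case False
        then have s: "s \<in> C" using gen B by simp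
        then have car: "s \<in> carrier R" "c \<in> carrier R" "d s \<in> carrier R" using fin gen d A_carrier by auto
        have "c \<otimes> s = c \<otimes> (s \<ominus> d s \<otimes> g) \<oplus> (c \<otimes> d s) \<otimes> g"
          using car fin by (simp add: r_diff_distr m_closed m_assoc) (simp add: a_minus_def m_closed add.m_assoc l_neg)
        moreover have "c \<otimes> (s \<ominus> d s \<otimes> g) \<in> left_span R A ((\<lambda>s. s \<ominus> d s \<otimes> g) ` C)"
          using gen s by (intro left_span.gen) auto
        ultimately show ?thesis using A_mult[OF gen(1) d[OF s]] by blast
      qed
    qed
    have span_car: "f \<in> carrier R" if "f \<in> left_span R A D" "D \<subseteq> carrier R" for f D
      using that by induction (use A_carrier m_closed in auto)
    \<comment> \<open>Each \<open>f\<close> is regarded as the map \<open>m \<mapsto> f m\<close>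
      from \<open>R\<close> to \<open>R/P\<close>. If \<open>g\<close> is nonzero at some
      \<open>m0\<close>, it is a pivot: multiples of \<open>g\<close> are subtracted so that the
      other generators vanish at \<open>m0\<close>, and testing at \<open>m0\<close> then detects
      the coefficient of \<open>g\<close>. Otherwise \<open>g\<close> acts as zero and is
      dropped.\<close>
    show ?thesis
    proof (cases "\<exists>m\<in>carrier R. g \<otimes> m \<notin> P")
      case True
      then obtain m0 where m0: "m0 \<in> carrier R" "g \<otimes> m0 \<notin> P" by blast
      have "\<forall>s\<in>C. \<exists>d\<in>A. s \<otimes> m0 \<ominus> d \<otimes> (g \<otimes> m0) \<in> P"
        using simple[of "g \<otimes> m0"] m0 fin m_closed by auto
      then obtain d where d: "\<And>s. s \<in> C \<Longrightarrow> d s \<in> A" "\<And>s. s \<in> C \<Longrightarrow> s \<otimes> m0 \<ominus> d s \<otimes> (g \<otimes> m0) \<in> P" by metis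
      define D where "D = (\<lambda>s. s \<ominus> d s \<otimes> g) ` C"
      have D: "finite D" "D \<subseteq> carrier R" using fin d A_carrier m_closed by (auto simp: D_def)
      have cardD: "card D < card B" using cardC card_image_le[OF fin(1)] unfolding D_def by (rule order.strict_trans1[rotated])
      have Dm0: "s \<otimes> m0 \<in> P" if "s \<in> D" for s
        using that d fin m0 A_carrier by (auto simp: D_def l_diff_distr m_closed m_assoc subset_iff)
      have span_m0: "f \<otimes> m0 \<in> P" if "f \<in> left_span R A D" for f
        using that
      proof induction
        case (add x y)
        then show ?case using span_car[OF _ D(2)] m0 PD(3) by (simp add: l_distr)
      next
        case (gen c s)
        then show ?case using Dm0 PD(5) D(2) A_carrier m0 by (auto simp: m_assoc subset_iff)
      qed (use m0 PD(2) in simp)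
      obtain T where T: "finite T" "T \<subseteq> carrier R"
        "\<forall>f\<in>left_span R A D. (\<forall>m\<in>T. f \<otimes> m \<in> P) \<longrightarrow> (\<forall>m\<in>carrier R. f \<otimes> m \<in> P)"
        using less.hyps[OF cardD D] by blast
      show ?thesis
      proof (intro exI[of _ "insert m0 T"] conjI ballI impI)
        fix f m assume f: "f \<in> left_span R A B" and 0: "\<forall>m\<in>insert m0 T. f \<otimes> m \<in> P" and m: "m \<in> carrier R"
        obtain f' c where f': "f' \<in> left_span R A D" "c \<in> A" "f = f' \<oplus> c \<otimes> g"
          using decomp[OF f, of d] d(1) unfolding D_def by blast
        have car: "f' \<in> carrier R" "c \<in> carrier R" using span_car[OF f'(1) D(2)] f'(2) A_carrier by auto
        have split: "f \<otimes> x = f' \<otimes> x \<oplus> c \<otimes> (g \<otimes> x)" if "x \<in> carrier R" for x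
          using that f'(3) car fin by (simp add: l_distr m_closed m_assoc)
        have cancel: "y \<in> P" if "x \<oplus> y \<in> P" "x \<in> P" "y \<in> carrier R" for x y
        proof -
          have "(x \<oplus> y) \<ominus> x = y" using that PD(1) by (simp add: a_minus_def a_comm[of x y] a_assoc r_neg)
          moreover have "(x \<oplus> y) \<ominus> x \<in> P" using PD(6) that by blast
          ultimately show ?thesis by simp
        qed
        have "c \<otimes> (g \<otimes> m0) \<in> P"
          using cancel[OF _ span_m0[OF f'(1)]] 0 split[OF m0(1)] car fin m0 m_closed by auto
        then have cg: "c \<otimes> z \<in> P" if "z \<in> carrier R" for z
          using prime[OF f'(2) _ _ m0(2) that] fin m0 m_closed by auto
        have "f' \<otimes> x \<in> P" if "x \<in> T" for x
          using cancel[of "c \<otimes> (g \<otimes> x)" "f' \<otimes> x"] 0 that split[of x] cg[of "g \<otimes> x"] T(2) fin car m_closed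
          by (auto simp: a_comm subset_iff)
        then have "f' \<otimes> m \<in> P" using T(3) f'(1) m by blast
        then show "f \<otimes> m \<in> P" using split[OF m] cg[of "g \<otimes> m"] fin m m_closed PD(3) by simp
      qed (use T m0 in auto)
    next
      case False
      \<comment> \<open>Elimination with all coefficients zero leaves the generators in
        \<open>C\<close> unchanged and merely splits off a multiple of \<open>g\<close>.\<close>
      have eq: "(\<lambda>s. s \<ominus> \<zero> \<otimes> g) ` C = C"
        using fin by (intro trans[OF image_cong[OF refl] image_ident]) (auto simp: a_minus_def minus_equality[of \<zero> \<zero>])
      obtain T where T: "finite T" "T \<subseteq> carrier R"
        "\<forall>f\<in>left_span R A C. (\<forall>m\<in>T. f \<otimes> m \<in> P) \<longrightarrow> (\<forall>m\<in>carrier R. f \<otimes> m \<in> P)"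
        using less.hyps[OF cardC fin(1,2)] by blast
      show ?thesis
      proof (intro exI[of _ T] conjI ballI impI)
        fix f m assume f: "f \<in> left_span R A B" and 0: "\<forall>m\<in>T. f \<otimes> m \<in> P" and m: "m \<in> carrier R"
        obtain f' c where f': "f' \<in> left_span R A C" "c \<in> A" "f = f' \<oplus> c \<otimes> g"
          using decomp[OF f zero_A] unfolding eq by blast
        have car: "f' \<in> carrier R" "c \<in> carrier R" using span_car[OF f'(1) fin(2)] f'(2) A_carrier by auto
        have split: "f \<otimes> x = f' \<otimes> x \<oplus> c \<otimes> (g \<otimes> x)" if "x \<in> carrier R" for x
          using that f'(3) car fin by (simp add: l_distr m_closed m_assoc)
        have cg: "c \<otimes> (g \<otimes> x) \<in> P" if "x \<in> carrier R" for x
          using PD(5)[OF f'(2)] False that by blast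
        have "f' \<otimes> x \<in> P" if x: "x \<in> T" for x
        proof -
          have "f \<otimes> x \<ominus> c \<otimes> (g \<otimes> x) \<in> P" using PD(6) 0 x cg T(2) by blast
          moreover have "f \<otimes> x \<ominus> c \<otimes> (g \<otimes> x) = f' \<otimes> x"
            using split[of x] x T(2) car fin m_closed by (auto simp: a_minus_def add.m_assoc r_neg subset_iff)
          ultimately show ?thesis by simp
        qed
        then have "f' \<otimes> m \<in> P" using T(3) f'(1) m by blast
        then show "f \<otimes> m \<in> P" using split[OF m] cg[OF m] PD(3) by simp
      qed (use T in auto)
    qed
  qed
qed

text \<open>Take a test set \<open>T\<close> of least size: vectors on which an element must vanish
  modulo \<open>L\<close> to lie in the core. After removing some \<open>t\<close>, an element
  \<open>a\<close> outside the core still vanishes on the rest. Multiples of \<open>a\<close> are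
  then detected at \<open>t\<close> alone, where simplicity of \<open>R/L\<close> gives
  \<open>s r a = a\<close>; so this holds modulo the core.\<close>

theorem GCR_finite_over_commutative: "GCR R"
  unfolding GCR_iff[OF nonunital_ring_axioms]
proof (intro allI impI)
  fix L assume "max_modular R L"
  then interpret L: max_modular_left_ideal L R by (rule max_modular_left_idealI)
  let ?I = "ideal_core R L"
  have "A_submodule L" unfolding A_submodule_def using L.l_closed A_carrier L.a_subset by auto
  moreover have "L \<noteq> carrier R" using L.proper by blast
  ultimately obtain P where P: "A_submodule P" "L \<subseteq> P" "P \<noteq> carrier R"
    "\<And>y z. \<lbrakk>y \<in> carrier R - P; z \<in> carrier R\<rbrakk> \<Longrightarrow> \<exists>d\<in>A. z \<ominus> d \<otimes> y \<in> P"
    using exists_maximal_submodule[of L] by metis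
  \<comment> \<open>\<open>L\<close> is the largest left ideal inside \<open>P\<close>, because an
    element outside \<open>L\<close> generates \<open>R\<close> modulo \<open>L\<close>, and
    \<open>L\<close> is contained in the proper submodule \<open>P\<close>. This returns from
    \<open>P\<close> to \<open>L\<close>.\<close>
  have L_iff: "y \<in> L" if y: "y \<in> carrier R" and *: "\<And>x. x \<in> carrier R \<Longrightarrow> x \<otimes> y \<in> P" for y
  proof (rule ccontr)
    assume "y \<notin> L"
    have "z \<in> P" if z: "z \<in> carrier R" for z
    proof -
      obtain s where s: "s \<in> carrier R" "s \<otimes> y \<ominus> z \<in> L" using L.simple[of y z] y z \<open>y \<notin> L\<close> by blast
      have "s \<otimes> y \<ominus> (s \<otimes> y \<ominus> z) = z"
        using s y z by (simp add: a_minus_def m_closed minus_add minus_minus r_neg1 a_assoc[symmetric] r_neg)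
      moreover have "s \<otimes> y \<ominus> (s \<otimes> y \<ominus> z) \<in> P"
        using A_submoduleD(6)[OF P(1) *[OF s(1)]] s(2) P(2) by blast
      ultimately show ?thesis by simp
    qed
    then show False using P(3) A_submoduleD(1)[OF P(1)] by blast
  qed
  obtain T0 where T0: "finite T0" "T0 \<subseteq> carrier R"
    "\<forall>f\<in>carrier R. (\<forall>m\<in>T0. f \<otimes> m \<in> P) \<longrightarrow> (\<forall>m\<in>carrier R. f \<otimes> m \<in> P)"
    using finite_test_set[OF P(1,4) S(1,2)] unfolding S(3) by blast
  define test where "test T \<longleftrightarrow> T \<subseteq> carrier R \<and> (\<forall>f\<in>carrier R. (\<forall>m\<in>T. f \<otimes> m \<in> L) \<longrightarrow> f \<in> ?I)" for T
  have "test T0"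
    unfolding test_def
  proof (intro conjI ballI impI T0)
    fix f assume f: "f \<in> carrier R" "\<forall>m\<in>T0. f \<otimes> m \<in> L"
    have "f \<otimes> r \<in> L" if r: "r \<in> carrier R" for r
    \<comment> \<open>The test set for \<open>P\<close> is applied to \<open>x f\<close> with
      \<open>x\<close> arbitrary, since membership in \<open>L\<close> requires all left multiples
      to lie in \<open>P\<close>.\<close>
    proof (rule L_iff)
      fix x assume x: "x \<in> carrier R"
      have "(x \<otimes> f) \<otimes> m \<in> P" if "m \<in> T0" for m
        using that f x T0(2) P(2) L.l_closed by (auto simp: m_assoc subset_iff)
      then have "(x \<otimes> f) \<otimes> r \<in> P" using T0(3) x f r m_closed by blast
      then show "x \<otimes> (f \<otimes> r) \<in> P" using x f r by (simp add: m_assoc)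
    qed (use f r m_closed in simp)
    then show "f \<in> ?I" using f by (simp add: ideal_core_def)
  qed
  then obtain T where T: "finite T" "test T" and min: "\<And>T'. T' \<subset> T \<Longrightarrow> \<not> test T'"
  proof -
    assume "test T0"
    then obtain T where "finite T \<and> test T" "\<And>T'. finite T' \<and> test T' \<Longrightarrow> card T \<le> card T'"
      using T0(1) ex_has_least_nat[of "\<lambda>T. finite T \<and> test T" T0 card] by blast
    then show thesis
      using that[of T] by (meson finite_subset leD psubset_card_mono psubset_imp_subset)
  qed
  have "T \<noteq> {}"
  proof
    assume "T = {}"
    then have "carrier R \<subseteq> L" using T(2) L.core_subset unfolding test_def by blast
    then show False using L.proper by blast
  qed
  then obtain t where t: "t \<in> T" by blast
  then have tR: "t \<in> carrier R" using T(2) by (auto simp: test_def)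
  have "\<not> test (T - {t})" using min t by blast
  then obtain a where a: "a \<in> carrier R" "a \<notin> ?I" and aT: "\<And>m. m \<in> T - {t} \<Longrightarrow> a \<otimes> m \<in> L"
    using T(2) unfolding test_def by blast
  show "has_minimal R ?I"
    unfolding has_minimal_def
  proof (rule bexI[of _ a], intro ballI impI)
    fix r assume r: "r \<in> carrier R" "r \<otimes> a \<notin> ?I"
    have raT: "(x \<otimes> a) \<otimes> m \<in> L" if "m \<in> T - {t}" "x \<in> carrier R" for m x
      using aT[OF that(1)] L.l_closed that a T(2) by (auto simp: m_assoc test_def)
    have rat: "(r \<otimes> a) \<otimes> t \<notin> L"
    proof
      assume "(r \<otimes> a) \<otimes> t \<in> L"
      then have "\<forall>m\<in>T. (r \<otimes> a) \<otimes> m \<in> L" using raT r by blast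
      then show False using T(2) r a m_closed unfolding test_def by blast
    qed
    have car: "(r \<otimes> a) \<otimes> t \<in> carrier R" "a \<otimes> t \<in> carrier R" using r a tR m_closed by simp_all
    obtain s where s: "s \<in> carrier R" "s \<otimes> ((r \<otimes> a) \<otimes> t) \<ominus> a \<otimes> t \<in> L"
      using L.simple[OF DiffI[OF car(1) rat] car(2)] by blast
    let ?b = "s \<otimes> (r \<otimes> a) \<ominus> a"
    have bm: "?b \<otimes> m = ((s \<otimes> r) \<otimes> a) \<otimes> m \<ominus> a \<otimes> m" if "m \<in> carrier R" for m
      using s r a that by (simp add: l_diff_distr m_closed m_assoc)
    have "?b \<otimes> m \<in> L" if m: "m \<in> T" for m
    proof (cases "m = t")
      case True
      then show ?thesis using s tR r a bm by (simp add: m_closed m_assoc)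
    next
      case False
      have "m \<in> carrier R" using m T(2) by (auto simp: test_def)
      then show ?thesis
        using raT[of m "s \<otimes> r"] aT[of m] False m s r bm L.diff_closed m_closed by simp
    qed
    then have "?b \<in> ?I" using T(2) s r a m_closed by (auto simp: test_def)
    then show "\<exists>s\<in>carrier R. s \<otimes> (r \<otimes> a) \<ominus> a \<in> ?I" by (rule bexI[OF _ s(1)])
  qed (use a in blast)
qed

end

section \<open>Group rings of virtually abelian groups\<close>

context group
begin

definition delta :: "'a \<Rightarrow> 'k::field \<Rightarrow> 'a \<Rightarrow> 'k" where
  "delta x c = (\<lambda>z. if z = x then c else 0)"

abbreviation gconv :: "('a \<Rightarrow> 'k::field) \<Rightarrow> ('a \<Rightarrow> 'k) \<Rightarrow> 'a \<Rightarrow> 'k" where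
  "gconv \<equiv> topological_groupoid.conv (group_groupoid G)"

lemma gconv_def:
  "gconv f g x = (if x \<in> carrier G then \<Sum>y\<in>{y \<in> carrier G. g y \<noteq> 0}. f (x \<otimes> inv y) * g y else 0)"
  using fun_cong[OF fun_cong[OF fun_cong[OF group_ring_simps(2)]], of f g x]
  by (simp add: group_ring_def)

lemma finite_support_delta: "x \<in> carrier G \<Longrightarrow> finite_support (delta x c)"
  by (auto simp: finite_support_def delta_def)

lemma gconv_delta:
  assumes "y \<in> carrier G" "d \<noteq> 0"
  shows "gconv f (delta y d) = (\<lambda>x. if x \<in> carrier G then f (x \<otimes> inv y) * d else 0)"
proof -
  have "{z \<in> carrier G. delta y d z \<noteq> 0} = {y}" using assms by (auto simp: delta_def)
  then show ?thesis by (auto simp: gconv_def delta_def)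
qed

lemma gconv_delta_delta:
  assumes "x \<in> carrier G" "y \<in> carrier G"
  shows "gconv (delta x c) (delta y 1) = delta (x \<otimes> y) c"
proof -
  have "z \<otimes> inv y = x \<longleftrightarrow> z = x \<otimes> y" if "z \<in> carrier G" for z
    using assms that inv_solve_right' by metis
  then show ?thesis using assms unfolding gconv_delta[OF assms(2) one_neq_zero]
    by (auto simp: delta_def fun_eq_iff)
qed

lemma gconv_one:
  assumes "finite_support f"
  shows "gconv (delta \<one> 1) f = f"
proof
  fix x
  show "gconv (delta \<one> 1) f x = f x"
  proof (cases "x \<in> carrier G")
    case True
    have fin: "finite {y \<in> carrier G. f y \<noteq> 0}" using assms by (auto simp: finite_support_def intro: finite_subset)
    have "x \<otimes> inv y = \<one> \<longleftrightarrow> y = x" if "y \<in> carrier G" for y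
      using True that by (metis inv_closed inv_equality inv_inv r_inv)
    then have "gconv (delta \<one> 1) f x = (\<Sum>y\<in>{y \<in> carrier G. f y \<noteq> 0}. if y = x then f y else 0)"
      using True by (auto simp: gconv_def delta_def intro!: sum.cong)
    then show ?thesis using True fin by (simp add: sum.delta)
  next
    case False
    then show ?thesis using assms by (auto simp: gconv_def finite_support_def)
  qed
qed

text \<open>For \<open>x\<close> in \<open>H\<close>, the map \<open>y \<mapsto> x y^-1\<close> is
  an involution of \<open>H\<close> by commutativity, and it exchanges the two convolution
  sums.\<close>

lemma gconv_commute:
  fixes f g :: "'a \<Rightarrow> 'k::field"
  assumes H: "subgroup H G" and comm: "\<And>x y. \<lbrakk>x \<in> H; y \<in> H\<rbrakk> \<Longrightarrow> x \<otimes> y = y \<otimes> x"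
    and f: "finite_support f" "{x. f x \<noteq> 0} \<subseteq> H" and g: "finite_support g" "{x. g x \<noteq> 0} \<subseteq> H"
  shows "{x. gconv f g x \<noteq> 0} \<subseteq> H" and "gconv f g = gconv g f"
proof -
  interpret H: subgroup H G by fact
  have sub: "{x. gconv f g x \<noteq> 0} \<subseteq> H" if "{x. f x \<noteq> 0} \<subseteq> H" "{x. g x \<noteq> 0} \<subseteq> H" for f g :: "'a \<Rightarrow> 'k"
  proof
    fix x assume "x \<in> {x. gconv f g x \<noteq> 0}"
    then have x: "x \<in> carrier G" "(\<Sum>y\<in>{y \<in> carrier G. g y \<noteq> 0}. f (x \<otimes> inv y) * g y) \<noteq> 0"
      by (auto simp: gconv_def split: if_splits)
    then obtain y where y: "y \<in> {y \<in> carrier G. g y \<noteq> 0}" "f (x \<otimes> inv y) * g y \<noteq> 0"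
      by (meson sum.not_neutral_contains_not_neutral)
    then have "x \<otimes> inv y \<in> H" "y \<in> H" using that by auto
    then have "(x \<otimes> inv y) \<otimes> y \<in> H" by simp
    then show "x \<in> H" using x y by (simp add: m_assoc)
  qed
  show "{x. gconv f g x \<noteq> 0} \<subseteq> H" by (rule sub[OF f(2) g(2)])
  show "gconv f g = gconv g f"
  proof
    fix x
    show "gconv f g x = gconv g f x"
    proof (cases "x \<in> H")
      case False
      then have "gconv f g x = 0" "gconv g f x = 0" using sub[OF f(2) g(2)] sub[OF g(2) f(2)] by blast+
      then show ?thesis by simp
    next
      case x: True
      then have xG: "x \<in> carrier G" by simp
      have restrict: "gconv f g x = (\<Sum>y\<in>{y \<in> H. g y \<noteq> 0 \<and> f (x \<otimes> inv y) \<noteq> 0}. f (x \<otimes> inv y) * g y)"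
        if "finite_support g" "{x. g x \<noteq> 0} \<subseteq> H" for f g :: "'a \<Rightarrow> 'k"
        unfolding gconv_def using xG that
        by (auto simp: finite_support_def intro!: sum.mono_neutral_right intro: finite_subset[of _ "{x. g x \<noteq> 0}"])
      have *: "x \<otimes> inv (x \<otimes> inv y) = y" if "y \<in> H" for y
      proof -
        have "inv (x \<otimes> inv y) = y \<otimes> inv x" using x that by (simp add: inv_mult_group)
        also have "\<dots> = inv x \<otimes> y" using x that by (intro comm) simp_all
        finally show ?thesis using x that by (simp add: m_assoc[symmetric])
      qed
      show ?thesis
        unfolding restrict[OF g] restrict[OF f]
        by (rule sum.reindex_bij_witness[of _ "\<lambda>y. x \<otimes> inv y" "\<lambda>y. x \<otimes> inv y"])
          (use x * in \<open>auto simp: mult.commute\<close>)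
    qed
  qed
qed

text \<open>Right cosets are sets \<open>H x\<close>, so each group element is an element of
  \<open>H\<close> times a representative on its right. This makes the representatives generators of
  the group ring as a left module over functions supported on \<open>H\<close>.\<close>

theorem GCR_group_ring_virtually_abelian:
  assumes "virtually_abelian G"
  shows "GCR (group_ring G :: ('a \<Rightarrow> 'k::field) ring)"
proof -
  obtain H where H: "subgroup H G" and comm: "comm_group (G\<lparr>carrier := H\<rparr>)" and fin: "finite (rcosets H)"
    using assms unfolding virtually_abelian_def by blast
  interpret H: subgroup H G by fact
  have comm: "x \<otimes> y = y \<otimes> x" if "x \<in> H" "y \<in> H" for x y
    using comm_group.axioms(1)[OF comm] that by (auto simp: comm_monoid_def comm_monoid_axioms_def)
  let ?R = "group_ring G :: ('a \<Rightarrow> 'k) ring"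
  define A where "A = {f :: 'a \<Rightarrow> 'k. finite_support f \<and> {x. f x \<noteq> 0} \<subseteq> H}"
  define rep where "rep C = (SOME x. x \<in> C)" for C :: "'a set"
  define S where "S = (\<lambda>C. delta (rep C) (1 :: 'k)) ` (rcosets H)"
  have rep: "rep C \<in> C" if C: "C \<in> rcosets H" for C
  proof -
    obtain x where "x \<in> carrier G" "C = H #> x" using C by (auto simp: RCOSETS_def)
    then have "x \<in> C" using rcos_self[OF _ H] by simp
    then show ?thesis unfolding rep_def by (rule someI)
  qed
  have repG: "rep C \<in> carrier G" if "C \<in> rcosets H" for C
    using rep[OF that] H.rcosets_carrier[OF group_axioms that] by blast
  have deltaA: "delta h c \<in> A" if "h \<in> H" for h and c :: 'k
    using that finite_support_delta[OF H.mem_carrier[OF that], of c] by (auto simp: A_def delta_def)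
  have delta_span: "delta x c \<in> left_span ?R A S" if x: "x \<in> carrier G" for x and c :: 'k
  proof -
    let ?C = "H #> x"
    have C: "?C \<in> rcosets H" using x by (rule rcosetsI[OF H.subset])
    obtain h where h: "h \<in> H" "rep ?C = h \<otimes> x" using rep[OF C] by (auto simp: r_coset_def)
    have "x = inv h \<otimes> rep ?C" using h x by (simp add: m_assoc[symmetric])
    then have "delta x c = delta (inv h) c \<otimes>\<^bsub>?R\<^esub> delta (rep ?C) 1"
      using gconv_delta_delta[of "inv h" "rep ?C" c] h repG[OF C] by (simp add: group_ring_simps)
    also have "\<dots> \<in> left_span ?R A S"
    proof (rule left_span.gen)
      show "delta (inv h) c \<in> A" using h by (intro deltaA) simp
      show "delta (rep ?C) 1 \<in> S" unfolding S_def using C by (rule imageI)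
    qed
    finally show ?thesis .
  qed
  have span: "f \<in> left_span ?R A S" if "finite D" "{x. f x \<noteq> 0} \<subseteq> D" "D \<subseteq> carrier G" for D f
    using that
  proof (induction D arbitrary: f rule: finite_induct)
    case empty
    then have "f = \<zero>\<^bsub>?R\<^esub>" by (auto simp: group_ring_simps)
    then show ?case by (simp add: left_span.zero)
  next
    case (insert x D)
    have "f(x := 0) \<in> left_span ?R A S" using insert.prems by (intro insert.IH) auto
    moreover have "delta x (f x) \<in> left_span ?R A S" using insert.prems by (intro delta_span) simp
    ultimately have "delta x (f x) \<oplus>\<^bsub>?R\<^esub> f(x := 0) \<in> left_span ?R A S" by (intro left_span.add)
    moreover have "delta x (f x) \<oplus>\<^bsub>?R\<^esub> f(x := 0) = f" by (auto simp: group_ring_simps delta_def)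
    ultimately show ?case by simp
  qed
  have SR: "S \<subseteq> carrier ?R" using finite_support_delta repG by (auto simp: S_def group_ring_simps)
  have AR: "A \<subseteq> carrier ?R" by (auto simp: A_def group_ring_simps)
  have ring: "nonunital_ring ?R" by (rule nonunital_ring_group_ring)
  have minus: "\<ominus>\<^bsub>?R\<^esub> f = (\<lambda>x. -1 * f x)" if "finite_support f" for f :: "'a \<Rightarrow> 'k"
    using finite_support_scale[OF that, of "-1"] that
    by (intro abelian_group.minus_equality[OF nonunital_ring.axioms(1)[OF ring]]) (simp_all add: group_ring_simps)
  have "finite_over_commutative ?R A S (delta \<one> 1)"
  proof (intro finite_over_commutative.intro finite_over_commutative_axioms.intro ring AR SR)
    show "delta \<one> 1 \<in> A" by (rule deltaA) simp
    show "delta \<one> 1 \<otimes>\<^bsub>?R\<^esub> f = f" if "f \<in> carrier ?R" for f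
      using that by (simp add: group_ring_simps gconv_one)
    show "finite S" using fin by (simp add: S_def)
    show "left_span ?R A S = carrier ?R"
    proof
      show "carrier ?R \<subseteq> left_span ?R A S"
      proof
        fix f assume "f \<in> carrier ?R"
        then show "f \<in> left_span ?R A S"
          using span[of "{x. f x \<noteq> 0}" f] by (simp add: group_ring_simps finite_support_def)
      qed
      show "left_span ?R A S \<subseteq> carrier ?R"
      proof
        fix f assume "f \<in> left_span ?R A S"
        then show "f \<in> carrier ?R"
          by induction (use AR SR nonunital_ring.m_closed[OF ring] in
            \<open>auto simp: abelian_monoid.zero_closed[OF abelian_group.axioms(1)[OF nonunital_ring.axioms(1)[OF ring]]]
              abelian_monoid.a_closed[OF abelian_group.axioms(1)[OF nonunital_ring.axioms(1)[OF ring]]]\<close>)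
      qed
    qed
    fix f g assume f: "f \<in> A"
    then have f': "finite_support f" "{x. f x \<noteq> 0} \<subseteq> H" by (auto simp: A_def)
    show "\<ominus>\<^bsub>?R\<^esub> f \<in> A"
      unfolding minus[OF f'(1)] using finite_support_scale[OF f'(1), of "-1"] f'(2) by (simp add: A_def)
    assume g: "g \<in> A"
    then have g': "finite_support g" "{x. g x \<noteq> 0} \<subseteq> H" by (auto simp: A_def)
    have "{x. f x + g x \<noteq> 0} \<subseteq> {x. f x \<noteq> 0} \<union> {x. g x \<noteq> 0}" by auto
    then show "f \<oplus>\<^bsub>?R\<^esub> g \<in> A"
      using finite_support_add[OF f'(1) g'(1)] f'(2) g'(2) by (auto simp: A_def group_ring_simps)
    show "f \<otimes>\<^bsub>?R\<^esub> g \<in> A" using gconv_commute(1)[OF H comm f' g'] finite_support_conv[OF f'(1) g'(1)]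
      by (simp add: A_def group_ring_simps)
    show "f \<otimes>\<^bsub>?R\<^esub> g = g \<otimes>\<^bsub>?R\<^esub> f" using gconv_commute(2)[OF H comm f' g'] by (simp add: group_ring_simps)
  qed
  then show ?thesis by (rule finite_over_commutative.GCR_finite_over_commutative)
qed

end

section \<open>The two implications\<close>

context ample_groupoid
begin

text \<open>Injectivity of ranges and of sources leaves only products of an arrow with its own
  inverse. Indicators of bisections thus behave like partial isometries.\<close>

lemma setprod_ginv:
  assumes "compact_bisection G B"
  shows "setprod (ginv G ` B) B = src G ` B" "setprod B (ginv G ` B) = tgt G ` B"
proof -
  note B = compact_bisectionD[OF assms]
  have A: "x \<in> B \<Longrightarrow> x \<in> Arr" for x using B(4) by blast
  show "setprod (ginv G ` B) B = src G ` B"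
  proof safe
    fix z assume "z \<in> setprod (ginv G ` B) B"
    then obtain x y where xy: "x \<in> B" "y \<in> B" "z = gcomp G (ginv G x) y" "src G (ginv G x) = tgt G y"
      unfolding setprod_def by blast
    then have "x = y" using inj_onD[OF B(6), of x y] A by simp
    then show "z \<in> src G ` B" using xy A by simp
  next
    fix x assume x: "x \<in> B"
    then have "src G x = gcomp G (ginv G x) x" "src G (ginv G x) = tgt G x" using A by simp_all
    then show "src G x \<in> setprod (ginv G ` B) B" unfolding setprod_def using x by blast
  qed
  show "setprod B (ginv G ` B) = tgt G ` B"
  proof safe
    fix z assume "z \<in> setprod B (ginv G ` B)"
    then obtain x y where xy: "x \<in> B" "y \<in> B" "z = gcomp G x (ginv G y)" "src G x = tgt G (ginv G y)"
      unfolding setprod_def by blast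
    then have "x = y" using inj_onD[OF B(5), of x y] A by simp
    then show "z \<in> tgt G ` B" using xy A by simp
  next
    fix x assume x: "x \<in> B"
    then have "tgt G x = gcomp G x (ginv G x)" "src G x = tgt G (ginv G x)" using A by simp_all
    then show "tgt G x \<in> setprod B (ginv G ` B)" unfolding setprod_def using x by blast
  qed
qed

lemma finite_compact_cover:
  assumes "compactin X V" "\<And>u. u \<in> V \<Longrightarrow> \<exists>W\<in>\<U>. openin X W \<and> u \<in> W"
  obtains \<W> where "finite \<W>" "\<W> \<subseteq> \<U>" "V \<subseteq> \<Union>\<W>"
proof -
  have "\<exists>\<F>. finite \<F> \<and> \<F> \<subseteq> {W \<in> \<U>. openin X W} \<and> V \<subseteq> \<Union>\<F>"
    by (rule compactinD[OF assms(1)]) (use assms(2) in auto)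
  then show thesis using that by blast
qed

text \<open>The ideal \<open>I\<close> is studied through the indicators it contains, and
  \<open>X\<close> collects the units none of whose compact open neighbourhoods has its indicator in
  \<open>I\<close>. At an isolated point of \<open>X\<close> the kernel of restriction to the
  isotropy group lies in \<open>I\<close>, so \<open>has_minimal_of_corner_hom\<close>
  applies.\<close>

lemma GCR_steinberg:
  assumes sc: "second_countable (arrows G)" and t0: "t0_space (orbit_space G)"
    and iso: "\<And>u. u \<in> units G \<Longrightarrow> GCR (group_ring (isotropy_group G u) :: ('a \<Rightarrow> 'k::field) ring)"
  shows "GCR (steinberg_algebra G :: ('a \<Rightarrow> 'k) ring)"
  unfolding GCR_iff[OF nonunital_ring_steinberg]
proof (intro allI impI)
  let ?R = "steinberg_algebra G :: ('a \<Rightarrow> 'k) ring"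
  let ?one = "indicator :: 'a set \<Rightarrow> 'a \<Rightarrow> 'k"
  fix L assume mL: "max_modular ?R L"
  define I where "I = ideal_core ?R L"
  note LL = max_modular_left_idealI[OF mL]
  have ideal: "two_sided_ideal I ?R" unfolding I_def by (rule max_modular_left_ideal.core_ideal[OF LL])
  have I_zero: "(\<lambda>x. 0) \<in> I"
    using additive_subgroup.zero_closed[OF two_sided_ideal.axioms(1)[OF ideal]] by (simp add: St_simps)
  have I_add: "(\<lambda>x. f x + g x) \<in> I" if "f \<in> I" "g \<in> I" for f g
    using additive_subgroup.a_closed[OF two_sided_ideal.axioms(1)[OF ideal] that] by (simp add: St_simps)
  have I_left: "conv f g \<in> I" if "g \<in> I" "f \<in> St" for f g
    using two_sided_ideal.I_l_closed[OF ideal that(1)] that(2) by (simp add: St_simps)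
  have I_right: "conv f g \<in> I" if "f \<in> I" "g \<in> St" for f g
    using two_sided_ideal.I_r_closed[OF ideal that(1)] that(2) by (simp add: St_simps)
  have prime: "f \<in> I" if "f \<in> St" "g \<in> St" "\<And>r. r \<in> St \<Longrightarrow> conv f (conv r g) \<in> I" "g \<notin> I" for f g
    using max_modular_left_ideal.core_prime[OF LL, of f g] that unfolding I_def St_simps by blast
  have oneSt: "?one V \<in> St" if "compact_open_units G V" for V
    by (rule St_indicator1[OF compact_open_units_bisection[OF that]])
  have subset: "?one W \<in> I" if V: "compact_open_units G V" "?one V \<in> I" and W: "compact_open_units G W" "W \<subseteq> V" for V W
  proof -
    have "conv (?one W) (?one V) = ?one W"
      unfolding conv_unit_right[OF compact_open_unitsD(4)[OF V(1)]]
      using W(2) units_inj_on(1,4)[OF compact_open_unitsD(4)[OF W(1)]] compact_open_unitsD(4)[OF W(1)]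
      by (auto simp: indicator_def fun_eq_iff subset_iff)
    then show ?thesis using I_left[OF V(2) oneSt[OF W(1)]] by simp
  qed
  \<comment> \<open>The indicators of \<open>B\<close>, of its sources and of its ranges are
    obtained from one another by multiplying with indicators of \<open>B\<close>, of its inverse or
    of sets of units.\<close>
  have bis: "?one B \<in> I \<longleftrightarrow> ?one (src G ` B) \<in> I" "?one B \<in> I \<longleftrightarrow> ?one (tgt G ` B) \<in> I"
    if B: "compact_bisection G B" for B
  proof -
    note B' = compact_bisection_ginv[OF B]
    note BA = compact_bisectionD(4)[OF B]
    have "conv (?one B) (?one (src G ` B)) = ?one B"
      unfolding conv_unit_right[OF compact_open_unitsD(4)[OF compact_open_units_src[OF B]]]
      using BA by (auto simp: indicator_def fun_eq_iff)
    moreover have "conv (?one (ginv G ` B)) (?one B) = ?one (src G ` B)"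
      unfolding conv_indicators[OF B' B] setprod_ginv[OF B] ..
    ultimately show "?one B \<in> I \<longleftrightarrow> ?one (src G ` B) \<in> I"
      using I_left St_indicator1[OF B] St_indicator1[OF B'] by metis
    have "conv (?one (tgt G ` B)) (?one B) = ?one B"
      unfolding conv_unit_left[OF compact_open_unitsD(4)[OF compact_open_units_tgt[OF B]] St_source_finite[OF St_indicator1[OF B]]]
      using BA by (auto simp: indicator_def fun_eq_iff)
    moreover have "conv (?one B) (?one (ginv G ` B)) = ?one (tgt G ` B)"
      unfolding conv_indicators[OF B B'] setprod_ginv[OF B] ..
    ultimately show "?one B \<in> I \<longleftrightarrow> ?one (tgt G ` B) \<in> I"
      using I_right St_indicator1[OF B] St_indicator1[OF B'] by metis
  qed
  define X where "X = {u \<in> units G. \<forall>V. compact_open_units G V \<and> u \<in> V \<longrightarrow> ?one V \<notin> I}"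
  \<comment> \<open>By compactness \<open>V\<close> is covered by finitely many sets whose
    indicators are in \<open>I\<close>; splitting off one set at a time makes the pieces
    disjoint.\<close>
  have kill: "?one V \<in> I" if V: "compact_open_units G V" and VX: "V \<inter> X = {}" for V
  proof -
    have "\<exists>W\<in>{W. compact_open_units G W \<and> ?one W \<in> I}. openin (unit_space G) W \<and> u \<in> W" if u: "u \<in> V" for u
    proof -
      have "u \<in> units G" "u \<notin> X" using u VX compact_open_unitsD(4)[OF V] by blast+
      then obtain W where "compact_open_units G W" "u \<in> W" "?one W \<in> I" by (auto simp: X_def)
      then show ?thesis using compact_open_unitsD(1) by blast
    qed
    then obtain \<W> where W: "finite \<W>" "\<W> \<subseteq> {W. compact_open_units G W \<and> ?one W \<in> I}" "V \<subseteq> \<Union>\<W>"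
      by (rule finite_compact_cover[OF compact_open_unitsD(2)[OF V]])
    from W V show ?thesis
    proof (induction \<W> arbitrary: V rule: finite_induct)
      case empty
      then have "?one V = (\<lambda>x. 0)" by auto
      then show ?case using I_zero by simp
    next
      case (insert W \<W>)
      have W: "compact_open_units G W" "?one W \<in> I" using insert.prems by auto
      have "?one (V \<inter> W) \<in> I"
        using subset[OF W] compact_open_units_Int[OF insert.prems(3) W(1)] by blast
      moreover have "?one (V - W) \<in> I"
        using insert.prems by (intro insert.IH compact_open_units_Diff W) auto
      ultimately have "(\<lambda>x. ?one (V \<inter> W) x + ?one (V - W) x) \<in> I" by (rule I_add)
      also have "(\<lambda>x. ?one (V \<inter> W) x + ?one (V - W) x) = ?one V" by (auto simp: indicator_def)
      finally show ?case .
    qed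
  qed
  \<comment> \<open>An ideal is only assumed to be stable under ring multiplication, so the scalar
    is attached to a local unit.\<close>
  have bis_I: "(\<lambda>x. c * ?one B x) \<in> I" if "compact_bisection G B" "?one B \<in> I" for B c
  proof -
    note V = compact_open_unitsD(4)[OF compact_open_units_tgt[OF that(1)]]
    have "conv (\<lambda>x. c * ?one (tgt G ` B) x) (?one B) = (\<lambda>x. c * ?one B x)"
      unfolding conv_scale_left conv_unit_left[OF V St_source_finite[OF St_indicator1[OF that(1)]]]
      using compact_bisectionD(4)[OF that(1)] by (auto simp: indicator_def fun_eq_iff)
    moreover have "(\<lambda>x. c * ?one (tgt G ` B) x) \<in> St"
      by (rule St_indicator[OF compact_open_units_bisection[OF compact_open_units_tgt[OF that(1)]]])
    ultimately show ?thesis using I_left[OF that(2)] by metis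
  qed
  have Xu: "X \<subseteq> units G" by (auto simp: X_def)
  have closed: "closedin (unit_space G) X"
    unfolding closedin_def topspace_unit_space
  proof (intro conjI Xu)
    show "openin (unit_space G) (units G - X)"
    proof (subst openin_subopen, intro ballI)
      fix u assume u: "u \<in> units G - X"
      then obtain V where V: "compact_open_units G V" "u \<in> V" "?one V \<in> I" by (auto simp: X_def)
      then have "V \<subseteq> units G - X" using compact_open_unitsD(4)[OF V(1)] by (auto simp: X_def)
      then show "\<exists>T. openin (unit_space G) T \<and> u \<in> T \<and> T \<subseteq> units G - X"
        using V compact_open_unitsD(1) by blast
    qed
  qed
  have push: "src G x \<in> X" if x: "x \<in> Arr" "tgt G x \<in> X" for x
  proof (rule ccontr)
    assume "src G x \<notin> X"
    then obtain V where V: "compact_open_units G V" "src G x \<in> V" "?one V \<in> I" using x by (auto simp: X_def)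
    obtain B where B: "compact_bisection G B" "x \<in> B" by (rule compact_bisection_basis[OF openin_topspace x(1)])
    let ?B = "{y \<in> B. src G y \<in> V}"
    have B': "compact_bisection G ?B" by (rule compact_bisection_src_restrict[OF B(1) V(1)])
    have "?one (src G ` ?B) \<in> I" by (rule subset[OF V(1,3) compact_open_units_src[OF B']]) blast
    then have "?one (tgt G ` ?B) \<in> I" using bis[OF B'] by simp
    moreover have "tgt G x \<in> tgt G ` ?B" using B V by blast
    ultimately show False using x(2) compact_open_units_tgt[OF B'] unfolding X_def by blast
  qed
  have "tgt G x \<in> X" if "x \<in> Arr" "src G x \<in> X" for x using push[of "ginv G x"] that by simp
  then have inv: "invariant X" unfolding invariant_def using push Xu by blast
  \<comment> \<open>If \<open>X\<close> were empty, all indicators of compact bisections would be in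
    \<open>I\<close>, hence the whole algebra, whereas \<open>I\<close> lies in the proper left
    ideal \<open>L\<close>.\<close>
  have ne: "X \<noteq> {}"
  proof
    assume "X = {}"
    then have all: "?one B \<in> I" if "compact_bisection G B" for B
      using kill[OF compact_open_units_src[OF that]] bis[OF that] by simp
    have "f \<in> I" if "f \<in> St" for f
      using that by (induction rule: St_induct) (simp_all add: I_zero I_add bis_I all)
    then show False
      using max_modular_left_ideal.proper[OF LL] max_modular_left_ideal.core_subset[OF LL]
      by (auto simp: St_simps I_def)
  qed
  \<comment> \<open>Primeness gives \<open>r\<close> with \<open>1_V1 r 1_V2\<close> outside
    \<open>I\<close>, and expanding \<open>r\<close> yields a bisection from \<open>V2\<close> to
    \<open>V1\<close> whose indicator is not in \<open>I\<close>. Its sources meet \<open>X\<close>,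
    by \<open>kill\<close>; such a source lies in \<open>V2\<close>, and it lies in
    \<open>U1\<close> because its arrow ends there and \<open>U1\<close> is invariant.\<close>
  have irr: "U1 \<inter> U2 \<inter> X \<noteq> {}"
    if U: "openin (unit_space G) U1" "openin (unit_space G) U2" "invariant U1" "invariant U2"
      "U1 \<inter> X \<noteq> {}" "U2 \<inter> X \<noteq> {}" for U1 U2
  proof -
    have ex: "\<exists>V. compact_open_units G V \<and> V \<subseteq> U \<and> ?one V \<notin> I" if U: "openin (unit_space G) U" "U \<inter> X \<noteq> {}" for U
    proof -
      obtain u where u: "u \<in> U" "u \<in> X" using U by blast
      obtain V where "compact_open_units G V" "u \<in> V" "V \<subseteq> U" by (rule compact_open_units_basis[OF U(1) u(1)])
      then show ?thesis using u by (auto simp: X_def)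
    qed
    obtain V1 where V1: "compact_open_units G V1" "V1 \<subseteq> U1" "?one V1 \<notin> I" using ex[OF U(1,5)] by blast
    obtain V2 where V2: "compact_open_units G V2" "V2 \<subseteq> U2" "?one V2 \<notin> I" using ex[OF U(2,6)] by blast
    note V1u = compact_open_unitsD(4)[OF V1(1)] and V2u = compact_open_unitsD(4)[OF V2(1)]
    obtain r where r: "r \<in> St" "conv (?one V1) (conv r (?one V2)) \<notin> I"
      using prime[OF oneSt[OF V1(1)] oneSt[OF V2(1)]] V1(3) V2(3) by blast
    have "\<exists>B. compact_bisection G B \<and> ?one {x \<in> {x \<in> B. src G x \<in> V2}. tgt G x \<in> V1} \<notin> I"
    proof (rule ccontr)
      assume "\<not> ?thesis"
      then have all: "?one {x \<in> {x \<in> B. src G x \<in> V2}. tgt G x \<in> V1} \<in> I" if "compact_bisection G B" for B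
        using that by blast
      have "conv (?one V1) (conv r (?one V2)) \<in> I"
        using r(1)
      proof (induction rule: St_induct)
        case zero
        then show ?case by (simp add: conv_zero_left conv_zero_right I_zero)
      next
        case (add B c g)
        have sf: "source_finite (conv (?one B) (?one V2))" "source_finite (conv g (?one V2))"
          "source_finite (\<lambda>x. c * conv (?one B) (?one V2) x)"
          using St_source_finite St_conv[OF _ oneSt[OF V2(1)]] St_indicator1[OF add(1)] add(2) St_scale by blast+
        have BA: "B \<subseteq> Arr" using compact_bisectionD(4)[OF add(1)] .
        have "conv (?one V1) (conv (?one B) (?one V2)) = ?one {x \<in> {x \<in> B. src G x \<in> V2}. tgt G x \<in> V1}"
          using BA unfolding conv_unit_left[OF V1u sf(1)]
          by (auto simp: conv_unit_right[OF V2u] indicator_def fun_eq_iff)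
        moreover have "(\<lambda>x. c * ?one {x \<in> {x \<in> B. src G x \<in> V2}. tgt G x \<in> V1} x) \<in> I"
          by (intro bis_I all add(1) compact_bisection_tgt_restrict compact_bisection_src_restrict V1(1) V2(1))
        ultimately show ?case
          unfolding conv_add_left conv_scale_left conv_add_right[OF sf(3,2)] conv_scale_right
          using I_add add(3) by simp
      qed
      then show False using r(2) by contradiction
    qed
    then obtain B where B: "compact_bisection G B" "?one {x \<in> {x \<in> B. src G x \<in> V2}. tgt G x \<in> V1} \<notin> I" by blast
    let ?B = "{x \<in> {x \<in> B. src G x \<in> V2}. tgt G x \<in> V1}"
    have B': "compact_bisection G ?B"
      by (intro compact_bisection_tgt_restrict compact_bisection_src_restrict B V1 V2)
    have "src G ` ?B \<inter> X \<noteq> {}" using kill[OF compact_open_units_src[OF B']] bis[OF B'] B(2) by blast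
    then obtain x where x: "x \<in> B" "src G x \<in> V2" "tgt G x \<in> V1" "src G x \<in> X" by blast
    have "x \<in> Arr" using x(1) compact_bisectionD(4)[OF B(1)] by blast
    then have "src G x \<in> U1" using invariantD[OF U(3)] x(3) V1(2) by blast
    then show ?thesis using x V2(2) by blast
  qed
  obtain u V0 where u: "u \<in> X" "openin (unit_space G) V0" "V0 \<inter> X = {u}"
    using isolated_point_of_irreducible[OF sc t0 closed inv ne irr] by blast
  have uu: "u \<in> units G" using u Xu by blast
  have "u \<in> V0" using u(3) by blast
  then obtain V where V: "compact_open_units G V" "u \<in> V" "V \<subseteq> V0"
    by (rule compact_open_units_basis[OF u(2)])
  have VX: "V \<inter> X = {u}" using u V by blast
  have orbX: "orbit u \<subseteq> X" using invariant_orbit[OF inv] u(1) by blast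
  have Vu: "V \<inter> orbit u = {u}" using VX orbX orbit_self[OF uu] by blast
  have e: "?one V \<notin> I" using u(1) V by (auto simp: X_def)
  note hom = surj_ring_hom_isotropy[OF uu V(1) Vu, where 'k = 'k]
  show "has_minimal ?R (ideal_core ?R L)"
  proof (rule idempotent.has_minimal_of_corner_hom[OF idempotent_unit[OF V(1)] mL _ hom iso[OF uu]])
    show "?one V \<notin> ideal_core ?R L" using e by (simp add: I_def)
    fix f assume "f \<in> carrier (corner ?R (?one V))"
      and h0: "(\<lambda>x. if x \<in> carrier (isotropy_group G u) then f x else 0) = \<zero>\<^bsub>group_ring (isotropy_group G u)\<^esub>"
    then have f: "f \<in> St" "\<And>x. f x \<noteq> 0 \<Longrightarrow> x \<in> Arr \<and> src G x \<in> V \<and> tgt G x \<in> V"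
      unfolding corner_St_iff[OF V(1)] by blast+
    \<comment> \<open>The hypothesis only covers isotropy arrows. The corner condition makes every
      arrow over \<open>u\<close> at which \<open>f\<close> is nonzero an isotropy arrow, so
      \<open>f\<close> vanishes on the whole fibre.\<close>
    have vanish: "f x = 0" if x: "x \<in> fib u" for x
    proof (rule ccontr)
      assume nz: "f x \<noteq> 0"
      then have "tgt G x \<in> V \<inter> orbit u" using f(2)[OF nz] x by (auto simp: orbit_def)
      then have "x \<in> carrier (isotropy_group G u)" using Vu x by (auto simp: isotropy_group_def fib_def)
      then show False using fun_cong[OF h0, of x] nz by (simp add: group_ring_def)
    qed
    obtain W0 where W0: "openin (unit_space G) W0" "u \<in> W0" "\<And>x. \<lbrakk>x \<in> Arr; src G x \<in> W0\<rbrakk> \<Longrightarrow> f x = 0"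
      using St_vanish_nbhd[OF f(1) uu vanish] by metis
    obtain W where W: "compact_open_units G W" "u \<in> W" "W \<subseteq> W0"
      by (rule compact_open_units_basis[OF W0(1,2)])
    \<comment> \<open>As \<open>f\<close> vanishes over \<open>W\<close>, it equals
      \<open>f 1_(V - W)\<close>; and \<open>V - W\<close> avoids \<open>X\<close>, since
      \<open>u\<close> was the only point of \<open>X\<close> in \<open>V\<close>.\<close>
    have VW: "compact_open_units G (V - W)" by (rule compact_open_units_Diff[OF V(1) W(1)])
    have "(V - W) \<inter> X = {}" using VX W(2) by auto
    then have "?one (V - W) \<in> I" by (rule kill[OF VW])
    then have "conv f (?one (V - W)) \<in> I" using I_left f(1) by blast
    also have "conv f (?one (V - W)) = f"
      unfolding conv_unit_right[OF compact_open_unitsD(4)[OF VW]]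
      using f(2) W0(3) W(3) by (auto simp: fun_eq_iff)
    finally show "f \<in> ideal_core ?R L" by (simp add: I_def)
  qed
qed

end

section \<open>Orbit modules and separation of orbits\<close>

context ample_groupoid
begin

text \<open>The coefficients of \<open>f\<close> acting on the basis vector \<open>u\<close> of the free module over an orbit,
  the module induced from the trivial representation of the isotropy group at \<open>u\<close>.\<close>

definition orbit_coeff :: "('a \<Rightarrow> 'k::field) \<Rightarrow> 'a \<Rightarrow> 'a \<Rightarrow> 'k" where
  "orbit_coeff f u w = (\<Sum>x\<in>{x \<in> fib u. f x \<noteq> 0 \<and> tgt G x = w}. f x)"

lemma orbit_coeff_eq:
  assumes "finite Y" "Y \<subseteq> {x \<in> fib u. tgt G x = w}" "\<And>x. \<lbrakk>x \<in> fib u; f x \<noteq> 0; tgt G x = w\<rbrakk> \<Longrightarrow> x \<in> Y"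
  shows "orbit_coeff f u w = (\<Sum>x\<in>Y. f x)"
  unfolding orbit_coeff_def using assms by (auto intro!: sum.mono_neutral_left)

lemma orbit_coeff_finite: "source_finite f \<Longrightarrow> finite {x \<in> fib u. f x \<noteq> 0 \<and> tgt G x = w}"
  by (rule finite_subset[OF _ source_finiteD(2)]) auto

lemma orbit_coeff_add:
  assumes "source_finite f" "source_finite g"
  shows "orbit_coeff (\<lambda>x. f x + g x) u w = orbit_coeff f u w + orbit_coeff g u w"
proof -
  let ?Y = "{x \<in> fib u. f x \<noteq> 0 \<and> tgt G x = w} \<union> {x \<in> fib u. g x \<noteq> 0 \<and> tgt G x = w}"
  have fin: "finite ?Y" using orbit_coeff_finite assms by blast
  have "orbit_coeff (\<lambda>x. f x + g x) u w = (\<Sum>x\<in>?Y. f x + g x)" by (rule orbit_coeff_eq[OF fin]) auto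
  moreover have "orbit_coeff f u w = (\<Sum>x\<in>?Y. f x)" by (rule orbit_coeff_eq[OF fin]) auto
  moreover have "orbit_coeff g u w = (\<Sum>x\<in>?Y. g x)" by (rule orbit_coeff_eq[OF fin]) auto
  ultimately show ?thesis by (simp add: sum.distrib)
qed

lemma orbit_coeff_scale:
  assumes "source_finite f"
  shows "orbit_coeff (\<lambda>x. c * f x) u w = c * orbit_coeff f u w"
  using orbit_coeff_eq[OF orbit_coeff_finite[OF assms], of u w u w "\<lambda>x. c * f x"]
  by (auto simp: orbit_coeff_def sum_distrib_left)

lemma orbit_coeff_diff:
  assumes "source_finite f" "source_finite g"
  shows "orbit_coeff (\<lambda>x. f x - g x) u w = orbit_coeff f u w - orbit_coeff g u w"
proof -
  have "source_finite (\<lambda>x. -1 * g x)" using assms(2) by (simp add: source_finite_def)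
  from orbit_coeff_add[OF assms(1) this] show ?thesis unfolding orbit_coeff_scale[OF assms(2)] by simp
qed

lemma orbit_coeff_vanish: "(\<And>x. x \<in> fib u \<Longrightarrow> f x = 0) \<Longrightarrow> orbit_coeff f u w = 0"
  unfolding orbit_coeff_def by (rule sum.neutral) simp

lemma orbit_coeff_nonzero:
  assumes "orbit_coeff f u w \<noteq> 0"
  obtains x where "x \<in> fib u" "tgt G x = w"
  using assms unfolding orbit_coeff_def by (rule sum.not_neutral_contains_not_neutral) blast

text \<open>A bisection acts on the basis vectors of the module as a partial bijection taking
  sources to ranges; \<open>x = b y\<close> matches the arrows of the two sums.\<close>

lemma orbit_coeff_conv_left:
  fixes f :: "'a \<Rightarrow> 'k::field"
  assumes B: "compact_bisection G B" and f: "source_finite f"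
  shows "b \<in> B \<Longrightarrow> orbit_coeff (conv (indicator B) f) u (tgt G b) = orbit_coeff f u (src G b)"
    and "w \<notin> tgt G ` B \<Longrightarrow> orbit_coeff (conv (indicator B) f) u w = 0"
proof -
  note BD = compact_bisectionD[OF B]
  note left = conv_indicator_left[OF BD(4,6) f]
  show "orbit_coeff (conv (indicator B) f) u w = 0" if "w \<notin> tgt G ` B"
    unfolding orbit_coeff_def
  proof (rule sum.neutral, safe)
    fix x assume "x \<in> fib u" "w = tgt G x"
    then show "conv (indicator B) f x = 0" using left(2)[of x] that by (simp add: fib_def)
  qed
  show "orbit_coeff (conv (indicator B) f) u (tgt G b) = orbit_coeff f u (src G b)" if b: "b \<in> B"
  proof -
    have bA: "b \<in> Arr" using b BD(4) by blast
    have eq: "conv (indicator B) f x = f (gcomp G (ginv G b) x)" if "x \<in> fib u" "tgt G x = tgt G b" for x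
      using left(1)[OF _ b] that by (simp add: fib_def)
    show ?thesis
      unfolding orbit_coeff_def
      by (rule sum.reindex_bij_witness[of _ "\<lambda>y. gcomp G b y" "\<lambda>x. gcomp G (ginv G b) x"])
        (use bA eq in \<open>auto simp: fib_def\<close>)
  qed
qed

text \<open>The bisection acts first and moves the basis vector at the source of \<open>b\<close> to
  the one at its range.\<close>

lemma orbit_coeff_conv_right:
  fixes f :: "'a \<Rightarrow> 'k::field"
  assumes B: "compact_bisection G B"
  shows "b \<in> B \<Longrightarrow> orbit_coeff (conv f (indicator B)) (src G b) w = orbit_coeff f (tgt G b) w"
    and "u \<notin> src G ` B \<Longrightarrow> orbit_coeff (conv f (indicator B)) u w = 0"
proof -
  note BD = compact_bisectionD[OF B]
  note right = conv_indicator_right[OF BD(4,5)]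
  show "orbit_coeff (conv f (indicator B)) u w = 0" if "u \<notin> src G ` B"
    by (rule orbit_coeff_vanish) (use right(2) that in \<open>auto simp: fib_def\<close>)
  show "orbit_coeff (conv f (indicator B)) (src G b) w = orbit_coeff f (tgt G b) w" if b: "b \<in> B"
  proof -
    have bA: "b \<in> Arr" using b BD(4) by blast
    have eq: "conv f (indicator B) x = f (gcomp G x (ginv G b))" if "x \<in> fib (src G b)" for x
      using right(1)[OF _ b, of x f] that by (simp add: fib_def)
    show ?thesis
      unfolding orbit_coeff_def
      by (rule sum.reindex_bij_witness[of _ "\<lambda>y. gcomp G y b" "\<lambda>x. gcomp G x (ginv G b)"])
        (use bA eq in \<open>auto simp: fib_def\<close>)
  qed
qed

text \<open>The sum of all coefficients of \<open>f\<close> applied to the basis vector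
  \<open>v\<close>.\<close>

definition augmentation :: "('a \<Rightarrow> 'k::field) \<Rightarrow> 'a \<Rightarrow> 'k" where
  "augmentation f v = (\<Sum>x\<in>{x \<in> fib v. f x \<noteq> 0}. f x)"

text \<open>The indicator of \<open>U\<close> contributes 1 exactly over the sources of
  \<open>U\<close>, an open and closed set of units even if \<open>U\<close> is not closed in the
  arrow space.\<close>

lemma augmentation_locally_constant:
  fixes f :: "'a \<Rightarrow> 'k::field"
  assumes "f \<in> St" and v: "v \<in> units G"
  shows "\<exists>N. openin (unit_space G) N \<and> v \<in> N \<and> (\<forall>w\<in>N. augmentation f w = augmentation f v)"
  using assms(1)
proof (induction rule: St_induct)
  case zero
  then show ?case using v openin_topspace[of "unit_space G"] topspace_unit_space
    by (intro exI[of _ "units G"]) (auto simp: augmentation_def)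
next
  case (add U c g)
  obtain N where N: "openin (unit_space G) N" "v \<in> N" "\<And>w. w \<in> N \<Longrightarrow> augmentation g w = augmentation g v"
    using add(3) by blast
  note U = compact_bisectionD[OF add(1)] and sU = compact_open_unitsD[OF compact_open_units_src[OF add(1)]]
  have eq: "augmentation (\<lambda>x. c * indicator U x + g x) w = (if w \<in> src G ` U then c else 0) + augmentation g w" for w
  proof -
    let ?T = "{x \<in> fib w. x \<in> U}"
    have T: "?T = (if w \<in> src G ` U then {inv_into U (src G) w} else {})"
      using U(4,5) by (auto simp: fib_def f_inv_into_f inv_into_into subset_iff inj_on_def)
    have fg: "finite {x \<in> fib w. g x \<noteq> 0}" using source_finiteD(2)[OF St_source_finite[OF add(2)]] .
    let ?Y = "?T \<union> {x \<in> fib w. g x \<noteq> 0}"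
    have fin: "finite ?Y" using fg T by simp
    have "augmentation (\<lambda>x. c * indicator U x + g x) w = (\<Sum>x\<in>?Y. c * indicator U x + g x)"
      unfolding augmentation_def using fin by (intro sum.mono_neutral_left) (auto simp: indicator_def)
    also have "\<dots> = (\<Sum>x\<in>?Y. c * indicator U x) + (\<Sum>x\<in>?Y. g x)" by (rule sum.distrib)
    also have "(\<Sum>x\<in>?Y. g x) = augmentation g w"
      unfolding augmentation_def using fin by (intro sum.mono_neutral_right) auto
    also have "(\<Sum>x\<in>?Y. c * indicator U x) = (\<Sum>x\<in>?T. c)"
      using fin by (intro sum.mono_neutral_cong_right) (auto simp: indicator_def)
    also have "\<dots> = (if w \<in> src G ` U then c else 0)" unfolding T by simp
    finally show ?thesis .
  qed
  define M where "M = (if v \<in> src G ` U then src G ` U else units G - src G ` U)"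
  have "openin (unit_space G) M" "v \<in> M"
    using sU(1,3) v openin_topspace[of "unit_space G"] topspace_unit_space by (auto simp: M_def)
  then show ?case
  proof (intro exI[of _ "N \<inter> M"] conjI ballI)
    fix w assume w: "w \<in> N \<inter> M"
    then have "w \<in> src G ` U \<longleftrightarrow> v \<in> src G ` U" by (simp add: M_def split: if_splits)
    then show "augmentation (\<lambda>x. c * indicator U x + g x) w = augmentation (\<lambda>x. c * indicator U x + g x) v"
      using N(3)[of w] w unfolding eq by simp
  qed (use N in \<open>auto intro: openin_Int\<close>)
qed

lemma exclude_finite:
  assumes "u \<in> units G" "finite E"
  obtains W where "compact_open_units G W" "u \<in> W" "W \<inter> E \<subseteq> {u}"
proof -
  have "closedin (unit_space G) (E \<inter> units G - {u})"
    using assms Hausdorff_units by (auto intro!: closedin_Hausdorff_finite simp: topspace_unit_space)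
  then have "openin (unit_space G) (units G - (E \<inter> units G - {u}))"
    using openin_diff[OF openin_topspace] topspace_unit_space by metis
  then obtain W where "compact_open_units G W" "u \<in> W" "W \<subseteq> units G - (E \<inter> units G - {u})"
    by (rule compact_open_units_basis) (use assms in auto)
  then show thesis using that[of W] by blast
qed

text \<open>A single coefficient need not be locally constant. Restricting ranges to a
  \<open>W\<close> that contains \<open>w\<close> but no other range of the support of
  \<open>f\<close> over \<open>v\<close> turns the coefficient into an augmentation, which stays
  nonzero nearby; some coefficient of \<open>f\<close> must then be nonzero there.\<close>

lemma orbit_coeff_nonzero_open:
  fixes f :: "'a \<Rightarrow> 'k::field"
  assumes f: "f \<in> St" and v: "v \<in> units G" and nz: "orbit_coeff f v w \<noteq> 0"
  obtains N where "openin (unit_space G) N" "v \<in> N" "\<And>v'. v' \<in> N \<Longrightarrow> \<exists>w'. orbit_coeff f v' w' \<noteq> 0"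
proof -
  have sf: "source_finite f" by (rule St_source_finite[OF f])
  obtain x0 where x0: "x0 \<in> fib v" "tgt G x0 = w"
    by (rule orbit_coeff_nonzero[OF nz])
  then have w: "w \<in> units G" by (auto simp: fib_def)
  obtain W where W: "compact_open_units G W" "w \<in> W" "W \<inter> tgt G ` {x \<in> fib v. f x \<noteq> 0} \<subseteq> {w}"
    by (rule exclude_finite[OF w finite_imageI[OF source_finiteD(2)[OF sf]]])
  define g where "g = conv (indicator W) f"
  have g: "g = (\<lambda>x. if x \<in> Arr \<and> tgt G x \<in> W then f x else 0)"
    unfolding g_def by (rule conv_unit_left[OF compact_open_unitsD(4)[OF W(1)] sf])
  have gSt: "g \<in> St" unfolding g_def
    by (rule St_conv[OF St_indicator1[OF compact_open_units_bisection[OF W(1)]] f])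
  have "augmentation g v = orbit_coeff f v w"
    unfolding augmentation_def orbit_coeff_def using W(2,3) by (intro sum.cong) (auto simp: g fib_def)
  then have nz': "augmentation g v \<noteq> 0" using nz by simp
  obtain N where N: "openin (unit_space G) N" "v \<in> N" "\<And>z. z \<in> N \<Longrightarrow> augmentation g z = augmentation g v"
    using augmentation_locally_constant[OF gSt v] by blast
  have "\<exists>w'. orbit_coeff f z w' \<noteq> 0" if z: "z \<in> N" for z
  proof (rule ccontr)
    assume *: "\<not> ?thesis"
    let ?Y = "{x \<in> fib z. g x \<noteq> 0}"
    have fin: "finite ?Y" using source_finiteD(2)[OF St_source_finite[OF gSt]] .
    have "augmentation g z = (\<Sum>w'\<in>tgt G ` ?Y. \<Sum>x\<in>{x \<in> ?Y. tgt G x = w'}. g x)"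
      unfolding augmentation_def by (rule sum.image_gen[OF fin])
    also have "\<dots> = (\<Sum>w'\<in>tgt G ` ?Y. orbit_coeff f z w')"
      unfolding orbit_coeff_def by (intro sum.cong refl) (auto simp: g fib_def split: if_splits)
    also have "\<dots> = 0" using * by simp
    finally show False using N(3)[OF z] nz' by simp
  qed
  then show thesis using that N by blast
qed

text \<open>The annihilator of the single basis vector \<open>u\<close>; the annihilator of the
  whole module is its \<open>ideal_core\<close>.\<close>

definition orbit_annihilator :: "'a \<Rightarrow> ('a \<Rightarrow> 'k::field) set" where
  "orbit_annihilator u = {f \<in> St. \<forall>w. orbit_coeff f u w = 0}"

lemma orbit_annihilator_left:
  fixes f g :: "'a \<Rightarrow> 'k::field"
  assumes f: "f \<in> orbit_annihilator u" and "g \<in> St"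
  shows "conv g f \<in> orbit_annihilator u"
proof -
  have fS: "f \<in> St" "\<And>w. orbit_coeff f u w = 0" using f by (auto simp: orbit_annihilator_def)
  have "orbit_coeff (conv g f) u w = 0" for w
    using assms(2)
  proof (induction rule: St_induct)
    case zero
    then show ?case by (simp add: conv_zero_left orbit_coeff_vanish)
  next
    case (add U c h)
    have "orbit_coeff (conv (indicator U) f) u w = 0"
    proof (cases "w \<in> tgt G ` U")
      case True
      then show ?thesis using orbit_coeff_conv_left(1)[OF add(1) St_source_finite[OF fS(1)]] fS(2) by auto
    qed (use orbit_coeff_conv_left(2)[OF add(1) St_source_finite[OF fS(1)]] in simp)
    moreover have sf: "source_finite (conv (indicator U) f)" "source_finite (conv h f)"
        "source_finite (\<lambda>x. c * conv (indicator U) f x)"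
      using St_source_finite St_conv[OF _ fS(1)] St_indicator1[OF add(1)] add(2) St_scale by blast+
    ultimately show ?case
      unfolding conv_add_left conv_scale_left orbit_coeff_add[OF sf(3,2)] orbit_coeff_scale[OF sf(1)] using add(3) by simp
  qed
  then show ?thesis using St_conv[OF assms(2) fS(1)] by (simp add: orbit_annihilator_def)
qed

lemma orbit_coeff_unit:
  assumes V: "compact_open_units G V" and u: "u \<in> V"
  shows "orbit_coeff (indicator V :: 'a \<Rightarrow> 'k::field) u w = (if w = u then 1 else 0)"
proof -
  have Vu: "V \<subseteq> units G" using compact_open_unitsD(4)[OF V] .
  have "x = u" if "x \<in> fib u" "x \<in> V" for x using that Vu by (auto simp: fib_def)
  moreover have "u \<in> fib u" "tgt G u = u" using u Vu unit_arrow by (auto simp: fib_def)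
  ultimately have "{x \<in> fib u. (indicator V x :: 'k) \<noteq> 0 \<and> tgt G x = w} = (if w = u then {u} else {})"
    using u by (auto simp: indicator_def)
  then show ?thesis using u by (simp add: orbit_coeff_def)
qed

text \<open>The orbit module is simple: a nonzero vector is cut down to one of its basis components,
  which is moved to \<open>u\<close> along an arrow and rescaled. The indicator of any compact open
  \<open>V\<close> around \<open>u\<close> fixes \<open>u\<close>, hence is a right
  identity.\<close>

lemma max_modular_orbit_annihilator:
  assumes u: "u \<in> units G"
  shows "max_modular (steinberg_algebra G) (orbit_annihilator u :: ('a \<Rightarrow> 'k::field) set)"
proof -
  let ?R = "steinberg_algebra G :: ('a \<Rightarrow> 'k) ring" and ?L = "orbit_annihilator u :: ('a \<Rightarrow> 'k) set"
  have L: "f \<in> ?L \<longleftrightarrow> f \<in> St \<and> (\<forall>w. orbit_coeff f u w = 0)" for f by (simp add: orbit_annihilator_def)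
  have ring: "nonunital_ring ?R" by (rule nonunital_ring_steinberg)
  have diff: "f \<ominus>\<^bsub>?R\<^esub> g \<in> ?L \<longleftrightarrow> (\<forall>w. orbit_coeff f u w = orbit_coeff g u w)" if "f \<in> St" "g \<in> St" for f g
    unfolding St_minus[OF that] L orbit_coeff_diff[OF that[THEN St_source_finite]] using St_diff[OF that] by simp
  have left: "left_ideal ?L ?R"
  proof (intro left_ideal.intro left_ideal_axioms.intro ring additive_subgroup.intro
      group.subgroupI abelian_group.a_group[OF nonunital_ring.axioms(1)[OF ring]])
    show "?L \<subseteq> carrier (add_monoid ?R)" by (auto simp: L St_simps)
    show "?L \<noteq> {}" using L[of "\<lambda>x. 0"] St_zero by (auto simp: orbit_coeff_vanish)
    show "f \<otimes>\<^bsub>add_monoid ?R\<^esub> g \<in> ?L" if "f \<in> ?L" "g \<in> ?L" for f g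
      using that St_add[of f g] orbit_coeff_add[OF St_source_finite[of f] St_source_finite[of g], of u]
      by (auto simp: L St_simps)
    show "inv\<^bsub>add_monoid ?R\<^esub> f \<in> ?L" if f: "f \<in> ?L" for f
    proof -
      have "\<zero>\<^bsub>?R\<^esub> \<ominus>\<^bsub>?R\<^esub> f \<in> ?L"
        using f diff[OF St_zero, of f] unfolding L by (simp add: St_simps orbit_coeff_vanish)
      moreover have "\<zero>\<^bsub>?R\<^esub> \<ominus>\<^bsub>?R\<^esub> f = \<ominus>\<^bsub>?R\<^esub> f"
        using f abelian_group.a_inv_closed[OF nonunital_ring.axioms(1)[OF ring], of f]
          abelian_monoid.l_zero[OF abelian_group.axioms(1)[OF nonunital_ring.axioms(1)[OF ring]]]
        by (simp add: a_minus_def L St_def)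
      ultimately show ?thesis by (simp add: a_inv_def)
    qed
    show "x \<otimes>\<^bsub>?R\<^esub> a \<in> ?L" if "a \<in> ?L" "x \<in> carrier ?R" for a x
      using orbit_annihilator_left[OF that(1)] that(2) by (simp add: St_simps)
  qed
  obtain V where V: "compact_open_units G V" "u \<in> V"
    using compact_open_units_basis[OF openin_topspace] u topspace_unit_space by metis
  let ?c = "indicator V :: 'a \<Rightarrow> 'k"
  have cS: "?c \<in> St" by (rule St_indicator1[OF compact_open_units_bisection[OF V(1)]])
  have cL: "?c \<notin> ?L"
    using orbit_coeff_unit[OF V, of u, where 'k = 'k] by (auto simp: L intro!: exI[of _ u])
  have mod: "f \<ominus>\<^bsub>?R\<^esub> f \<otimes>\<^bsub>?R\<^esub> ?c \<in> ?L" if f: "f \<in> St" for f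
  proof -
    have "orbit_coeff f u w = orbit_coeff (conv f ?c) u w" for w
      unfolding orbit_coeff_def conv_unit_right[OF compact_open_unitsD(4)[OF V(1)]]
      using V(2) by (intro sum.cong) (auto simp: fib_def)
    then show ?thesis using diff[OF f St_conv[OF f cS]] by (simp add: St_simps)
  qed
  have maximal: "\<exists>z\<in>St. z \<otimes>\<^bsub>?R\<^esub> y \<ominus>\<^bsub>?R\<^esub> ?c \<in> ?L" if y: "y \<in> St" "y \<notin> ?L" for y
  proof -
    have sf: "source_finite y" by (rule St_source_finite[OF y(1)])
    obtain w where w: "orbit_coeff y u w \<noteq> 0" using y by (auto simp: L)
    obtain x where x: "x \<in> fib u" "tgt G x = w" by (rule orbit_coeff_nonzero[OF w])
    then have xA: "x \<in> Arr" "src G x = u" by (auto simp: fib_def)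
    have wu: "w \<in> units G" using x xA by auto
    obtain W where W: "compact_open_units G W" "w \<in> W" "W \<inter> tgt G ` {x \<in> fib u. y x \<noteq> 0} \<subseteq> {w}"
      by (rule exclude_finite[OF wu finite_imageI[OF source_finiteD(2)[OF sf]]])
    obtain B0 where B0: "compact_bisection G B0" "ginv G x \<in> B0"
      by (rule compact_bisection_basis[OF openin_topspace inv_arrow[OF xA(1)]])
    \<comment> \<open>The inverse of \<open>x\<close> leads from \<open>w\<close> to
      \<open>u\<close>. Restricting sources to \<open>W\<close> discards every other basis vector
      occurring in \<open>y\<close> applied to \<open>u\<close>.\<close>
    define B where "B = {z \<in> B0. src G z \<in> W}"
    have B: "compact_bisection G B" unfolding B_def by (rule compact_bisection_src_restrict[OF B0(1) W(1)])
    have xB: "ginv G x \<in> B" using B0(2) xA x W(2) by (simp add: B_def)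
    have co: "orbit_coeff (conv (indicator B) y) u w' = (if w' = u then orbit_coeff y u w else 0)" for w'
    proof (cases "w' \<in> tgt G ` B")
      case True
      then obtain b where b: "b \<in> B" "w' = tgt G b" by blast
      then have 1: "orbit_coeff (conv (indicator B) y) u w' = orbit_coeff y u (src G b)"
        using orbit_coeff_conv_left(1)[OF B sf] by simp
      show ?thesis
      proof (cases "src G b = w")
        case True
        have "src G b = src G (ginv G x)" using True x xA by simp
        then have "b = ginv G x" by (rule inj_onD[OF compact_bisectionD(5)[OF B] _ b(1) xB])
        then show ?thesis using 1 True b xA by simp
      next
        case False
        have "src G b \<in> W" using b by (simp add: B_def)
        then have "src G b \<notin> tgt G ` {x \<in> fib u. y x \<noteq> 0}" using W(3) False by blast
        then have "{x \<in> fib u. y x \<noteq> 0 \<and> tgt G x = src G b} = {}" by (auto simp: image_iff)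
        then have "orbit_coeff y u (src G b) = 0" unfolding orbit_coeff_def by (simp only: sum.empty)
        moreover have "w' \<noteq> u"
        proof
          assume "w' = u"
          then have "tgt G b = tgt G (ginv G x)" using b xA by simp
          then have "b = ginv G x" by (rule inj_onD[OF compact_bisectionD(6)[OF B] _ b(1) xB])
          then show False using False x xA by simp
        qed
        ultimately show ?thesis using 1 by simp
      qed
    next
      case False
      moreover have "u \<in> tgt G ` B" using xB xA by (auto intro!: image_eqI[of _ _ "ginv G x"])
      ultimately show ?thesis using orbit_coeff_conv_left(2)[OF B sf False] by auto
    qed
    let ?z = "\<lambda>x. inverse (orbit_coeff y u w) * indicator B x :: 'k"
    have zS: "?z \<in> St" by (rule St_indicator[OF B])
    have "orbit_coeff (conv ?z y) u w' = orbit_coeff ?c u w'" for w'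
      unfolding conv_scale_left orbit_coeff_scale[OF St_source_finite[OF St_conv[OF St_indicator1[OF B] y(1)]]]
        orbit_coeff_unit[OF V] co using w by simp
    then have "?z \<otimes>\<^bsub>?R\<^esub> y \<ominus>\<^bsub>?R\<^esub> ?c \<in> ?L" using diff[OF St_conv[OF zS y(1)] cS] by (simp add: St_simps)
    then show ?thesis using zS by blast
  qed
  show ?thesis
    unfolding max_modular_def St_simps(1)
    by (rule conjI, rule left, rule bexI[of _ ?c], intro conjI ballI) (use cS cL mod maximal in auto)
qed

text \<open>A bisection through an arrow from \<open>u\<close> to \<open>v\<close> moves the basis
  vector \<open>u\<close> to \<open>v\<close>, and by linearity such basis vectors are all that has
  to be tested.\<close>

lemma core_orbit_annihilator:
  fixes f :: "'a \<Rightarrow> 'k::field"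
  assumes u: "u \<in> units G"
  shows "f \<in> ideal_core (steinberg_algebra G) (orbit_annihilator u) \<longleftrightarrow>
    f \<in> St \<and> (\<forall>v\<in>orbit u. \<forall>w. orbit_coeff f v w = 0)"
proof (intro iffI conjI ballI allI)
  assume "f \<in> ideal_core (steinberg_algebra G) (orbit_annihilator u)"
  then have f: "f \<in> St" "\<And>r. r \<in> St \<Longrightarrow> conv f r \<in> orbit_annihilator u"
    by (auto simp: ideal_core_def St_simps)
  show "f \<in> St" by (rule f)
  fix v w assume "v \<in> orbit u"
  then obtain x where x: "x \<in> Arr" "src G x = u" "tgt G x = v" by (auto simp: orbit_def fib_def)
  obtain B where B: "compact_bisection G B" "x \<in> B" by (rule compact_bisection_basis[OF openin_topspace x(1)])
  have "conv f (indicator B) \<in> orbit_annihilator u" by (rule f(2)[OF St_indicator1[OF B(1)]])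
  then show "orbit_coeff f v w = 0" using orbit_coeff_conv_right(1)[OF B, of f w] x by (simp add: orbit_annihilator_def)
next
  assume f: "f \<in> St \<and> (\<forall>v\<in>orbit u. \<forall>w. orbit_coeff f v w = 0)"
  have "orbit_coeff (conv f r) u w = 0" if "r \<in> St" for r w
    using that
  proof (induction rule: St_induct)
    case zero
    then show ?case by (simp add: conv_zero_right orbit_coeff_vanish)
  next
    case (add U c h)
    have 0: "orbit_coeff (conv f (indicator U)) u w = 0"
    proof (cases "u \<in> src G ` U")
      case True
      then obtain b where b: "b \<in> U" "u = src G b" by blast
      have "tgt G b \<in> orbit u" using b compact_bisectionD(4)[OF add(1)] by (auto simp: orbit_def fib_def)
      then show ?thesis using orbit_coeff_conv_right(1)[OF add(1) b(1), of f w] f b by simp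
    qed (rule orbit_coeff_conv_right(2)[OF add(1)])
    have sf: "source_finite (\<lambda>x. c * indicator U x :: 'k)" "source_finite h"
      "source_finite (conv f (indicator U))" "source_finite (conv f h)" "source_finite (\<lambda>x. c * conv f (indicator U) x)"
      using St_source_finite St_conv[OF conjunct1[OF f]] St_indicator1[OF add(1)] add(2) St_scale St_indicator[OF add(1)] by blast+
    show ?case
      unfolding conv_add_right[OF sf(1,2)] conv_scale_right orbit_coeff_add[OF sf(5,4)] orbit_coeff_scale[OF sf(3)] 0
      using add(3) by simp
  qed
  then have "conv f r \<in> orbit_annihilator u" if "r \<in> St" for r
    using that St_conv[OF conjunct1[OF f]] by (simp add: orbit_annihilator_def)
  then show "f \<in> ideal_core (steinberg_algebra G) (orbit_annihilator u)"
    using f by (simp add: ideal_core_def St_simps)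
qed

text \<open>Suppose that \<open>u\<close> and \<open>v\<close> have the same open invariant
  neighbourhoods but different orbits. Both orbit modules then have the same annihilator, and a left
  ideal \<open>R a\<close> minimal modulo it is isomorphic to each, by
  \<open>r a \<mapsto> r a p u\<close> and \<open>r a \<mapsto> r a q v\<close>. The contradiction
  is an element of \<open>R a\<close> that one map kills and the other does not.\<close>

lemma t0_of_GCR:
  assumes GCR: "GCR (steinberg_algebra G :: ('a \<Rightarrow> 'k::field) ring)"
  shows "t0_space (orbit_space G)"
  unfolding t0_orbit_space_iff
proof (intro ballI impI, rule ccontr)
  let ?R = "steinberg_algebra G :: ('a \<Rightarrow> 'k) ring"
  fix u v assume u: "u \<in> units G" and v: "v \<in> units G"
    and ind: "\<forall>W. openin (unit_space G) W \<and> invariant W \<longrightarrow> (u \<in> W \<longleftrightarrow> v \<in> W)" and nv: "v \<notin> orbit u"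
  let ?Lu = "orbit_annihilator u :: ('a \<Rightarrow> 'k) set" and ?Lv = "orbit_annihilator v :: ('a \<Rightarrow> 'k) set"
  \<comment> \<open>A nonzero coefficient at a point of the orbit of \<open>p\<close> persists on an
    open set \<open>N\<close>. The saturation of \<open>N\<close> contains \<open>p\<close>, hence
    \<open>q\<close>, so \<open>N\<close> meets the orbit of \<open>q\<close>, where the
    coefficients vanish.\<close>
  have sub: "ideal_core ?R (orbit_annihilator q) \<subseteq> ideal_core ?R (orbit_annihilator p)"
    if pq: "p \<in> units G" "q \<in> units G"
      "\<And>W. openin (unit_space G) W \<Longrightarrow> invariant W \<Longrightarrow> p \<in> W \<Longrightarrow> q \<in> W" for p q
  proof
    fix f :: "'a \<Rightarrow> 'k" assume "f \<in> ideal_core ?R (orbit_annihilator q)"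
    then have f: "f \<in> St" "\<And>z w. z \<in> orbit q \<Longrightarrow> orbit_coeff f z w = 0"
      unfolding core_orbit_annihilator[OF pq(2)] by auto
    have "orbit_coeff f z w = 0" if z: "z \<in> orbit p" for z w
    proof (rule ccontr)
      assume nz: "orbit_coeff f z w \<noteq> 0"
      have zu: "z \<in> units G" using z orbit_units by blast
      obtain N where N: "openin (unit_space G) N" "z \<in> N" "\<And>v'. v' \<in> N \<Longrightarrow> \<exists>w'. orbit_coeff f v' w' \<noteq> 0"
        using orbit_coeff_nonzero_open[OF f(1) zu nz] by metis
      have "N \<subseteq> units G" using openin_subset[OF N(1)] topspace_unit_space by simp
      then have "z \<in> saturation N" using saturation_superset N(2) by blast
      then have "p \<in> saturation N" using invariant_orbit[OF invariant_saturation z] by simp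
      then have "q \<in> saturation N" using pq(3)[OF openin_saturation[OF N(1)] invariant_saturation] by simp
      then obtain n where n: "n \<in> N" "q \<in> orbit n" by (auto simp: mem_saturation)
      have "n \<in> units G" using n(1) \<open>N \<subseteq> units G\<close> by blast
      then have "n \<in> orbit q"
        using invariant_orbit[OF orbit_invariant n(2), of q] orbit_self[OF pq(2)] by simp
      then show False using f(2) N(3)[OF n(1)] by blast
    qed
    then show "f \<in> ideal_core ?R (orbit_annihilator p)"
      unfolding core_orbit_annihilator[OF pq(1)] using f(1) by simp
  qed
  have core: "ideal_core ?R ?Lu = ideal_core ?R ?Lv"
    using sub[OF u v] sub[OF v u] ind by blast
  note mu = max_modular_orbit_annihilator[OF u, where 'k = 'k] and mv = max_modular_orbit_annihilator[OF v, where 'k = 'k]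
  let ?I = "ideal_core ?R ?Lu"
  have "has_minimal ?R ?I" using GCR mu unfolding GCR_iff[OF nonunital_ring_steinberg] by blast
  then obtain a where a: "a \<in> St" "a \<notin> ?I"
    and min: "\<And>r. r \<in> St \<Longrightarrow> conv r a \<notin> ?I \<Longrightarrow> \<exists>s\<in>St. conv s (conv r a) \<ominus>\<^bsub>?R\<^esub> a \<in> ?I"
    unfolding has_minimal_def St_simps(1,2) by blast
  obtain p where p: "p \<in> St" "conv a p \<notin> ?Lu" using a by (auto simp: ideal_core_def St_simps)
  obtain q where q: "q \<in> St" "conv a q \<notin> ?Lv" using a unfolding core by (auto simp: ideal_core_def St_simps)
  obtain V where V: "compact_open_units G V" "u \<in> V"
    using compact_open_units_basis[OF openin_topspace] u topspace_unit_space by metis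
  let ?one = "indicator :: 'a set \<Rightarrow> 'a \<Rightarrow> 'k"
  have VS: "?one V \<in> St" by (rule St_indicator1[OF compact_open_units_bisection[OF V(1)]])
  obtain s where s: "s \<in> St" "conv s (conv a p) \<ominus>\<^bsub>?R\<^esub> ?one V \<in> ?Lu"
    using max_modular_left_ideal.simple[OF max_modular_left_idealI[OF mu], of "conv a p" "?one V"]
      p(2) St_conv[OF a(1) p(1)] VS unfolding St_simps(1,2) by blast
  define x where "x = conv s a"
  have xS: "x \<in> St" unfolding x_def by (rule St_conv[OF s(1) a(1)])
  have assoc: "conv (conv f g) h = conv f (conv g h)" if "g \<in> St" "h \<in> St" for f g h :: "'a \<Rightarrow> 'k"
    using conv_assoc that[THEN St_source_finite] by blast
  have xp: "orbit_coeff (conv x p) u u = 1"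
  proof -
    have "conv s (conv a p) = conv x p" unfolding x_def by (rule assoc[OF a(1) p(1), symmetric])
    then have "orbit_coeff (\<lambda>z. conv x p z - ?one V z) u u = 0"
      using s(2) St_minus[OF St_conv[OF xS p(1)] VS] by (simp add: orbit_annihilator_def)
    then show ?thesis
      unfolding orbit_coeff_diff[OF St_source_finite[OF St_conv[OF xS p(1)]] St_source_finite[OF VS]]
      using orbit_coeff_unit[OF V, of u, where 'k = 'k] by simp
  qed
  have sfxq: "source_finite (conv x q)" by (rule St_source_finite[OF St_conv[OF xS q(1)]])
  \<comment> \<open>Since \<open>u\<close> is not in the orbit of \<open>v\<close>, the set
    \<open>W\<close> contains no basis vector that occurs in \<open>x q v\<close>, but it contains
    \<open>u\<close>. Thus \<open>1_W x\<close> kills \<open>q v\<close>, while its value at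
    \<open>p u\<close> keeps the coefficient 1 at \<open>u\<close>.\<close>
  obtain W where W: "compact_open_units G W" "u \<in> W" "W \<inter> tgt G ` {y \<in> fib v. conv x q y \<noteq> 0} \<subseteq> {u}"
    by (rule exclude_finite[OF u finite_imageI[OF source_finiteD(2)[OF sfxq]]])
  have nu: "u \<notin> orbit v"
    using nv invariant_orbit[OF orbit_invariant, of u v u] orbit_self[OF u] by blast
  have WS: "?one W \<in> St" by (rule St_indicator1[OF compact_open_units_bisection[OF W(1)]])
  note Wu = compact_open_unitsD(4)[OF W(1)]
  have "orbit_coeff (conv (?one W) (conv x q)) v w = 0" for w
  proof (rule orbit_coeff_vanish)
    fix y assume y: "y \<in> fib v"
    have "tgt G y \<noteq> u" using y nu by (auto simp: orbit_def)
    then have "tgt G y \<in> W \<Longrightarrow> conv x q y = 0" using W(3) y by blast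
    then show "conv (?one W) (conv x q) y = 0" unfolding conv_unit_left[OF Wu sfxq] by simp
  qed
  then have 1: "conv (conv (?one W) x) q \<in> ?Lv"
    unfolding assoc[OF xS q(1)] using St_conv[OF WS St_conv[OF xS q(1)]] by (simp add: orbit_annihilator_def)
  let ?y = "conv (?one W) x"
  have y: "?y = conv (conv (?one W) s) a" unfolding x_def by (rule assoc[OF s(1) a(1), symmetric])
  have yS: "?y \<in> St" by (rule St_conv[OF WS xS])
  \<comment> \<open>Otherwise minimality recovers \<open>a\<close> from \<open>?y\<close> modulo the
    common annihilator, and \<open>a q\<close> would kill \<open>v\<close> because
    \<open>?y q\<close> does.\<close>
  have "?y \<in> ?I"
  proof (rule ccontr)
    assume "?y \<notin> ?I"
    then obtain t where t: "t \<in> St" "conv t ?y \<ominus>\<^bsub>?R\<^esub> a \<in> ?I"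
      using min[OF St_conv[OF WS s(1)]] unfolding y by blast
    have tyS: "conv t ?y \<in> St" by (rule St_conv[OF t(1) yS])
    have "(\<lambda>z. conv t ?y z - a z) \<in> ideal_core ?R ?Lv" using t(2) unfolding core St_minus[OF tyS a(1)] .
    then have "conv (\<lambda>z. conv t ?y z + -1 * a z) q \<in> ?Lv" using q(1) by (auto simp: ideal_core_def St_simps)
    then have "(\<lambda>z. conv (conv t ?y) q z + -1 * conv a q z) \<in> ?Lv"
      unfolding conv_add_left conv_scale_left .
    then have c0: "orbit_coeff (conv (conv t ?y) q) v w + -1 * orbit_coeff (conv a q) v w = 0" for w
      using orbit_coeff_add[of "conv (conv t ?y) q" "\<lambda>z. -1 * conv a q z" v w]
        orbit_coeff_scale[OF St_source_finite[OF St_conv[OF a(1) q(1)]], of "-1" v w]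
        St_source_finite[OF St_conv[OF tyS q(1)]] St_source_finite[OF St_scale[OF St_conv[OF a(1) q(1)], of "-1"]]
      by (simp add: orbit_annihilator_def)
    have "conv t (conv ?y q) \<in> ?Lv" by (rule orbit_annihilator_left[OF 1 t(1)])
    then have "orbit_coeff (conv (conv t ?y) q) v w = 0" for w
      unfolding assoc[OF yS q(1)] by (simp add: orbit_annihilator_def)
    then have "conv a q \<in> ?Lv" using c0 St_conv[OF a(1) q(1)] by (simp add: orbit_annihilator_def)
    then show False using q(2) by contradiction
  qed
  then have "conv ?y p \<in> ?Lu" using p(1) by (auto simp: ideal_core_def St_simps)
  then have "orbit_coeff (conv (?one W) (conv x p)) u u = 0"
    unfolding assoc[OF xS p(1)] by (simp add: orbit_annihilator_def)
  moreover have "tgt G u = u" "src G u = u" using u by simp_all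
  then have "orbit_coeff (conv (?one W) (conv x p)) u u = orbit_coeff (conv x p) u u"
    using orbit_coeff_conv_left(1)[OF compact_open_units_bisection[OF W(1)] St_source_finite[OF St_conv[OF xS p(1)]] W(2), of u] by simp
  ultimately show False using xp by simp
qed

end

theorem (in ample_groupoid) GCR_steinberg_iff:
  assumes "second_countable (arrows G)"
  shows "GCR (steinberg_algebra G :: ('a \<Rightarrow> 'k::field) ring) \<longleftrightarrow> t0_space (orbit_space G) \<and>
    (\<forall>u\<in>units G. GCR (group_ring (isotropy_group G u) :: ('a \<Rightarrow> 'k) ring))"
proof (intro iffI conjI ballI)
  assume GCR: "GCR (steinberg_algebra G :: ('a \<Rightarrow> 'k) ring)"
  then show t0: "t0_space (orbit_space G)" by (rule t0_of_GCR)
  fix u assume u: "u \<in> units G"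
  obtain V where "compact_open_units G V" "V \<inter> orbit u = {u}"
    by (rule isolated_in_orbit[OF assms t0 u])
  then show "GCR (group_ring (isotropy_group G u) :: ('a \<Rightarrow> 'k) ring)"
    by (rule GCR_isotropy[OF GCR _ _ u])
qed (use GCR_steinberg[OF assms] in blast)

theorem theorem7p2:
  fixes G :: "'a groupoid"
  assumes "ample_groupoid G" and "second_countable (arrows G)"
  shows "(GCR (steinberg_algebra G :: ('a \<Rightarrow> 'k::field) ring) \<longleftrightarrow>
           t0_space (orbit_space G) \<and>
           (\<forall>u\<in>units G. GCR (group_ring (isotropy_group G u) :: ('a \<Rightarrow> 'k) ring)))
       \<and> ((\<forall>u\<in>units G. virtually_abelian (isotropy_group G u)) \<longrightarrow>
           (GCR (steinberg_algebra G :: ('a \<Rightarrow> complex) ring) \<longleftrightarrow> t0_space (orbit_space G)))"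
proof (intro conjI impI)
  interpret ample_groupoid G by fact
  show "GCR (steinberg_algebra G :: ('a \<Rightarrow> 'k::field) ring) \<longleftrightarrow> t0_space (orbit_space G) \<and>
      (\<forall>u\<in>units G. GCR (group_ring (isotropy_group G u) :: ('a \<Rightarrow> 'k) ring))"
    by (rule GCR_steinberg_iff[OF assms(2)])
  assume "\<forall>u\<in>units G. virtually_abelian (isotropy_group G u)"
  then have "\<forall>u\<in>units G. GCR (group_ring (isotropy_group G u) :: ('a \<Rightarrow> complex) ring)"
    using group.GCR_group_ring_virtually_abelian[OF group_isotropy_group] by blast
  then show "GCR (steinberg_algebra G :: ('a \<Rightarrow> complex) ring) \<longleftrightarrow> t0_space (orbit_space G)"
    using GCR_steinberg_iff[OF assms(2), where 'k = complex] by blast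
qed

end
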